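(* Let $F:\mathcal S\to\mathcal P$ be a morphism of graded vector bundles over a graded manifold $\mathcal M=(M,C^\infty_{\mathcal M})$ (over the identity). Consider the subsheaves $\ker(F)\subseteq\mathcal S$ and $\operatorname{im}(F)\subseteq\mathcal P$, given by $\ker(F)(U)=\ker(F_U)$ and $\operatorname{im}(F)(U)=F_U(\mathcal S(U))$. 1. If $F_{(m)}:\mathcal S_{(m)}\to\mathcal P_{(m)}$ is injective for all $m\in M$, then $\operatorname{im}(F)$ is a subbundle of $\mathcal P$. 2. If $F$ is surjective, then $\ker(F)$ is a subbundle of $\mathcal S$. 3. In general, the assumption that the graded rank of $F_{(m)}$ is constant in $m$ is not sufficient: there exist a graded manifold $\mathcal M$, graded vector bundles $\mathcal S,\mathcal P$ over $\mathcal M$ and a morphism $F:\mathcal S\to\mathcal P$ such that the graded dimension of the image of $F_{(m)}$ is the same for all $m\in M$, but $\operatorname{im}(F)$ is not a subbundle of $\mathcal P$.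
   Context: Graded conventions. "Graded" means $\mathbb Z$-graded over $\mathbb R$. A graded vector space is a sequence $V=(V_i)_{i\in\mathbb Z}$ of real vector spaces; an element $v\in V$ is by definition homogeneous ($v\in V_i$, $i=|v|$) and only elements of equal degree are added. Its graded dimension is $(\dim V_i)_{i}$. A graded linear map of degree $k$ is a family of linear maps $V_i\to W_{i+k}$. Graded algebras are associative, unital and graded commutative, $ab=(-1)^{|a||b|}ba$. Graded manifolds. For non-negative integers $(m_j)_{j\in\mathbb Z}$ with finite sum, let $\tilde m=\sum_{j\neq0}m_j$ and let $\xi^1,\dots,\xi^{\tilde m}$ be variables, exactly $m_j$ of them of degree $j$ for each $j\ne 0$. The sheaf $C^\infty_{(m_j)}$ on $\mathbb R^{m_0}$ assigns to an open $U$ the graded algebra whose degree $k$ elements are formal power series $\sum_{\mathbf p}f_{\mathbf p}\xi^{\mathbf p}$, $f_{\mathbf p}\in C^\infty(U)$, over multi-indices $\mathbf p\in\mathbb N_0^{\tilde m}$ with $\sum_i p_i|\xi^i|=k$ and $p_i\in\{0,1\}$ if $|\xi^i|$ is odd, multiplied by the rules of graded commutativity. A graded manifold of dimension $(m_j)$ is a pair $\mathcal M=(M,C^\infty_{\mathcal M})$, with $M$ a second countable Hausdorff space and $C^\infty_{\mathcal M}$ a sheaf of graded algebras on $M$ locally isomorphic to restrictions of $C^\infty_{(m_j)}$ to open subsets of $\mathbb R^{m_0}$ (so $M$ is a smooth manifold). The value $f(m)\in\mathbb R$ of a graded function $f$ at $m$ is the value of its body: in local coordinates $f(m)=f_{\mathbf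 0}(m)$ if $|f|=0$, and $f(m)=0$ if $|f|\neq0$. All graded manifolds are assumed connected (i.e. $M$ is connected). Graded vector bundles. A sheaf of $C^\infty_{\mathcal M}$-modules is a sheaf $\mathcal S$ of graded vector spaces on $M$ such that each $\mathcal S(U)$ is a graded $C^\infty_{\mathcal M}(U)$-module, compatibly with restrictions. A (local) frame over $U$ is a finite family $s_1,\dots,s_r\in\mathcal S(U)$ such that each $s\in\mathcal S(U)$ is $\sum f^i s_i$ for unique $f^i\in C^\infty_{\mathcal M}(U)$; its restrictions to smaller open sets are frames; its graded rank is $(r_j)$, $r_j=\#\{i:|s_i|=j\}$. A graded vector bundle over $\mathcal M$ is a sheaf of $C^\infty_{\mathcal M}$-modules admitting frames, all of the same graded rank, over the sets of some open cover of $M$. A morphism $F:\mathcal S\to\mathcal P$ of graded vector bundles over $\mathcal M$ (over the identity) is a morphism of sheaves such that each $F_U:\mathcal S(U)\to\mathcal P(U)$ is $C^\infty_{\mathcal M}(U)$-linear of degree $0$. $F$ is surjective if $F_U$ is surjective for every open $U\subseteq M$ (equivalently, $F_M$ is surjective). Fibers. Let $\mathfrak J_m=\{[f]_m\in C^\infty_{\mathcal M,m}: f(m)=0\}$. The fiber of $\mathcal S$ at $m$ is $\mathcal S_{(m)}=\mathcal S_m/(\mathfrak J_m\cdot\mathcal S_m)$, where $\mathcal S_m$ is the stalk; $F$ induces a degree $0$ linear map $F_{(m)}:\mathcal S_{(m)}\to\mathcal P_{(m)}$ via the map of stalks. Subbundles. Let $\mathcal S$ be a graded vector bundle with frames consisting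 of $r$ elements. A subsheaf $\mathcal L\subseteq\mathcal S$ is a subbundle if each $\mathcal L(U)$ is a $C^\infty_{\mathcal M}(U)$-submodule of $\mathcal S(U)$ and there is a fixed $J\subseteq\{1,\dots,r\}$ such that each $m\in M$ has an open neighborhood $U$ and a frame $s_1,\dots,s_r$ for $\mathcal S$ over $U$ such that $\{s_i\}_{i\in J}$ is a frame for $\mathcal L$ over $U$. *)

theory Defs
  imports "HOL-Analysis.Analysis" "HOL-Library.Function_Algebras"
begin

section \<open>Real-valued functions as a real vector space\<close>

instantiation "fun" :: (type, real_vector) real_vector
begin

definition scaleR_fun :: "real \<Rightarrow> ('a \<Rightarrow> 'b) \<Rightarrow> 'a \<Rightarrow> 'b"
  where "scaleR_fun c f = (\<lambda>x. c *\<^sub>R f x)"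

instance
  by standard (simp_all add: scaleR_fun_def fun_eq_iff scaleR_add_right scaleR_add_left)

end

section \<open>Graded linear algebra\<close>

definition linear_map_on :: "'a::real_vector set \<Rightarrow> ('a \<Rightarrow> 'b::real_vector) \<Rightarrow> bool"
  where "linear_map_on V f \<longleftrightarrow>
    (\<forall>x\<in>V. \<forall>y\<in>V. f (x + y) = f x + f y) \<and>
    (\<forall>c. \<forall>x\<in>V. f (c *\<^sub>R x) = c *\<^sub>R f x)"

text \<open>The components of a graded vector space are subspaces of one ambient vector space meeting
  only in \<open>0\<close>. So a nonzero homogeneous element has exactly one degree, and a family of linear
  maps on the components is the same as one function on homogeneous elements that is linear on
  each component. Elements of different degrees are never added.\<close>

definition graded_vector_space :: "(int \<Rightarrow> 'a::real_vector set) \<Rightarrow> bool"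
  where "graded_vector_space V \<longleftrightarrow>
    (\<forall>k. subspace (V k)) \<and> (\<forall>i j. i \<noteq> j \<longrightarrow> V i \<inter> V j = {0})"

definition graded_bilinear ::
    "(int \<Rightarrow> 'a::real_vector set) \<Rightarrow> (int \<Rightarrow> 'b::real_vector set) \<Rightarrow> (int \<Rightarrow> 'c::real_vector set)
      \<Rightarrow> ('a \<Rightarrow> 'b \<Rightarrow> 'c) \<Rightarrow> bool"
  where "graded_bilinear V W Z b \<longleftrightarrow> (\<forall>i j.
    (\<forall>v\<in>V i. \<forall>w\<in>W j. b v w \<in> Z (i + j)) \<and>
    (\<forall>w\<in>W j. linear_map_on (V i) (\<lambda>v. b v w)) \<and>
    (\<forall>v\<in>V i. linear_map_on (W j) (b v)))"

section \<open>Sheaves\<close>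

text \<open>\<open>sect S U k\<close> is the degree \<open>k\<close> part of \<open>S(U)\<close> and \<open>restr S U V\<close> the restriction from \<open>U\<close>
  to \<open>V\<close>.\<close>

record ('m, 's) gsheaf =
  sect :: "'m set \<Rightarrow> int \<Rightarrow> 's set"
  restr :: "'m set \<Rightarrow> 'm set \<Rightarrow> 's \<Rightarrow> 's"

definition sheaf_of_graded_vector_spaces ::
    "'m topology \<Rightarrow> ('m, 's::real_vector, 'z) gsheaf_scheme \<Rightarrow> bool"
  where "sheaf_of_graded_vector_spaces X S \<longleftrightarrow>
    (\<forall>U. openin X U \<longrightarrow> graded_vector_space (sect S U)) \<and>
    (\<forall>U V k. openin X U \<and> openin X V \<and> V \<subseteq> U \<longrightarrow>
       restr S U V ` sect S U k \<subseteq> sect S V k \<and> linear_map_on (sect S U k) (restr S U V)) \<and>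
    (\<forall>U k. openin X U \<longrightarrow> (\<forall>s\<in>sect S U k. restr S U U s = s)) \<and>
    (\<forall>U V W k. openin X U \<and> openin X V \<and> openin X W \<and> W \<subseteq> V \<and> V \<subseteq> U \<longrightarrow>
       (\<forall>s\<in>sect S U k. restr S V W (restr S U V s) = restr S U W s)) \<and>
    (\<forall>\<U> k \<sigma>. (\<forall>U\<in>\<U>. openin X U \<and> \<sigma> U \<in> sect S U k) \<and>
       (\<forall>U\<in>\<U>. \<forall>V\<in>\<U>. restr S U (U \<inter> V) (\<sigma> U) = restr S V (U \<inter> V) (\<sigma> V)) \<longrightarrow>
       (\<exists>!s. s \<in> sect S (\<Union>\<U>) k \<and> (\<forall>U\<in>\<U>. restr S (\<Union>\<U>) U s = \<sigma> U)))"

record ('m, 'a) galgebra = "('m, 'a) gsheaf" +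
  gmult :: "'m set \<Rightarrow> 'a \<Rightarrow> 'a \<Rightarrow> 'a"
  gone :: "'m set \<Rightarrow> 'a"

definition sheaf_of_graded_algebras ::
    "'m topology \<Rightarrow> ('m, 'a::real_vector, 'z) galgebra_scheme \<Rightarrow> bool"
  where "sheaf_of_graded_algebras X A \<longleftrightarrow>
    sheaf_of_graded_vector_spaces X A \<and>
    (\<forall>U. openin X U \<longrightarrow>
       graded_bilinear (sect A U) (sect A U) (sect A U) (gmult A U) \<and>
       gone A U \<in> sect A U 0 \<and>
       (\<forall>i. \<forall>a\<in>sect A U i. gmult A U (gone A U) a = a \<and> gmult A U a (gone A U) = a) \<and>
       (\<forall>i j k. \<forall>a\<in>sect A U i. \<forall>b\<in>sect A U j. \<forall>c\<in>sect A U k.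
          gmult A U (gmult A U a b) c = gmult A U a (gmult A U b c)) \<and>
       (\<forall>i j. \<forall>a\<in>sect A U i. \<forall>b\<in>sect A U j.
          gmult A U a b = (if odd (i * j) then - gmult A U b a else gmult A U b a))) \<and>
    (\<forall>U V. openin X U \<and> openin X V \<and> V \<subseteq> U \<longrightarrow>
       restr A U V (gone A U) = gone A V \<and>
       (\<forall>i j. \<forall>a\<in>sect A U i. \<forall>b\<in>sect A U j.
          restr A U V (gmult A U a b) = gmult A V (restr A U V a) (restr A U V b)))"

section \<open>The local model\<close>

text \<open>An open set of \<open>\<real>\<^sup>n\<close> is an open set of \<^const>\<open>Euclidean_space\<close> \<open>n\<close>, whose points are the
  sequences vanishing from index \<open>n\<close> on; this includes \<open>n = 0\<close>. A function is of class \<open>C\<^sup>k\<close> if its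
  partial derivatives up to order \<open>k\<close> exist and are continuous.\<close>

primrec C_on :: "nat \<Rightarrow> nat \<Rightarrow> (nat \<Rightarrow> real) set \<Rightarrow> ((nat \<Rightarrow> real) \<Rightarrow> real) \<Rightarrow> bool"
  where
    "C_on 0 n U f \<longleftrightarrow> continuous_map (subtopology (Euclidean_space n) U) euclideanreal f"
  | "C_on (Suc k) n U f \<longleftrightarrow>
       continuous_map (subtopology (Euclidean_space n) U) euclideanreal f \<and>
       (\<exists>g. \<forall>i<n. C_on k n U (g i) \<and>
          (\<forall>x\<in>U. ((\<lambda>t. f (x(i := t))) has_real_derivative g i x) (at (x i))))"

definition smooth_on :: "nat \<Rightarrow> (nat \<Rightarrow> real) set \<Rightarrow> ((nat \<Rightarrow> real) \<Rightarrow> real) \<Rightarrow> bool"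
  where "smooth_on n U f \<longleftrightarrow> (\<forall>k. C_on k n U f)"

text \<open>The list \<open>ds\<close> holds the degrees of the variables \<open>\<xi>\<close>, numbered from 0.\<close>

definition graded_variables :: "(int \<Rightarrow> nat) \<Rightarrow> int list \<Rightarrow> bool"
  where "graded_variables dm ds \<longleftrightarrow> 0 \<notin> set ds \<and> (\<forall>j. j \<noteq> 0 \<longrightarrow> count_list ds j = dm j)"

definition multi_index :: "int list \<Rightarrow> (nat \<Rightarrow> nat) \<Rightarrow> bool"
  where "multi_index ds p \<longleftrightarrow>
    (\<forall>i\<ge>length ds. p i = 0) \<and> (\<forall>i<length ds. odd (ds ! i) \<longrightarrow> p i \<le> 1)"

definition mdegree :: "int list \<Rightarrow> (nat \<Rightarrow> nat) \<Rightarrow> int"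
  where "mdegree ds p = (\<Sum>i<length ds. int (p i) * ds ! i)"

text \<open>The sign in \<open>\<xi>\<^sup>p \<xi>\<^sup>q = \<plusminus> \<xi>\<^sup>p\<^sup>+\<^sup>q\<close>, where \<open>\<xi>\<^sup>p = (\<xi>\<^sup>0)\<^bsup>p 0\<^esup> (\<xi>\<^sup>1)\<^bsup>p 1\<^esup> \<dots>\<close>: for \<open>j < i\<close> the \<open>q j\<close> factors
  number \<open>j\<close> of the second monomial move past the \<open>p i\<close> factors number \<open>i\<close> of the first.\<close>

definition koszul_sign :: "int list \<Rightarrow> (nat \<Rightarrow> nat) \<Rightarrow> (nat \<Rightarrow> nat) \<Rightarrow> real"
  where "koszul_sign ds p q =
    (if even (\<Sum>i<length ds. \<Sum>j<i. (int (p i) * ds ! i) * (int (q j) * ds ! j)) then 1 else -1)"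

text \<open>A formal power series is given by its coefficients: \<open>f p x\<close> is the value at \<open>x\<close> of the
  coefficient of \<open>\<xi>\<^sup>p\<close>. Coefficients are extended by \<open>0\<close> outside of \<open>U\<close>, so that distinct functions
  represent distinct series. The product coefficient at a non-admissible \<open>r\<close> is \<open>0\<close>, as odd
  variables square to \<open>0\<close>.\<close>

type_synonym power_series = "(nat \<Rightarrow> nat) \<Rightarrow> (nat \<Rightarrow> real) \<Rightarrow> real"

definition local_model :: "nat \<Rightarrow> int list \<Rightarrow> (nat \<Rightarrow> real, power_series) galgebra"
  where "local_model n ds = \<lparr>
    sect = (\<lambda>U k. {f. \<forall>p.
      (if multi_index ds p \<and> mdegree ds p = k then smooth_on n U (f p) else f p = 0) \<and>
      (\<forall>x. x \<notin> U \<longrightarrow> f p x = 0)}),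
    restr = (\<lambda>U V f p x. if x \<in> V then f p x else 0),
    gmult = (\<lambda>U f g r x. if multi_index ds r
      then (\<Sum>(p, q) | p + q = r. koszul_sign ds p q * f p x * g q x) else 0),
    gone = (\<lambda>U p x. if p = 0 \<and> x \<in> U then 1 else 0) \<rparr>"

section \<open>Graded manifolds\<close>

text \<open>A chart on \<open>V\<close> is a homeomorphism \<open>\<phi>\<close> onto an open subset of \<open>\<real>\<^sup>n\<close>, \<open>n = dm 0\<close>, with an
  isomorphism \<open>\<psi>\<close> of the sheaves of graded algebras over it.\<close>

definition graded_chart ::
    "'m topology \<Rightarrow> ('m, 'a::real_vector) galgebra \<Rightarrow> (int \<Rightarrow> nat) \<Rightarrow> int list \<Rightarrow> 'm set
      \<Rightarrow> ('m \<Rightarrow> nat \<Rightarrow> real) \<Rightarrow> ('m set \<Rightarrow> 'a \<Rightarrow> power_series) \<Rightarrow> bool"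
  where "graded_chart X A dm ds V \<phi> \<psi> \<longleftrightarrow>
    (let E = Euclidean_space (dm 0); B = local_model (dm 0) ds in
      graded_variables dm ds \<and> openin X V \<and> openin E (\<phi> ` V) \<and>
      homeomorphic_map (subtopology X V) (subtopology E (\<phi> ` V)) \<phi> \<and>
      (\<forall>U. openin X U \<and> U \<subseteq> V \<longrightarrow>
         (\<forall>k. bij_betw (\<psi> U) (sect A U k) (sect B (\<phi> ` U) k) \<and>
              linear_map_on (sect A U k) (\<psi> U)) \<and>
         \<psi> U (gone A U) = gone B (\<phi> ` U) \<and>
         (\<forall>i j. \<forall>a\<in>sect A U i. \<forall>b\<in>sect A U j.
            \<psi> U (gmult A U a b) = gmult B (\<phi> ` U) (\<psi> U a) (\<psi> U b))) \<and>
      (\<forall>U W k. openin X U \<and> openin X W \<and> W \<subseteq> U \<and> U \<subseteq> V \<longrightarrow>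
         (\<forall>a\<in>sect A U k. \<psi> W (restr A U W a) = restr B (\<phi> ` U) (\<phi> ` W) (\<psi> U a))))"

definition graded_manifold_of_dim ::
    "'m topology \<Rightarrow> ('m, 'a::real_vector) galgebra \<Rightarrow> (int \<Rightarrow> nat) \<Rightarrow> bool"
  where "graded_manifold_of_dim X A dm \<longleftrightarrow>
    Hausdorff_space X \<and> second_countable X \<and> connected_space X \<and>
    finite {j. dm j \<noteq> 0} \<and> sheaf_of_graded_algebras X A \<and>
    (\<forall>m\<in>topspace X. \<exists>ds V \<phi> \<psi>. m \<in> V \<and> graded_chart X A dm ds V \<phi> \<psi>)"

definition graded_manifold :: "'m topology \<Rightarrow> ('m, 'a::real_vector) galgebra \<Rightarrow> bool"
  where "graded_manifold X A \<longleftrightarrow> (\<exists>dm. graded_manifold_of_dim X A dm)"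

text \<open>The value at \<open>m\<close> of a function of degree \<open>k\<close> on \<open>U\<close> is read off in an arbitrarily chosen chart
  around \<open>m\<close>. It does not depend on the chart, since isomorphisms of local models preserve
  bodies.\<close>

definition gvalue ::
    "'m topology \<Rightarrow> ('m, 'a::real_vector) galgebra \<Rightarrow> 'm \<Rightarrow> int \<Rightarrow> 'm set \<Rightarrow> 'a \<Rightarrow> real"
  where "gvalue X A m k U f =
    (if k = 0 then
       (let (dm, ds, V, \<phi>, \<psi>) = (SOME (dm, ds, V, \<phi>, \<psi>). m \<in> V \<and> graded_chart X A dm ds V \<phi> \<psi>)
        in \<psi> (U \<inter> V) (restr A U (U \<inter> V) f) 0 (\<phi> m))
     else 0)"

section \<open>Graded vector bundles\<close>

record ('m, 'a, 's) gmodule = "('m, 's) gsheaf" +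
  act :: "'m set \<Rightarrow> 'a \<Rightarrow> 's \<Rightarrow> 's"

definition sheaf_of_modules ::
    "'m topology \<Rightarrow> ('m, 'a::real_vector) galgebra \<Rightarrow> ('m, 'a, 's::real_vector) gmodule \<Rightarrow> bool"
  where "sheaf_of_modules X A S \<longleftrightarrow>
    sheaf_of_graded_vector_spaces X S \<and>
    (\<forall>U. openin X U \<longrightarrow>
       graded_bilinear (sect A U) (sect S U) (sect S U) (act S U) \<and>
       (\<forall>k. \<forall>s\<in>sect S U k. act S U (gone A U) s = s) \<and>
       (\<forall>i j k. \<forall>a\<in>sect A U i. \<forall>b\<in>sect A U j. \<forall>s\<in>sect S U k.
          act S U (gmult A U a b) s = act S U a (act S U b s))) \<and>
    (\<forall>U V. openin X U \<and> openin X V \<and> V \<subseteq> U \<longrightarrow>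
       (\<forall>i k. \<forall>a\<in>sect A U i. \<forall>s\<in>sect S U k.
          restr S U V (act S U a s) = act S V (restr A U V a) (restr S U V s)))"

definition freely_generates ::
    "('m, 'a::real_vector) galgebra \<Rightarrow> ('m, 'a, 's::real_vector) gmodule \<Rightarrow> 'm set
      \<Rightarrow> nat set \<Rightarrow> (nat \<Rightarrow> int) \<Rightarrow> (nat \<Rightarrow> 's) \<Rightarrow> bool"
  where "freely_generates A S U I d s \<longleftrightarrow>
    finite I \<and> (\<forall>i\<in>I. s i \<in> sect S U (d i)) \<and>
    (\<forall>k. \<forall>t\<in>sect S U k.
       \<exists>!f. f \<in> (\<Pi>\<^sub>E i\<in>I. sect A U (k - d i)) \<and> t = (\<Sum>i\<in>I. act S U (f i) (s i)))"

text \<open>A frame over \<open>U\<close> is a finite family \<open>s i\<close> of degrees \<open>d i\<close>, \<open>i \<in> I\<close>, that freely generates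
  \<open>S(U)\<close> and whose restrictions to smaller open sets are frames as well. On a graded manifold the
  latter follows from the former by means of bump functions.\<close>

definition frame ::
    "'m topology \<Rightarrow> ('m, 'a::real_vector) galgebra \<Rightarrow> ('m, 'a, 's::real_vector) gmodule \<Rightarrow> 'm set
      \<Rightarrow> nat set \<Rightarrow> (nat \<Rightarrow> int) \<Rightarrow> (nat \<Rightarrow> 's) \<Rightarrow> bool"
  where "frame X A S U I d s \<longleftrightarrow>
    openin X U \<and> freely_generates A S U I d s \<and>
    (\<forall>V. openin X V \<and> V \<subseteq> U \<longrightarrow> freely_generates A S V I d (\<lambda>i. restr S U V (s i)))"

definition frame_rank :: "nat set \<Rightarrow> (nat \<Rightarrow> int) \<Rightarrow> int \<Rightarrow> nat"
  where "frame_rank I d j = card {i\<in>I. d i = j}"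

definition graded_vector_bundle ::
    "'m topology \<Rightarrow> ('m, 'a::real_vector) galgebra \<Rightarrow> ('m, 'a, 's::real_vector) gmodule \<Rightarrow> bool"
  where "graded_vector_bundle X A S \<longleftrightarrow>
    sheaf_of_modules X A S \<and>
    (\<exists>\<rho>. \<forall>m\<in>topspace X. \<exists>U I d s. m \<in> U \<and> frame X A S U I d s \<and> frame_rank I d = \<rho>)"

definition bundle_morphism ::
    "'m topology \<Rightarrow> ('m, 'a::real_vector) galgebra \<Rightarrow> ('m, 'a, 's::real_vector) gmodule
      \<Rightarrow> ('m, 'a, 'p::real_vector) gmodule \<Rightarrow> ('m set \<Rightarrow> 's \<Rightarrow> 'p) \<Rightarrow> bool"
  where "bundle_morphism X A S P F \<longleftrightarrow>
    (\<forall>U. openin X U \<longrightarrow>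
       (\<forall>k. F U ` sect S U k \<subseteq> sect P U k \<and> linear_map_on (sect S U k) (F U)) \<and>
       (\<forall>i k. \<forall>a\<in>sect A U i. \<forall>s\<in>sect S U k. F U (act S U a s) = act P U a (F U s))) \<and>
    (\<forall>U V k. openin X U \<and> openin X V \<and> V \<subseteq> U \<longrightarrow>
       (\<forall>s\<in>sect S U k. F V (restr S U V s) = restr P U V (F U s)))"

definition surjective_morphism ::
    "'m topology \<Rightarrow> ('m, 'a, 's) gmodule \<Rightarrow> ('m, 'a, 'p) gmodule \<Rightarrow> ('m set \<Rightarrow> 's \<Rightarrow> 'p) \<Rightarrow> bool"
  where "surjective_morphism X S P F \<longleftrightarrow>
    (\<forall>U k. openin X U \<longrightarrow> F U ` sect S U k = sect P U k)"

section \<open>Subbundles\<close>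

text \<open>A subsheaf is given by its sets of sections; restriction and module structure are inherited.\<close>

definition submodule_sheaf ::
    "'m topology \<Rightarrow> ('m, 'a::real_vector) galgebra \<Rightarrow> ('m, 'a, 's::real_vector) gmodule
      \<Rightarrow> ('m set \<Rightarrow> int \<Rightarrow> 's set) \<Rightarrow> bool"
  where "submodule_sheaf X A S L \<longleftrightarrow>
    (\<forall>U k. openin X U \<longrightarrow> L U k \<subseteq> sect S U k) \<and> sheaf_of_modules X A (S\<lparr>sect := L\<rparr>)"

definition subbundle ::
    "'m topology \<Rightarrow> ('m, 'a::real_vector) galgebra \<Rightarrow> ('m, 'a, 's::real_vector) gmodule
      \<Rightarrow> ('m set \<Rightarrow> int \<Rightarrow> 's set) \<Rightarrow> bool"
  where "subbundle X A S L \<longleftrightarrow>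
    submodule_sheaf X A S L \<and>
    (\<exists>r J. J \<subseteq> {1..r} \<and>
      (\<forall>m\<in>topspace X. \<exists>U d s. m \<in> U \<and>
         frame X A S U {1..r} d s \<and> frame X A (S\<lparr>sect := L\<rparr>) U J d s))"

definition kernel_sheaf ::
    "('m, 'a, 's) gmodule \<Rightarrow> ('m set \<Rightarrow> 's \<Rightarrow> 'p::zero) \<Rightarrow> 'm set \<Rightarrow> int \<Rightarrow> 's set"
  where "kernel_sheaf S F U k = {s \<in> sect S U k. F U s = 0}"

definition image_sheaf ::
    "('m, 'a, 's) gmodule \<Rightarrow> ('m set \<Rightarrow> 's \<Rightarrow> 'p) \<Rightarrow> 'm set \<Rightarrow> int \<Rightarrow> 'p set"
  where "image_sheaf S F U k = F U ` sect S U k"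

section \<open>Stalks and fibers\<close>

record 'v vspace =
  vcarrier :: "'v set"
  vadd :: "'v \<Rightarrow> 'v \<Rightarrow> 'v"
  vzero :: "'v"
  vscale :: "real \<Rightarrow> 'v \<Rightarrow> 'v"

definition lincomb :: "'v vspace \<Rightarrow> real list \<Rightarrow> 'v list \<Rightarrow> 'v"
  where "lincomb V cs vs = foldr (\<lambda>(c, v) w. vadd V (vscale V c v) w) (zip cs vs) (vzero V)"

definition has_dimension :: "'v vspace \<Rightarrow> nat \<Rightarrow> bool"
  where "has_dimension V n \<longleftrightarrow>
    (\<exists>vs. length vs = n \<and> set vs \<subseteq> vcarrier V \<and>
      (\<forall>v\<in>vcarrier V. \<exists>!cs. length cs = n \<and> v = lincomb V cs vs) \<and>
      (\<forall>cs. length cs = n \<longrightarrow> lincomb V cs vs \<in> vcarrier V))"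

definition nbhd_sections ::
    "'m topology \<Rightarrow> ('m, 's, 'z) gsheaf_scheme \<Rightarrow> 'm \<Rightarrow> int \<Rightarrow> ('m set \<times> 's) set"
  where "nbhd_sections X S m k = {(U, s). openin X U \<and> m \<in> U \<and> s \<in> sect S U k}"

definition germ_rel ::
    "'m topology \<Rightarrow> ('m, 's, 'z) gsheaf_scheme \<Rightarrow> 'm \<Rightarrow> int \<Rightarrow> (('m set \<times> 's) \<times> ('m set \<times> 's)) set"
  where "germ_rel X S m k = {((U, s), (V, t)).
    (U, s) \<in> nbhd_sections X S m k \<and> (V, t) \<in> nbhd_sections X S m k \<and>
    (\<exists>W. openin X W \<and> m \<in> W \<and> W \<subseteq> U \<inter> V \<and> restr S U W s = restr S V W t)}"

definition germ ::
    "'m topology \<Rightarrow> ('m, 's, 'z) gsheaf_scheme \<Rightarrow> 'm \<Rightarrow> int \<Rightarrow> 'm set \<Rightarrow> 's \<Rightarrow> ('m set \<times> 's) set"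
  where "germ X S m k U s = germ_rel X S m k `` {(U, s)}"

text \<open>Operations on classes are unions over representatives, as in \<^theory>\<open>HOL.Equiv_Relations\<close>.\<close>

definition stalk ::
    "'m topology \<Rightarrow> ('m, 's::real_vector, 'z) gsheaf_scheme \<Rightarrow> 'm \<Rightarrow> int \<Rightarrow> ('m set \<times> 's) set vspace"
  where "stalk X S m k = \<lparr>
    vcarrier = nbhd_sections X S m k // germ_rel X S m k,
    vadd = (\<lambda>G H. \<Union>(U, s)\<in>G. \<Union>(V, t)\<in>H.
      germ X S m k (U \<inter> V) (restr S U (U \<inter> V) s + restr S V (U \<inter> V) t)),
    vzero = germ X S m k (topspace X) 0,
    vscale = (\<lambda>c G. \<Union>(U, s)\<in>G. germ X S m k U (c *\<^sub>R s)) \<rparr>"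

definition stalk_act ::
    "'m topology \<Rightarrow> ('m, 'a::real_vector) galgebra \<Rightarrow> ('m, 'a, 's::real_vector) gmodule \<Rightarrow> 'm
      \<Rightarrow> int \<Rightarrow> ('m set \<times> 'a) set \<Rightarrow> ('m set \<times> 's) set \<Rightarrow> ('m set \<times> 's) set"
  where "stalk_act X A S m k f G = (\<Union>(U, a)\<in>f. \<Union>(V, s)\<in>G.
    germ X S m k (U \<inter> V) (act S (U \<inter> V) (restr A U (U \<inter> V) a) (restr S V (U \<inter> V) s)))"

definition stalk_map ::
    "'m topology \<Rightarrow> ('m, 'a, 'p) gmodule \<Rightarrow> ('m set \<Rightarrow> 's \<Rightarrow> 'p) \<Rightarrow> 'm
      \<Rightarrow> int \<Rightarrow> ('m set \<times> 's) set \<Rightarrow> ('m set \<times> 'p) set"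
  where "stalk_map X P F m k G = (\<Union>(U, s)\<in>G. germ X P m k U (F U s))"

definition vanishing_germs ::
    "'m topology \<Rightarrow> ('m, 'a::real_vector) galgebra \<Rightarrow> 'm \<Rightarrow> int \<Rightarrow> ('m set \<times> 'a) set set"
  where "vanishing_germs X A m k =
    {germ X A m k U f | U f. (U, f) \<in> nbhd_sections X A m k \<and> gvalue X A m k U f = 0}"

text \<open>The degree \<open>k\<close> part of \<open>\<JJ>\<^sub>m \<cdot> S\<^sub>m\<close>: finite sums of products.\<close>

inductive_set ideal_stalk ::
    "'m topology \<Rightarrow> ('m, 'a::real_vector) galgebra \<Rightarrow> ('m, 'a, 's::real_vector) gmodule \<Rightarrow> 'm
      \<Rightarrow> int \<Rightarrow> ('m set \<times> 's) set set"
  for X A S m k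
  where
    zero: "vzero (stalk X S m k) \<in> ideal_stalk X A S m k"
  | add: "\<lbrakk> f \<in> vanishing_germs X A m i; G \<in> vcarrier (stalk X S m (k - i));
            H \<in> ideal_stalk X A S m k \<rbrakk>
          \<Longrightarrow> vadd (stalk X S m k) (stalk_act X A S m k f G) H \<in> ideal_stalk X A S m k"

definition fiber_rel ::
    "'m topology \<Rightarrow> ('m, 'a::real_vector) galgebra \<Rightarrow> ('m, 'a, 's::real_vector) gmodule \<Rightarrow> 'm
      \<Rightarrow> int \<Rightarrow> (('m set \<times> 's) set \<times> ('m set \<times> 's) set) set"
  where "fiber_rel X A S m k = {(G, H).
    G \<in> vcarrier (stalk X S m k) \<and> H \<in> vcarrier (stalk X S m k) \<and>
    vadd (stalk X S m k) G (vscale (stalk X S m k) (-1) H) \<in> ideal_stalk X A S m k}"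

definition fiber ::
    "'m topology \<Rightarrow> ('m, 'a::real_vector) galgebra \<Rightarrow> ('m, 'a, 's::real_vector) gmodule \<Rightarrow> 'm
      \<Rightarrow> int \<Rightarrow> ('m set \<times> 's) set set vspace"
  where "fiber X A S m k = (let T = stalk X S m k; R = fiber_rel X A S m k in \<lparr>
    vcarrier = vcarrier T // R,
    vadd = (\<lambda>C D. \<Union>G\<in>C. \<Union>H\<in>D. R `` {vadd T G H}),
    vzero = R `` {vzero T},
    vscale = (\<lambda>c C. \<Union>G\<in>C. R `` {vscale T c G}) \<rparr>)"

definition fiber_map ::
    "'m topology \<Rightarrow> ('m, 'a::real_vector) galgebra \<Rightarrow> ('m, 'a, 'p::real_vector) gmodule
      \<Rightarrow> ('m set \<Rightarrow> 's \<Rightarrow> 'p) \<Rightarrow> 'm \<Rightarrow> int \<Rightarrow> ('m set \<times> 's) set set \<Rightarrow> ('m set \<times> 'p) set set"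
  where "fiber_map X A P F m k C = (\<Union>G\<in>C. fiber_rel X A P m k `` {stalk_map X P F m k G})"

definition fiber_injective ::
    "'m topology \<Rightarrow> ('m, 'a::real_vector) galgebra \<Rightarrow> ('m, 'a, 's::real_vector) gmodule
      \<Rightarrow> ('m, 'a, 'p::real_vector) gmodule \<Rightarrow> ('m set \<Rightarrow> 's \<Rightarrow> 'p) \<Rightarrow> 'm \<Rightarrow> bool"
  where "fiber_injective X A S P F m \<longleftrightarrow>
    (\<forall>k. inj_on (fiber_map X A P F m k) (vcarrier (fiber X A S m k)))"

text \<open>The degree \<open>k\<close> part of the image of \<open>F\<^bsub>(m)\<^esub>\<close>, as a vector space.\<close>

definition fiber_image ::
    "'m topology \<Rightarrow> ('m, 'a::real_vector) galgebra \<Rightarrow> ('m, 'a, 's::real_vector) gmodule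
      \<Rightarrow> ('m, 'a, 'p::real_vector) gmodule \<Rightarrow> ('m set \<Rightarrow> 's \<Rightarrow> 'p) \<Rightarrow> 'm
      \<Rightarrow> int \<Rightarrow> ('m set \<times> 'p) set set vspace"
  where "fiber_image X A S P F m k = (fiber X A P m k)
    \<lparr>vcarrier := fiber_map X A P F m k ` vcarrier (fiber X A S m k)\<rparr>"

end

theory Submission
  imports Defs
begin

text \<open>A function of degree 0 with nonzero value at \<open>m\<close> is invertible near \<open>m\<close>: its body has no zero
  near \<open>m\<close>, so the power series can be inverted recursively. Therefore the Steinitz exchange
  argument works: sections that are linearly independent modulo \<open>\<JJ>\<^sub>m \<cdot> S\<^sub>m\<close> are part of a frame near \<open>m\<close>.

  If \<open>F\<close> is injective on fibers, this applies to the images \<open>F s\<^sub>i\<close> of a local frame of \<open>S\<close>. It follows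
  that \<open>F\<close> is injective on sections, so that preimages glue and the image is a sheaf. If \<open>F\<close> is
  surjective, it applies to preimages \<open>t\<^sub>j\<close> of a local frame of \<open>P\<close>; subtracting from each
  remaining frame element the combination of the \<open>t\<^sub>j\<close> with the same image yields a frame of \<open>S\<close>
  whose remaining elements form a frame of the kernel.

  For the counterexample take the point with a single coordinate \<open>\<xi>\<close>, of degree 1. Multiplication
  by \<open>\<xi>\<close> is zero on fibers, but its image is nonzero and annihilated by \<open>\<xi>\<close>, so it has no frame.\<close>

text \<open>Fibers are quotients of stalks, which are quotients of sections; the predicate
  \<open>nul\<close> removes both layers. It says that a section vanishes in the fiber at m, and in
  a frame this means that the values at m of all its coefficients are 0 (\<open>nul_iff\<close>).
  Independence in a fiber thereby becomes a statement about real linear combinations of sections.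
  The grading fits the exchange argument by itself: a coefficient with nonzero value at m has degree
  0, so the element put into the frame has the degree of the one it replaces, and the degrees of the
  frame slots never change. A frame must freely generate over every smaller open set. Nothing is
  therefore extended from small sets to large ones: frames are shrunk, and each property is checked
  over all smaller open sets. Gluing is an obstacle only for images; the kernel is cut out by an
  equation, which can be checked locally. In the counterexample the image is shown to be a sheaf of
  submodules, so what fails is the existence of a frame and not gluing.\<close>

text \<open>Operations on germs are unions over representatives. Such a union collapses to one class
  as soon as every representative contributes the same class and at least one representative
  exists.\<close>

lemma UN_pairs_constant:
  assumes "(a, b) \<in> A" "\<And>a b. (a, b) \<in> A \<Longrightarrow> f a b = c"
  shows "(\<Union>(a, b)\<in>A. f a b) = c"
  using assms by blast

section \<open>Maps that are linear on a subspace\<close>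

lemma linear_map_on_zero: "linear_map_on V f \<Longrightarrow> 0 \<in> V \<Longrightarrow> f 0 = 0"
  unfolding linear_map_on_def by (metis scaleR_zero_left)

lemma linear_map_on_diff:
  assumes "linear_map_on V f" "subspace V" "x \<in> V" "y \<in> V" shows "f (x - y) = f x - f y"
proof -
  have "f (x + (-1) *\<^sub>R y) = f x + (-1) *\<^sub>R f y"
    using assms subspace_scale[OF assms(2,4), of "-1"] unfolding linear_map_on_def by metis
  then show ?thesis by simp
qed

lemma linear_map_on_sum:
  assumes "linear_map_on V f" "subspace V" "\<And>i. i \<in> I \<Longrightarrow> g i \<in> V"
  shows "f (\<Sum>i\<in>I. g i) = (\<Sum>i\<in>I. f (g i))"
proof (cases "finite I")
  case True
  then show ?thesis using assms(3)
  proof (induction I)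
    case empty
    then show ?case using linear_map_on_zero[OF assms(1)] subspace_0[OF assms(2)] by simp
  next
    case (insert i I)
    moreover have "(\<Sum>i\<in>I. g i) \<in> V" using insert by (intro subspace_sum[OF assms(2)]) auto
    ultimately show ?case using assms(1) by (simp add: linear_map_on_def)
  qed
next
  case False
  then show ?thesis using linear_map_on_zero[OF assms(1)] subspace_0[OF assms(2)] by simp
qed

section \<open>Sheaves and germs\<close>

text \<open>The record scheme \<open>'z\<close> lets the same lemmas serve sheaves of algebras,
  sheaves of modules and subsheaves obtained by updating \<open>sect\<close>.\<close>

locale vsheaf =
  fixes X :: "'m topology" and S :: "('m, 's::real_vector, 'z) gsheaf_scheme"
  assumes vsheaf: "sheaf_of_graded_vector_spaces X S"
begin

lemma subspace_sect: "openin X U \<Longrightarrow> subspace (sect S U k)"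
  using vsheaf unfolding sheaf_of_graded_vector_spaces_def graded_vector_space_def
  by (elim conjE) simp

lemmas zero_in = subspace_0[OF subspace_sect]
  and add_in = subspace_add[OF subspace_sect]
  and diff_in = subspace_diff[OF subspace_sect]
  and scale_in = subspace_scale[OF subspace_sect]
  and sum_in = subspace_sum[OF subspace_sect]

lemma restr_in:
  "openin X U \<Longrightarrow> openin X V \<Longrightarrow> V \<subseteq> U \<Longrightarrow> s \<in> sect S U k \<Longrightarrow> restr S U V s \<in> sect S V k"
  using vsheaf unfolding sheaf_of_graded_vector_spaces_def by (elim conjE) (simp add: image_subset_iff)

lemma restr_linear:
  "openin X U \<Longrightarrow> openin X V \<Longrightarrow> V \<subseteq> U \<Longrightarrow> linear_map_on (sect S U k) (restr S U V)"
  using vsheaf unfolding sheaf_of_graded_vector_spaces_def by (elim conjE) simp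

lemma restr_add:
  "openin X U \<Longrightarrow> openin X V \<Longrightarrow> V \<subseteq> U \<Longrightarrow> s \<in> sect S U k \<Longrightarrow> t \<in> sect S U k \<Longrightarrow>
   restr S U V (s + t) = restr S U V s + restr S U V t"
  using restr_linear unfolding linear_map_on_def by blast

lemma restr_scale:
  "openin X U \<Longrightarrow> openin X V \<Longrightarrow> V \<subseteq> U \<Longrightarrow> s \<in> sect S U k \<Longrightarrow>
   restr S U V (c *\<^sub>R s) = c *\<^sub>R restr S U V s"
  using restr_linear unfolding linear_map_on_def by blast

lemma restr_zero: "openin X U \<Longrightarrow> openin X V \<Longrightarrow> V \<subseteq> U \<Longrightarrow> restr S U V 0 = 0"
  using linear_map_on_zero[OF restr_linear zero_in] .

lemma restr_sum:
  "openin X U \<Longrightarrow> openin X V \<Longrightarrow> V \<subseteq> U \<Longrightarrow> (\<And>i. i \<in> I \<Longrightarrow> f i \<in> sect S U k) \<Longrightarrow>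
   restr S U V (\<Sum>i\<in>I. f i) = (\<Sum>i\<in>I. restr S U V (f i))"
  using linear_map_on_sum[OF restr_linear subspace_sect] .

lemma restr_id: "openin X U \<Longrightarrow> s \<in> sect S U k \<Longrightarrow> restr S U U s = s"
  using vsheaf unfolding sheaf_of_graded_vector_spaces_def by (elim conjE) simp

lemma restr_restr:
  "openin X U \<Longrightarrow> openin X V \<Longrightarrow> openin X W \<Longrightarrow> W \<subseteq> V \<Longrightarrow> V \<subseteq> U \<Longrightarrow> s \<in> sect S U k \<Longrightarrow>
   restr S V W (restr S U V s) = restr S U W s"
  using vsheaf unfolding sheaf_of_graded_vector_spaces_def by (elim conjE) simp

text \<open>Both restrictions to \<open>C\<close> factor through \<open>B\<close>, so agreement over
  \<open>B\<close> is inherited. Proofs about germs use this to pass to intersections of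
  neighborhoods.\<close>

lemma restr_eq_mono:
  assumes "openin X U" "openin X V" "openin X B" "openin X C" "B \<subseteq> U" "B \<subseteq> V" "C \<subseteq> B"
    and "s \<in> sect S U k" "t \<in> sect S V l" and eq: "restr S U B s = restr S V B t"
  shows "restr S U C s = restr S V C t"
proof -
  have "restr S U C s = restr S B C (restr S U B s)"
    using assms(1-9) by (intro restr_restr[symmetric]) auto
  also have "\<dots> = restr S V C t"
    unfolding eq using assms(1-9) by (intro restr_restr) auto
  finally show ?thesis .
qed

lemma glue:
  assumes "\<And>U. U \<in> \<U> \<Longrightarrow> openin X U" "\<And>U. U \<in> \<U> \<Longrightarrow> \<sigma> U \<in> sect S U k"
    and "\<And>U V. U \<in> \<U> \<Longrightarrow> V \<in> \<U> \<Longrightarrow> restr S U (U \<inter> V) (\<sigma> U) = restr S V (U \<inter> V) (\<sigma> V)"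
  shows "\<exists>!s. s \<in> sect S (\<Union>\<U>) k \<and> (\<forall>U\<in>\<U>. restr S (\<Union>\<U>) U s = \<sigma> U)"
proof -
  have "(\<forall>U\<in>\<U>. openin X U \<and> \<sigma> U \<in> sect S U k) \<and>
       (\<forall>U\<in>\<U>. \<forall>V\<in>\<U>. restr S U (U \<inter> V) (\<sigma> U) = restr S V (U \<inter> V) (\<sigma> V))"
    using assms by blast
  then show ?thesis
    using vsheaf unfolding sheaf_of_graded_vector_spaces_def by (elim conjE) simp
qed

text \<open>The uniqueness half of gluing, applied to the cover by all open sets on which the two
  sections agree.\<close>

lemma separated:
  assumes U: "openin X U" and s: "s \<in> sect S U k" and t: "t \<in> sect S U k"
    and loc: "\<And>m. m \<in> U \<Longrightarrow> \<exists>W. openin X W \<and> m \<in> W \<and> W \<subseteq> U \<and> restr S U W s = restr S U W t"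
  shows "s = t"
proof -
  define \<U> where "\<U> = {W. openin X W \<and> W \<subseteq> U \<and> restr S U W s = restr S U W t}"
  have un: "\<Union>\<U> = U" using loc unfolding \<U>_def by blast
  have ex: "\<exists>!s'. s' \<in> sect S (\<Union>\<U>) k \<and> (\<forall>W\<in>\<U>. restr S (\<Union>\<U>) W s' = restr S U W s)"
  proof (rule glue)
    fix V W assume "V \<in> \<U>" "W \<in> \<U>"
    then have "openin X V" "openin X W" "V \<subseteq> U" "W \<subseteq> U" unfolding \<U>_def by auto
    then show "restr S V (V \<inter> W) (restr S U V s) = restr S W (V \<inter> W) (restr S U W s)"
      using restr_restr[OF U _ _ _ _ s] by (simp add: openin_Int)
  qed (use restr_in[OF U _ _ s] in \<open>simp_all add: \<U>_def\<close>, metis)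
  then show ?thesis unfolding un using s t by (metis (mono_tags, lifting) \<U>_def mem_Collect_eq)
qed

section \<open>Germs and the operations on stalks\<close>

lemma germ_mem:
  assumes "openin X U" "m \<in> U" "s \<in> sect S U k"
  shows "(V, t) \<in> germ X S m k U s \<longleftrightarrow> openin X V \<and> m \<in> V \<and> t \<in> sect S V k \<and>
    (\<exists>W. openin X W \<and> m \<in> W \<and> W \<subseteq> U \<inter> V \<and> restr S U W s = restr S V W t)"
  using assms by (auto simp: germ_def germ_rel_def nbhd_sections_def)

lemma equiv_germ_rel: "equiv (nbhd_sections X S m k) (germ_rel X S m k)"
proof (rule equivI)
  show "germ_rel X S m k \<subseteq> nbhd_sections X S m k \<times> nbhd_sections X S m k"
    by (auto simp: germ_rel_def)
  show "refl_on (nbhd_sections X S m k) (germ_rel X S m k)"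
    by (auto simp: refl_on_def germ_rel_def nbhd_sections_def)
  show "sym (germ_rel X S m k)"
    by (auto simp: sym_def germ_rel_def)
  show "trans (germ_rel X S m k)"
  proof (rule transI)
    fix x y z assume "(x, y) \<in> germ_rel X S m k" "(y, z) \<in> germ_rel X S m k"
    moreover obtain U s V t W u where xyz: "x = (U, s)" "y = (V, t)" "z = (W, u)"
      by (metis surj_pair)
    ultimately obtain B C where
      o: "openin X U" "openin X V" "openin X W" "m \<in> U" "m \<in> V" "m \<in> W"
        "s \<in> sect S U k" "t \<in> sect S V k" "u \<in> sect S W k" and
      B: "openin X B" "m \<in> B" "B \<subseteq> U \<inter> V" "restr S U B s = restr S V B t" and
      C: "openin X C" "m \<in> C" "C \<subseteq> V \<inter> W" "restr S V C t = restr S W C u"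
      by (auto simp: germ_rel_def nbhd_sections_def)
    \<comment> \<open>The two agreements live on \<open>B\<close> and on \<open>C\<close>; on the
      intersection the middle section \<open>t\<close> links them.\<close>
    have BC: "openin X (B \<inter> C)" using B C by blast
    have "restr S U (B \<inter> C) s = restr S V (B \<inter> C) t"
      using B BC o by (intro restr_eq_mono[OF _ _ _ _ _ _ _ _ _ B(4)]) auto
    also have "\<dots> = restr S W (B \<inter> C) u"
      using C BC o by (intro restr_eq_mono[OF _ _ _ _ _ _ _ _ _ C(4)]) auto
    finally show "(x, z) \<in> germ_rel X S m k"
      unfolding xyz germ_rel_def nbhd_sections_def using o B C BC by blast
  qed
qed

lemma germ_eq_iff:
  assumes "openin X U" "m \<in> U" "s \<in> sect S U k" "openin X V" "m \<in> V" "t \<in> sect S V k"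
  shows "germ X S m k U s = germ X S m k V t \<longleftrightarrow>
    (\<exists>W. openin X W \<and> m \<in> W \<and> W \<subseteq> U \<inter> V \<and> restr S U W s = restr S V W t)"
proof -
  have "germ X S m k U s = germ X S m k V t \<longleftrightarrow> ((U, s), (V, t)) \<in> germ_rel X S m k"
    unfolding germ_def using assms
    by (intro eq_equiv_class_iff[OF equiv_germ_rel]) (auto simp: nbhd_sections_def)
  then show ?thesis using assms by (auto simp: germ_rel_def nbhd_sections_def)
qed

lemma germ_restr:
  assumes "openin X U" "m \<in> V" "s \<in> sect S U k" "openin X V" "V \<subseteq> U"
  shows "germ X S m k V (restr S U V s) = germ X S m k U s"
proof (subst germ_eq_iff)
  show "\<exists>W. openin X W \<and> m \<in> W \<and> W \<subseteq> V \<inter> U \<and> restr S V W (restr S U V s) = restr S U W s"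
    using assms restr_restr[OF assms(1,4,4) _ _ assms(3)] by blast
qed (use assms restr_in in auto)

lemma germ_self: "openin X U \<Longrightarrow> m \<in> U \<Longrightarrow> s \<in> sect S U k \<Longrightarrow> (U, s) \<in> germ X S m k U s"
  by (auto simp: germ_mem)

lemma germ_mem_eq:
  assumes "openin X U" "m \<in> U" "s \<in> sect S U k" "(V, t) \<in> germ X S m k U s"
  shows "openin X V" "m \<in> V" "t \<in> sect S V k" "germ X S m k V t = germ X S m k U s"
proof -
  show V: "openin X V" "m \<in> V" "t \<in> sect S V k" using assms by (simp_all add: germ_mem)
  show "germ X S m k V t = germ X S m k U s"
    using germ_eq_iff[OF assms(1-3) V] assms(4) germ_mem[OF assms(1-3)] by auto
qed

lemma stalk_carrier:
  "vcarrier (stalk X S m k) = {germ X S m k U s | U s. openin X U \<and> m \<in> U \<and> s \<in> sect S U k}"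
  by (auto simp: stalk_def quotient_def germ_def nbhd_sections_def)

lemma germ_in_carrier:
  "openin X U \<Longrightarrow> m \<in> U \<Longrightarrow> s \<in> sect S U k \<Longrightarrow> germ X S m k U s \<in> vcarrier (stalk X S m k)"
  by (auto simp: stalk_carrier)


text \<open>A common domain \<open>U\<close> loses no generality, since germs can be restricted to
  any smaller neighborhood. The content is independence of representatives: over the small set
  \<open>B \<inter> C\<close> every sum of representatives is the restriction of
  \<open>s + t\<close>.\<close>

lemma vadd_germ:
  assumes U: "openin X U" "m \<in> U" and s: "s \<in> sect S U k" and t: "t \<in> sect S U k"
  shows "vadd (stalk X S m k) (germ X S m k U s) (germ X S m k U t) = germ X S m k U (s + t)"
proof -
  have *: "germ X S m k (V \<inter> W) (restr S V (V \<inter> W) s' + restr S W (V \<inter> W) t') = germ X S m k U (s + t)"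
    if g: "(V, s') \<in> germ X S m k U s" "(W, t') \<in> germ X S m k U t" for V s' W t'
  proof -
    note V = germ_mem_eq[OF U s g(1)] and W = germ_mem_eq[OF U t g(2)]
    obtain B C where B: "openin X B" "m \<in> B" "B \<subseteq> U \<inter> V" "restr S U B s = restr S V B s'" and
      C: "openin X C" "m \<in> C" "C \<subseteq> U \<inter> W" "restr S U C t = restr S W C t'"
      using g U s t by (auto simp: germ_mem)
    have BC: "openin X (B \<inter> C)" "B \<inter> C \<subseteq> U" "B \<inter> C \<subseteq> V" "B \<inter> C \<subseteq> W" "B \<inter> C \<subseteq> V \<inter> W" "openin X (V \<inter> W)"
      using B C V W by auto
    have "restr S U (B \<inter> C) s = restr S V (B \<inter> C) s'"
      using B BC U V s by (intro restr_eq_mono[OF _ _ _ _ _ _ _ _ _ B(4)]) auto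
    moreover have "restr S U (B \<inter> C) t = restr S W (B \<inter> C) t'"
      using C BC U W t by (intro restr_eq_mono[OF _ _ _ _ _ _ _ _ _ C(4)]) auto
    ultimately have "restr S (V \<inter> W) (B \<inter> C) (restr S V (V \<inter> W) s' + restr S W (V \<inter> W) t') = restr S U (B \<inter> C) (s + t)"
      using BC U V W s t by (simp add: restr_add[where k = k] restr_in restr_restr[where k = k])
    then show ?thesis
      using BC U V W B C s t
      by (subst germ_eq_iff) (auto intro!: add_in restr_in exI[of _ "B \<inter> C"])
  qed
  have "(\<Union>(W, t')\<in>germ X S m k U t. germ X S m k (V \<inter> W) (restr S V (V \<inter> W) s' + restr S W (V \<inter> W) t'))
      = germ X S m k U (s + t)" if "(V, s') \<in> germ X S m k U s" for V s'
    by (rule UN_pairs_constant[OF germ_self[OF U t] *[OF that]])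
  then have "(\<Union>(V, s')\<in>germ X S m k U s. \<Union>(W, t')\<in>germ X S m k U t.
      germ X S m k (V \<inter> W) (restr S V (V \<inter> W) s' + restr S W (V \<inter> W) t')) = germ X S m k U (s + t)"
    by (rule UN_pairs_constant[OF germ_self[OF U s]])
  then show ?thesis by (simp add: stalk_def)
qed

lemma vscale_germ:
  assumes U: "openin X U" "m \<in> U" and s: "s \<in> sect S U k"
  shows "vscale (stalk X S m k) c (germ X S m k U s) = germ X S m k U (c *\<^sub>R s)"
proof -
  have *: "germ X S m k V (c *\<^sub>R s') = germ X S m k U (c *\<^sub>R s)" if g: "(V, s') \<in> germ X S m k U s" for V s'
  proof -
    note V = germ_mem_eq[OF U s g]
    obtain B where B: "openin X B" "m \<in> B" "B \<subseteq> U \<inter> V" "restr S U B s = restr S V B s'"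
      using g U s by (auto simp: germ_mem)
    then have "restr S V B (c *\<^sub>R s') = restr S U B (c *\<^sub>R s)"
      using U V s by (simp add: restr_scale[where k = k])
    then show ?thesis
      using U V s B by (subst germ_eq_iff) (auto intro!: scale_in)
  qed
  have "(\<Union>(V, s')\<in>germ X S m k U s. germ X S m k V (c *\<^sub>R s')) = germ X S m k U (c *\<^sub>R s)"
    by (rule UN_pairs_constant[OF germ_self[OF U s] *])
  then show ?thesis by (simp add: stalk_def)
qed

text \<open>\<open>stalk\<close> takes its zero over the whole space; moving it to an arbitrary
  neighborhood makes it comparable with local sections.\<close>

lemma vzero_germ:
  assumes U: "openin X U" "m \<in> U"
  shows "vzero (stalk X S m k) = germ X S m k U 0"
  using germ_restr[of "topspace X" m U 0 k] assms
  by (simp add: stalk_def openin_subset zero_in restr_zero)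

end

section \<open>Smooth functions and units of the local model\<close>

lemma C_on_SucI:
  assumes "continuous_map (subtopology (Euclidean_space n) U) euclideanreal f"
    and "\<And>i. i < n \<Longrightarrow> C_on k n U (g i)"
    and "\<And>i x. i < n \<Longrightarrow> x \<in> U \<Longrightarrow> ((\<lambda>t. f (x(i := t))) has_real_derivative g i x) (at (x i))"
  shows "C_on (Suc k) n U f"
  unfolding C_on.simps using assms by (intro conjI exI[of _ g]) auto

lemma C_on_SucE:
  assumes "C_on (Suc k) n U f"
  obtains g where "continuous_map (subtopology (Euclidean_space n) U) euclideanreal f"
    and "\<And>i. i < n \<Longrightarrow> C_on k n U (g i)"
    and "\<And>i x. i < n \<Longrightarrow> x \<in> U \<Longrightarrow> ((\<lambda>t. f (x(i := t))) has_real_derivative g i x) (at (x i))"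
proof -
  from assms have c: "continuous_map (subtopology (Euclidean_space n) U) euclideanreal f"
    and "\<exists>g. \<forall>i<n. C_on k n U (g i) \<and>
      (\<forall>x\<in>U. ((\<lambda>t. f (x(i := t))) has_real_derivative g i x) (at (x i)))"
    by simp_all
  then obtain g where "\<forall>i<n. C_on k n U (g i) \<and>
      (\<forall>x\<in>U. ((\<lambda>t. f (x(i := t))) has_real_derivative g i x) (at (x i)))"
    by blast
  then show thesis by (intro that[of g] c) simp_all
qed

declare C_on.simps(2) [simp del]

text \<open>The product rule needs this: the derivative of a product contains the factors
  themselves, which must count as functions of the lower class.\<close>

lemma C_on_Suc_imp: "C_on (Suc k) n U f \<Longrightarrow> C_on k n U f"
proof (induction k arbitrary: f)
  case (Suc k)
  from Suc.prems show ?case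
    by (rule C_on_SucE) (rule C_on_SucI, auto intro: Suc.IH)
qed (simp add: C_on.simps)

lemma C_on_const: "C_on k n U (\<lambda>x. c)"
proof (induction k arbitrary: c)
  case (Suc k)
  show ?case by (rule C_on_SucI[of _ _ _ _ "\<lambda>i x. 0"]) (simp_all add: Suc)
qed simp

lemma C_on_add: "C_on k n U f \<Longrightarrow> C_on k n U g \<Longrightarrow> C_on k n U (\<lambda>x. f x + g x)"
proof (induction k arbitrary: f g)
  case (Suc k)
  obtain f' where f': "continuous_map (subtopology (Euclidean_space n) U) euclideanreal f"
      "\<And>i. i < n \<Longrightarrow> C_on k n U (f' i)"
      "\<And>i x. i < n \<Longrightarrow> x \<in> U \<Longrightarrow> ((\<lambda>t. f (x(i := t))) has_real_derivative f' i x) (at (x i))"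
    using C_on_SucE[OF Suc.prems(1)] by blast
  obtain g' where g': "continuous_map (subtopology (Euclidean_space n) U) euclideanreal g"
      "\<And>i. i < n \<Longrightarrow> C_on k n U (g' i)"
      "\<And>i x. i < n \<Longrightarrow> x \<in> U \<Longrightarrow> ((\<lambda>t. g (x(i := t))) has_real_derivative g' i x) (at (x i))"
    using C_on_SucE[OF Suc.prems(2)] by blast
  show ?case
    by (rule C_on_SucI[of _ _ _ _ "\<lambda>i x. f' i x + g' i x"])
      (intro continuous_map_add Suc.IH DERIV_add f' g'; assumption)+
qed (auto intro!: continuous_map_add)

lemma C_on_mult: "C_on k n U f \<Longrightarrow> C_on k n U g \<Longrightarrow> C_on k n U (\<lambda>x. f x * g x)"
proof (induction k arbitrary: f g)
  case (Suc k)
  obtain f' where f': "continuous_map (subtopology (Euclidean_space n) U) euclideanreal f"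
      "\<And>i. i < n \<Longrightarrow> C_on k n U (f' i)"
      "\<And>i x. i < n \<Longrightarrow> x \<in> U \<Longrightarrow> ((\<lambda>t. f (x(i := t))) has_real_derivative f' i x) (at (x i))"
    using C_on_SucE[OF Suc.prems(1)] by blast
  obtain g' where g': "continuous_map (subtopology (Euclidean_space n) U) euclideanreal g"
      "\<And>i. i < n \<Longrightarrow> C_on k n U (g' i)"
      "\<And>i x. i < n \<Longrightarrow> x \<in> U \<Longrightarrow> ((\<lambda>t. g (x(i := t))) has_real_derivative g' i x) (at (x i))"
    using C_on_SucE[OF Suc.prems(2)] by blast
  show ?case
  proof (rule C_on_SucI[of _ _ _ _ "\<lambda>i x. f' i x * g x + g' i x * f x"])
    show "continuous_map (subtopology (Euclidean_space n) U) euclideanreal (\<lambda>x. f x * g x)"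
      using f'(1) g'(1) by (rule continuous_map_real_mult)
    show "C_on k n U (\<lambda>x. f' i x * g x + g' i x * f x)" if "i < n" for i
      using that C_on_Suc_imp[OF Suc.prems(1)] C_on_Suc_imp[OF Suc.prems(2)] f'(2) g'(2)
      by (intro C_on_add Suc.IH) auto
    show "((\<lambda>t. f (x(i := t)) * g (x(i := t))) has_real_derivative
      f' i x * g x + g' i x * f x) (at (x i))" if "i < n" "x \<in> U" for i x
      using DERIV_mult[OF f'(3)[OF that] g'(3)[OF that]] by simp
  qed
qed (auto intro!: continuous_map_real_mult)

text \<open>The derivative of 1/f is -(1/f) f' (1/f), a product of functions already known to be of
  the lower class, so the induction closes.\<close>

lemma C_on_inverse:
  assumes nz: "\<And>x. x \<in> U \<Longrightarrow> f x \<noteq> 0"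
  shows "C_on k n U f \<Longrightarrow> C_on k n U (\<lambda>x. inverse (f x))"
proof (induction k)
  case 0
  then show ?case using nz by (auto intro!: continuous_map_real_inverse)
next
  case (Suc k)
  obtain f' where f': "continuous_map (subtopology (Euclidean_space n) U) euclideanreal f"
      "\<And>i. i < n \<Longrightarrow> C_on k n U (f' i)"
      "\<And>i x. i < n \<Longrightarrow> x \<in> U \<Longrightarrow> ((\<lambda>t. f (x(i := t))) has_real_derivative f' i x) (at (x i))"
    using C_on_SucE[OF Suc.prems(1)] by blast
  have inv: "C_on k n U (\<lambda>x. inverse (f x))"
    using Suc.IH C_on_Suc_imp[OF Suc.prems] by blast
  show ?case
  proof (rule C_on_SucI[of _ _ _ _ "\<lambda>i x. (-1) * (inverse (f x) * f' i x * inverse (f x))"])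
    show "continuous_map (subtopology (Euclidean_space n) U) euclideanreal (\<lambda>x. inverse (f x))"
      using f'(1) nz by (auto intro!: continuous_map_real_inverse)
    show "C_on k n U (\<lambda>x. (-1) * (inverse (f x) * f' i x * inverse (f x)))" if "i < n" for i
      using that by (intro C_on_mult C_on_const inv f')
    show "((\<lambda>t. inverse (f (x(i := t)))) has_real_derivative
      (-1) * (inverse (f x) * f' i x * inverse (f x))) (at (x i))" if "i < n" "x \<in> U" for i x
      using DERIV_inverse'[OF f'(3)[OF that]] nz[OF that(2)] by simp
  qed
qed

lemma smooth_on_const: "smooth_on n U (\<lambda>x. c)"
  and smooth_on_add: "smooth_on n U f \<Longrightarrow> smooth_on n U g \<Longrightarrow> smooth_on n U (\<lambda>x. f x + g x)"
  and smooth_on_mult: "smooth_on n U f \<Longrightarrow> smooth_on n U g \<Longrightarrow> smooth_on n U (\<lambda>x. f x * g x)"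
  and smooth_on_inverse: "(\<And>x. x \<in> U \<Longrightarrow> f x \<noteq> 0) \<Longrightarrow> smooth_on n U f \<Longrightarrow>
    smooth_on n U (\<lambda>x. inverse (f x))"
  by (simp_all add: smooth_on_def C_on_const C_on_add C_on_mult C_on_inverse)

lemma smooth_on_sum:
  "(\<And>i. i \<in> I \<Longrightarrow> smooth_on n U (f i)) \<Longrightarrow> smooth_on n U (\<lambda>x. \<Sum>i\<in>I. f i x)"
  by (induction I rule: infinite_finite_induct) (auto intro: smooth_on_const smooth_on_add)

lemma smooth_on_continuous:
  "smooth_on n U f \<Longrightarrow> continuous_map (subtopology (Euclidean_space n) U) euclideanreal f"
  unfolding smooth_on_def using C_on.simps(1) by blast

section \<open>Multi-indices and the inversion of power series\<close>

lemma multi_index_zero: "multi_index ds 0"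
  by (simp add: multi_index_def)

lemma mdegree_zero: "mdegree ds 0 = 0"
  by (simp add: mdegree_def)

lemma mdegree_add: "mdegree ds (p + q) = mdegree ds p + mdegree ds q"
  by (simp add: mdegree_def sum.distrib algebra_simps)

text \<open>Sums over infinite sets are 0 by convention, so the product of power series has its
  intended meaning only because a multi-index has finitely many splittings. All exponents are
  bounded by those of \<open>r\<close>, and none is nonzero beyond the list of variables.\<close>

lemma finite_splittings:
  assumes "multi_index ds r" shows "finite {(p, q). p + q = r}"
proof -
  \<comment> \<open>The total exponent of \<open>r\<close> serves as one bound for all
    positions.\<close>
  let ?A = "{p. \<forall>i. (i \<in> {..<length ds} \<longrightarrow> p i \<in> {..\<Sum>i<length ds. r i}) \<and>
    (i \<notin> {..<length ds} \<longrightarrow> p i = 0)}"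
  have "p \<in> ?A \<and> q \<in> ?A" if "p + q = r" for p q
  proof -
    have le: "p i \<le> r i" "q i \<le> r i" for i
      using that by auto
    moreover have "r i \<le> (\<Sum>i<length ds. r i)" if "i < length ds" for i
      using that by (intro member_le_sum) auto
    moreover have "r i = 0" if "\<not> i < length ds" for i
      using that assms by (simp add: multi_index_def)
    ultimately have "p i \<in> {..\<Sum>i<length ds. r i} \<and> q i \<in> {..\<Sum>i<length ds. r i}"
      if "i < length ds" for i
      using that by (meson atMost_iff order_trans)
    moreover have "p i = 0 \<and> q i = 0" if "\<not> i < length ds" for i
      using that le[of i] \<open>\<And>i. \<not> i < length ds \<Longrightarrow> r i = 0\<close> by simp
    ultimately show ?thesis by simp
  qed
  then have "{(p, q). p + q = r} \<subseteq> ?A \<times> ?A" by blast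
  moreover have "finite ?A" by (intro finite_set_of_finite_funs) auto
  ultimately show ?thesis by (meson finite_SigmaI finite_subset)
qed

text \<open>The measure for the recursive inversion: splitting off a nonzero monomial lowers the
  total exponent. Admissibility of \<open>p + q\<close> places the nonzero exponent of
  \<open>p\<close> among the counted positions.\<close>

lemma splitting_size_less:
  assumes "multi_index ds (p + q)" "p \<noteq> 0"
  shows "(\<Sum>i<length ds. q i) < (\<Sum>i<length ds. (p + q) i)"
proof -
  obtain i where "p i \<noteq> 0" using assms(2) by (auto simp: fun_eq_iff)
  moreover from this have "i < length ds"
    using assms(1) by (metis add_is_0 linorder_not_le multi_index_def plus_fun_apply)
  ultimately have "0 < (\<Sum>i<length ds. p i)"
    by (intro sum_pos2[of _ i]) auto
  then show ?thesis by (simp add: sum.distrib)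
qed

text \<open>Solves f g = 1 coefficient by coefficient: for r nonzero of degree 0, the coefficient of
  \<xi>^r reads f_0 g_r + (terms with p nonzero) = 0, and these terms involve only coefficients of g
  with smaller total exponent. Coefficients outside degree 0 are set to 0 to make g
  homogeneous.\<close>

function ps_inverse :: "int list \<Rightarrow> power_series \<Rightarrow> power_series" where
  "ps_inverse ds f r x =
    (if multi_index ds r \<and> mdegree ds r = 0 then
       if r = 0 then inverse (f 0 x)
       else - inverse (f 0 x) *
         (\<Sum>(p, q) | p + q = r \<and> p \<noteq> 0. koszul_sign ds p q * f p x * ps_inverse ds f q x)
     else 0)"
  by pat_completeness auto
termination
  by (relation "Wellfounded.measure (\<lambda>(ds, f, r, x). \<Sum>i<length ds. r i)")
    (auto simp: splitting_size_less simp del: plus_fun_apply)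

declare ps_inverse.simps [simp del]

lemma local_model_sect:
  "f \<in> sect (local_model n ds) U k \<longleftrightarrow> (\<forall>p.
      (if multi_index ds p \<and> mdegree ds p = k then smooth_on n U (f p) else f p = 0) \<and>
      (\<forall>x. x \<notin> U \<longrightarrow> f p x = 0))"
  by (simp add: local_model_def)

lemma local_model_gmult:
  "gmult (local_model n ds) U f g = (\<lambda>r x. if multi_index ds r
      then (\<Sum>(p, q) | p + q = r. koszul_sign ds p q * f p x * g q x) else 0)"
  by (simp add: local_model_def)

lemma local_model_gone:
  "gone (local_model n ds) U = (\<lambda>p x. if p = 0 \<and> x \<in> U then 1 else 0)"
  by (simp add: local_model_def)

lemma local_model_restr: "restr (local_model n ds) U V f = (\<lambda>p x. if x \<in> V then f p x else 0)"
  by (simp add: local_model_def)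

text \<open>The only splitting of the zero exponent is 0 + 0, with sign +1, so passing to the body
  is multiplicative.\<close>

lemma local_model_gmult_body:
  "gmult (local_model n ds) U f g 0 x = f 0 x * g 0 x"
proof -
  have "{(p, q). p + q = (0 :: nat \<Rightarrow> nat)} = {(0, 0)}"
    by (auto simp: fun_eq_iff)
  then show ?thesis by (simp add: local_model_gmult multi_index_zero koszul_sign_def)
qed

lemma local_model_inverse:
  assumes f: "f \<in> sect (local_model n ds) U 0" and nz: "\<And>x. x \<in> U \<Longrightarrow> f 0 x \<noteq> 0"
  shows "\<exists>g \<in> sect (local_model n ds) U 0.
    gmult (local_model n ds) U f g = gone (local_model n ds) U"
proof
  let ?g = "ps_inverse ds f"
  have out: "f p x = 0" if "x \<notin> U" for p x
    using f that by (simp add: local_model_sect)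
  have sm: "smooth_on n U (f p)" for p
    using f smooth_on_const[of n U 0] by (cases "multi_index ds p \<and> mdegree ds p = 0")
      (auto simp: local_model_sect zero_fun_def)
  have inv: "smooth_on n U (\<lambda>x. inverse (f 0 x))"
    using nz sm by (rule smooth_on_inverse)
  have sm_g: "smooth_on n U (?g r)" for r
  proof (induction "\<Sum>i<length ds. r i" arbitrary: r rule: less_induct)
    case less
    show ?case
    proof (cases "multi_index ds r \<and> mdegree ds r = 0")
      case True
      show ?thesis
      proof (cases "r = 0")
        case True
        then show ?thesis using inv
          by (subst ps_inverse.simps[abs_def]) (simp add: multi_index_zero mdegree_zero)
      next
        case False
        have "smooth_on n U (\<lambda>x. \<Sum>(p, q) | p + q = r \<and> p \<noteq> 0. koszul_sign ds p q * f p x * ?g q x)"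
          using True by (auto intro!: smooth_on_sum smooth_on_mult smooth_on_const sm less splitting_size_less
              simp del: plus_fun_apply)
        then have "smooth_on n U (\<lambda>x. (-1) * (inverse (f 0 x) *
            (\<Sum>(p, q) | p + q = r \<and> p \<noteq> 0. koszul_sign ds p q * f p x * ?g q x)))"
          by (intro smooth_on_mult smooth_on_const inv)
        then show ?thesis using True False
          by (subst ps_inverse.simps[abs_def]) simp
      qed
    next
      case False
      then show ?thesis using smooth_on_const[of n U 0]
        by (subst ps_inverse.simps[abs_def]) auto
    qed
  qed
  \<comment> \<open>Outside of \<open>U\<close> the body is 0 and \<open>inverse 0 = 0\<close>, so
    the recursion itself produces the extension by 0.\<close>
  have "?g r x = 0" if "x \<notin> U" for r x
    using that by (simp add: ps_inverse.simps out)
  moreover have "?g r = 0" if "\<not> (multi_index ds r \<and> mdegree ds r = 0)" for r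
    using that by (auto simp: ps_inverse.simps fun_eq_iff)
  ultimately show "?g \<in> sect (local_model n ds) U 0"
    using sm_g by (auto simp: local_model_sect)
  have g0: "?g 0 x = inverse (f 0 x)" for x
    by (simp add: ps_inverse.simps multi_index_zero mdegree_zero)
  have "(\<Sum>(p, q) | p + q = r. koszul_sign ds p q * f p x * ?g q x) = (if r = 0 \<and> x \<in> U then 1 else 0)"
    if r: "multi_index ds r" for r x
  proof (cases "r = 0")
    case True
    then show ?thesis
      using local_model_gmult_body[of n ds U f ?g x] nz[of x] out[of x 0]
      unfolding local_model_gmult g0 by (auto simp: multi_index_zero g0 koszul_sign_def)
  next
    case False
    note fin = finite_splittings[OF r]
    \<comment> \<open>The term with p = 0 contains \<open>?g r\<close> with sign +1; the recursion
      was set up so that it cancels all the others.\<close>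
    have split: "{(p, q). p + q = r} = insert (0, r) {(p, q). p + q = r \<and> p \<noteq> 0}"
      by auto
    have k: "koszul_sign ds 0 r = 1" by (simp add: koszul_sign_def)
    have fin': "finite {(p, q). p + q = r \<and> p \<noteq> 0}"
      by (rule finite_subset[OF _ fin]) auto
    show ?thesis
    proof (cases "mdegree ds r = 0")
      case True
      have "x \<in> U \<Longrightarrow> f 0 x * ?g r x = - (\<Sum>(p, q) | p + q = r \<and> p \<noteq> 0. koszul_sign ds p q * f p x * ?g q x)"
        using True False r nz by (subst ps_inverse.simps) simp
      moreover have "f 0 x * ?g r x = - (\<Sum>(p, q) | p + q = r \<and> p \<noteq> 0. koszul_sign ds p q * f p x * ?g q x)"
        if "x \<notin> U"
        using that out by simp
      ultimately have "f 0 x * ?g r x + (\<Sum>(p, q) | p + q = r \<and> p \<noteq> 0. koszul_sign ds p q * f p x * ?g q x) = 0"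
        by fastforce
      then show ?thesis using False
        unfolding split by (subst sum.insert[OF fin']) (auto simp: k)
    next
      case deg: False
      \<comment> \<open>Degrees add up, so in a splitting of an index of nonzero degree one part has
        nonzero degree, and there \<open>f\<close> or \<open>?g\<close> has coefficient 0.\<close>
      have "koszul_sign ds p q * f p x * ?g q x = 0" if "p + q = r" for p q
      proof -
        have "mdegree ds p \<noteq> 0 \<or> mdegree ds q \<noteq> 0" using deg that mdegree_add[of ds p q] by auto
        then show ?thesis using f by (auto simp: local_model_sect ps_inverse.simps[of _ _ q])
      qed
      then show ?thesis using False by (auto intro!: sum.neutral)
    qed
  qed
  then show "gmult (local_model n ds) U f ?g = gone (local_model n ds) U"
    unfolding local_model_gmult local_model_gone
  proof (intro ext, goal_cases)
    case (1 r x)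
    show ?case
    proof (cases "multi_index ds r")
      case True
      from 1[OF this] show ?thesis by (simp only: True if_True)
    next
      case False
      then have "r \<noteq> 0" using multi_index_zero by auto
      then show ?thesis using False by (simp only: if_False simp_thms)
    qed
  qed
qed

section \<open>Graded functions and their values\<close>

locale galgebra_sheaf =
  fixes X :: "'m topology" and A :: "('m, 'a::real_vector) galgebra"
  assumes alg: "sheaf_of_graded_algebras X A"
begin

sublocale A: vsheaf X A
  using alg by unfold_locales (simp add: sheaf_of_graded_algebras_def)

lemma algebra_axioms:
  assumes U: "openin X U"
  shows gmult_bilinear: "graded_bilinear (sect A U) (sect A U) (sect A U) (gmult A U)"
    and gone_in: "gone A U \<in> sect A U 0"
    and gone_left: "a \<in> sect A U i \<Longrightarrow> gmult A U (gone A U) a = a"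
    and gone_right: "a \<in> sect A U i \<Longrightarrow> gmult A U a (gone A U) = a"
    and gmult_assoc: "a \<in> sect A U i \<Longrightarrow> b \<in> sect A U j \<Longrightarrow> c \<in> sect A U k \<Longrightarrow>
      gmult A U (gmult A U a b) c = gmult A U a (gmult A U b c)"
    and gmult_commute: "a \<in> sect A U i \<Longrightarrow> b \<in> sect A U j \<Longrightarrow>
      gmult A U a b = (if odd (i * j) then - gmult A U b a else gmult A U b a)"
proof -
  note * = alg[unfolded sheaf_of_graded_algebras_def, THEN conjunct2, THEN conjunct1, THEN spec, THEN mp, OF U]
  note ** = *[THEN conjunct2] note ** = ** **[THEN conjunct2]
  note *** = **(2)[THEN conjunct2] note **** = ***[THEN conjunct2]
  show "graded_bilinear (sect A U) (sect A U) (sect A U) (gmult A U)"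
    by (rule *[THEN conjunct1])
  show "gone A U \<in> sect A U 0" by (rule **(1)[THEN conjunct1])
  show "a \<in> sect A U i \<Longrightarrow> gmult A U (gone A U) a = a"
    and "a \<in> sect A U i \<Longrightarrow> gmult A U a (gone A U) = a"
    using **(2)[THEN conjunct1] by blast+
  show "a \<in> sect A U i \<Longrightarrow> b \<in> sect A U j \<Longrightarrow> c \<in> sect A U k \<Longrightarrow>
      gmult A U (gmult A U a b) c = gmult A U a (gmult A U b c)"
    using ***[THEN conjunct1] by blast
  show "a \<in> sect A U i \<Longrightarrow> b \<in> sect A U j \<Longrightarrow>
      gmult A U a b = (if odd (i * j) then - gmult A U b a else gmult A U b a)"
    using ****  by blast
qed

lemma gmult_in:
  "openin X U \<Longrightarrow> a \<in> sect A U i \<Longrightarrow> b \<in> sect A U j \<Longrightarrow> gmult A U a b \<in> sect A U (i + j)"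
  using gmult_bilinear[of U] unfolding graded_bilinear_def by simp

lemma gmult_linear_left:
  "openin X U \<Longrightarrow> b \<in> sect A U j \<Longrightarrow> linear_map_on (sect A U i) (\<lambda>a. gmult A U a b)"
  using gmult_bilinear[of U] unfolding graded_bilinear_def by simp

lemma gmult_linear_right:
  "openin X U \<Longrightarrow> a \<in> sect A U i \<Longrightarrow> linear_map_on (sect A U j) (gmult A U a)"
  using gmult_bilinear[of U] unfolding graded_bilinear_def by simp

lemma gmult_commute_even:
  assumes "openin X U" "a \<in> sect A U i" "b \<in> sect A U j" "even (i * j)"
  shows "gmult A U a b = gmult A U b a"
  using gmult_commute[OF assms(1-3)] assms(4) by (auto split: if_splits)

lemma restr_gone: "openin X U \<Longrightarrow> openin X V \<Longrightarrow> V \<subseteq> U \<Longrightarrow> restr A U V (gone A U) = gone A V"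
  using alg[unfolded sheaf_of_graded_algebras_def, THEN conjunct2, THEN conjunct2] by blast

lemma restr_gmult:
  "openin X U \<Longrightarrow> openin X V \<Longrightarrow> V \<subseteq> U \<Longrightarrow> a \<in> sect A U i \<Longrightarrow> b \<in> sect A U j \<Longrightarrow>
    restr A U V (gmult A U a b) = gmult A V (restr A U V a) (restr A U V b)"
  using alg[unfolded sheaf_of_graded_algebras_def, THEN conjunct2, THEN conjunct2] by blast

end

locale gmanifold =
  fixes X :: "'m topology" and A :: "('m, 'a::real_vector) galgebra"
  assumes manifold: "graded_manifold X A"
begin

sublocale galgebra_sheaf X A
  using manifold by unfold_locales (auto simp: graded_manifold_def graded_manifold_of_dim_def)

abbreviation val :: "'m \<Rightarrow> int \<Rightarrow> 'm set \<Rightarrow> 'a \<Rightarrow> real"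
  where "val \<equiv> gvalue X A"

text \<open>For fixed \<open>X\<close> and \<open>A\<close> the choice in \<open>gvalue\<close>
  depends only on \<open>m\<close>, not on the section or its domain. One chart therefore computes
  the values at \<open>m\<close> of all sections of degree 0, and linearity and multiplicativity can
  be checked in it.\<close>

lemma value_chart:
  assumes "m \<in> topspace X"
  obtains dm ds V \<phi> \<psi> where "m \<in> V" "graded_chart X A dm ds V \<phi> \<psi>"
    "\<And>U f. val m 0 U f = \<psi> (U \<inter> V) (restr A U (U \<inter> V) f) 0 (\<phi> m)"
proof -
  let ?P = "\<lambda>(dm, ds, V, \<phi>, \<psi>). m \<in> V \<and> graded_chart X A dm ds V \<phi> \<psi>"
  define c where "c = (SOME c. ?P c)"
  obtain dm ds V \<phi> \<psi> where c: "c = (dm, ds, V, \<phi>, \<psi>)" by (cases c)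
  have "\<exists>c. ?P c"
    using manifold assms unfolding graded_manifold_def graded_manifold_of_dim_def by fastforce
  then have "?P c" unfolding c_def by (rule someI_ex)
  moreover have "val m 0 U f = \<psi> (U \<inter> V) (restr A U (U \<inter> V) f) 0 (\<phi> m)" for U f
    unfolding gvalue_def c_def[symmetric] c by simp
  ultimately show thesis using that[of V dm ds \<phi> \<psi>] unfolding c by simp
qed

lemma chartD:
  assumes "graded_chart X A dm ds V \<phi> \<psi>"
  shows "openin X V"
    and "continuous_map (subtopology X V) (Euclidean_space (dm 0)) \<phi>"
    and "openin X U \<Longrightarrow> U \<subseteq> V \<Longrightarrow>
      bij_betw (\<psi> U) (sect A U k) (sect (local_model (dm 0) ds) (\<phi> ` U) k)"
    and "openin X U \<Longrightarrow> U \<subseteq> V \<Longrightarrow> linear_map_on (sect A U k) (\<psi> U)"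
    and "openin X U \<Longrightarrow> U \<subseteq> V \<Longrightarrow> \<psi> U (gone A U) = gone (local_model (dm 0) ds) (\<phi> ` U)"
    and "openin X U \<Longrightarrow> U \<subseteq> V \<Longrightarrow> a \<in> sect A U i \<Longrightarrow> b \<in> sect A U j \<Longrightarrow>
      \<psi> U (gmult A U a b) = gmult (local_model (dm 0) ds) (\<phi> ` U) (\<psi> U a) (\<psi> U b)"
    and "openin X U \<Longrightarrow> openin X W \<Longrightarrow> W \<subseteq> U \<Longrightarrow> U \<subseteq> V \<Longrightarrow> a \<in> sect A U k \<Longrightarrow>
      \<psi> W (restr A U W a) = restr (local_model (dm 0) ds) (\<phi> ` U) (\<phi> ` W) (\<psi> U a)"
proof -
  note * = assms[unfolded graded_chart_def Let_def]
  from * show "openin X V" by (elim conjE)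
  from * have "homeomorphic_map (subtopology X V) (subtopology (Euclidean_space (dm 0)) (\<phi> ` V)) \<phi>"
    by (elim conjE)
  then show "continuous_map (subtopology X V) (Euclidean_space (dm 0)) \<phi>"
    using homeomorphic_imp_continuous_map continuous_map_into_fulltopology by blast
  from * show "openin X U \<Longrightarrow> U \<subseteq> V \<Longrightarrow>
      bij_betw (\<psi> U) (sect A U k) (sect (local_model (dm 0) ds) (\<phi> ` U) k)"
    by (elim conjE) simp
  from * show "openin X U \<Longrightarrow> U \<subseteq> V \<Longrightarrow> linear_map_on (sect A U k) (\<psi> U)"
    by (elim conjE) simp
  from * show "openin X U \<Longrightarrow> U \<subseteq> V \<Longrightarrow> \<psi> U (gone A U) = gone (local_model (dm 0) ds) (\<phi> ` U)"
    by (elim conjE) simp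
  from * show "openin X U \<Longrightarrow> U \<subseteq> V \<Longrightarrow> a \<in> sect A U i \<Longrightarrow> b \<in> sect A U j \<Longrightarrow>
      \<psi> U (gmult A U a b) = gmult (local_model (dm 0) ds) (\<phi> ` U) (\<psi> U a) (\<psi> U b)"
    by (elim conjE) simp
  from * show "openin X U \<Longrightarrow> openin X W \<Longrightarrow> W \<subseteq> U \<Longrightarrow> U \<subseteq> V \<Longrightarrow> a \<in> sect A U k \<Longrightarrow>
      \<psi> W (restr A U W a) = restr (local_model (dm 0) ds) (\<phi> ` U) (\<phi> ` W) (\<psi> U a)"
    by (elim conjE) simp
qed

lemma val_nonzero_degree: "k \<noteq> 0 \<Longrightarrow> val m k U f = 0"
  by (simp add: gvalue_def)

lemma in_topspace: "openin X U \<Longrightarrow> m \<in> U \<Longrightarrow> m \<in> topspace X"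
  using openin_subset by blast

lemma val_restr:
  assumes U: "openin X U" and W: "openin X W" "W \<subseteq> U" "m \<in> W" and f: "f \<in> sect A U k"
  shows "val m k W (restr A U W f) = val m k U f"
proof (cases "k = 0")
  case True
  obtain dm ds V \<phi> \<psi> where V: "m \<in> V" and ch: "graded_chart X A dm ds V \<phi> \<psi>" and
    val: "\<And>U f. val m 0 U f = \<psi> (U \<inter> V) (restr A U (U \<inter> V) f) 0 (\<phi> m)"
    using value_chart[OF in_topspace[OF W(1,3)]] by metis
  note V' = chartD(1)[OF ch]
  have o: "openin X (U \<inter> V)" "openin X (W \<inter> V)" using U W V' by auto
  have f': "restr A U (U \<inter> V) f \<in> sect A (U \<inter> V) 0"
    using U o f True by (auto intro: A.restr_in)
  have "restr A W (W \<inter> V) (restr A U W f) = restr A U (W \<inter> V) f"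
    using U W o f by (auto intro: A.restr_restr)
  also have "\<dots> = restr A (U \<inter> V) (W \<inter> V) (restr A U (U \<inter> V) f)"
    using U W(2) o f by (intro A.restr_restr[symmetric]) auto
  finally have "\<psi> (W \<inter> V) (restr A W (W \<inter> V) (restr A U W f)) =
      restr (local_model (dm 0) ds) (\<phi> ` (U \<inter> V)) (\<phi> ` (W \<inter> V)) (\<psi> (U \<inter> V) (restr A U (U \<inter> V) f))"
    using W(2) o f' by (simp, intro chartD(7)[OF ch]) auto
  then show ?thesis using V W by (simp add: True val local_model_restr)
qed (simp add: gvalue_def)

lemma val_linear:
  assumes U: "openin X U" "m \<in> U"
  shows "linear_map_on (sect A U k) (val m k U)"
proof (cases "k = 0")
  case True
  obtain dm ds V \<phi> \<psi> where V: "m \<in> V" and ch: "graded_chart X A dm ds V \<phi> \<psi>" and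
    val: "\<And>U f. val m 0 U f = \<psi> (U \<inter> V) (restr A U (U \<inter> V) f) 0 (\<phi> m)"
    using value_chart[OF in_topspace[OF U]] by metis
  have o: "openin X (U \<inter> V)" using U chartD(1)[OF ch] by auto
  have lin: "linear_map_on (sect A (U \<inter> V) 0) (\<psi> (U \<inter> V))"
    using o by (intro chartD(4)[OF ch]) auto
  have lin': "linear_map_on (sect A U 0) (restr A U (U \<inter> V))"
    using U o by (intro A.restr_linear) auto
  have "restr A U (U \<inter> V) f \<in> sect A (U \<inter> V) 0" if "f \<in> sect A U 0" for f
    using that U o by (intro A.restr_in) auto
  then show ?thesis using lin lin'
    unfolding True val linear_map_on_def by (simp add: scaleR_fun_def)
qed (simp add: gvalue_def linear_map_on_def)

lemma val_zero: "openin X U \<Longrightarrow> m \<in> U \<Longrightarrow> val m k U 0 = 0"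
  using linear_map_on_zero[OF val_linear A.zero_in] .

lemma val_add: "openin X U \<Longrightarrow> m \<in> U \<Longrightarrow> f \<in> sect A U k \<Longrightarrow> g \<in> sect A U k \<Longrightarrow>
    val m k U (f + g) = val m k U f + val m k U g"
  using val_linear unfolding linear_map_on_def by blast

lemma val_diff: "openin X U \<Longrightarrow> m \<in> U \<Longrightarrow> f \<in> sect A U k \<Longrightarrow> g \<in> sect A U k \<Longrightarrow>
    val m k U (f - g) = val m k U f - val m k U g"
  using linear_map_on_diff[OF val_linear A.subspace_sect] .

lemma val_scale: "openin X U \<Longrightarrow> m \<in> U \<Longrightarrow> f \<in> sect A U k \<Longrightarrow>
    val m k U (c *\<^sub>R f) = c * val m k U f"
  using val_linear[of U m k] unfolding linear_map_on_def by simp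

lemma val_gone:
  assumes U: "openin X U" "m \<in> U"
  shows "val m 0 U (gone A U) = 1"
proof -
  obtain dm ds V \<phi> \<psi> where V: "m \<in> V" and ch: "graded_chart X A dm ds V \<phi> \<psi>" and
    val: "\<And>U f. val m 0 U f = \<psi> (U \<inter> V) (restr A U (U \<inter> V) f) 0 (\<phi> m)"
    using value_chart[OF in_topspace[OF U]] by metis
  have o: "openin X (U \<inter> V)" using U chartD(1)[OF ch] by auto
  have "restr A U (U \<inter> V) (gone A U) = gone A (U \<inter> V)"
    using U o by (intro restr_gone) auto
  moreover have "\<psi> (U \<inter> V) (gone A (U \<inter> V)) = gone (local_model (dm 0) ds) (\<phi> ` (U \<inter> V))"
    using o by (intro chartD(5)[OF ch]) auto
  ultimately show ?thesis using U V by (simp add: val local_model_gone)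
qed

text \<open>Besides multiplicativity of bodies, one mixed case occurs: factors of opposite nonzero
  degrees have a product of degree 0. Both sides are then 0, since a section of nonzero degree has
  no body.\<close>

lemma val_gmult:
  assumes U: "openin X U" "m \<in> U" and a: "a \<in> sect A U i" and b: "b \<in> sect A U j"
  shows "val m (i + j) U (gmult A U a b) = val m i U a * val m j U b"
proof (cases "i + j = 0")
  case True
  obtain dm ds V \<phi> \<psi> where V: "m \<in> V" and ch: "graded_chart X A dm ds V \<phi> \<psi>" and
    val: "\<And>U f. val m 0 U f = \<psi> (U \<inter> V) (restr A U (U \<inter> V) f) 0 (\<phi> m)"
    using value_chart[OF in_topspace[OF U]] by metis
  have o: "openin X (U \<inter> V)" using U chartD(1)[OF ch] by auto
  let ?r = "restr A U (U \<inter> V)"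
  have in_V: "?r a \<in> sect A (U \<inter> V) i" "?r b \<in> sect A (U \<inter> V) j"
    using U o a b by (auto intro: A.restr_in)
  have "?r (gmult A U a b) = gmult A (U \<inter> V) (?r a) (?r b)"
    using U o a b by (intro restr_gmult) auto
  then have "\<psi> (U \<inter> V) (?r (gmult A U a b)) =
      gmult (local_model (dm 0) ds) (\<phi> ` (U \<inter> V)) (\<psi> (U \<inter> V) (?r a)) (\<psi> (U \<inter> V) (?r b))"
    using o in_V by (simp, intro chartD(6)[OF ch]) auto
  then have eq: "val m (i + j) U (gmult A U a b) =
      \<psi> (U \<inter> V) (?r a) 0 (\<phi> m) * \<psi> (U \<inter> V) (?r b) 0 (\<phi> m)"
    by (simp add: True val local_model_gmult_body)
  show ?thesis
  proof (cases "i = 0")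
    case i: True
    then show ?thesis using eq True by (simp add: val)
  next
    case False
    have "\<psi> (U \<inter> V) (?r a) \<in> sect (local_model (dm 0) ds) (\<phi> ` (U \<inter> V)) i"
      using bij_betwE[OF chartD(3)[OF ch o, of i]] in_V by auto
    then have "\<psi> (U \<inter> V) (?r a) 0 = 0"
      using False by (auto simp: local_model_sect mdegree_zero dest: spec[of _ 0])
    then show ?thesis using eq False by (simp add: val_nonzero_degree)
  qed
next
  case False
  then show ?thesis by (auto simp: gvalue_def)
qed

text \<open>The body may vanish elsewhere in \<open>U\<close>, hence the smaller \<open>W\<close>.
  The inverse is found in the local model over the image of \<open>W\<close> and carried back by
  surjectivity of the chart isomorphism; the identity comes back by its injectivity.\<close>

lemma unit_near:
  assumes U: "openin X U" "m \<in> U" and f: "f \<in> sect A U 0" and nz: "val m 0 U f \<noteq> 0"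
  obtains W g where "openin X W" "m \<in> W" "W \<subseteq> U" "g \<in> sect A W 0"
    "gmult A W (restr A U W f) g = gone A W"
proof -
  obtain dm ds V \<phi> \<psi> where V: "m \<in> V" and ch: "graded_chart X A dm ds V \<phi> \<psi>" and
    val: "\<And>U f. val m 0 U f = \<psi> (U \<inter> V) (restr A U (U \<inter> V) f) 0 (\<phi> m)"
    using value_chart[OF in_topspace[OF U]] by metis
  let ?B = "local_model (dm 0) ds"
  have oV: "openin X (U \<inter> V)" using U chartD(1)[OF ch] by auto
  have fV: "restr A U (U \<inter> V) f \<in> sect A (U \<inter> V) 0"
    using U oV f by (auto intro: A.restr_in)
  define h where "h = \<psi> (U \<inter> V) (restr A U (U \<inter> V) f)"
  have "h \<in> sect ?B (\<phi> ` (U \<inter> V)) 0"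
    unfolding h_def using bij_betwE[OF chartD(3)[OF ch oV, of 0]] fV by auto
  then have "smooth_on (dm 0) (\<phi> ` (U \<inter> V)) (h 0)"
    by (auto simp: local_model_sect mdegree_zero multi_index_zero dest: spec[of _ 0])
  then have "continuous_map (subtopology (Euclidean_space (dm 0)) (\<phi> ` (U \<inter> V))) euclideanreal (h 0)"
    by (rule smooth_on_continuous)
  moreover have "continuous_map (subtopology X (U \<inter> V))
      (subtopology (Euclidean_space (dm 0)) (\<phi> ` (U \<inter> V))) \<phi>"
    using continuous_map_from_subtopology[OF chartD(2)[OF ch], of U]
    by (intro continuous_map_into_subtopology) (auto simp: subtopology_subtopology Int_commute)
  ultimately have "continuous_map (subtopology X (U \<inter> V)) euclideanreal (h 0 \<circ> \<phi>)"
    by (rule continuous_map_compose[rotated])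
  then have "openin (subtopology X (U \<inter> V))
      {x \<in> topspace (subtopology X (U \<inter> V)). (h 0 \<circ> \<phi>) x \<in> - {0}}"
    by (rule openin_continuous_map_preimage) auto
  then have W: "openin X {x \<in> topspace (subtopology X (U \<inter> V)). (h 0 \<circ> \<phi>) x \<in> - {0}}"
    using oV openin_open_subtopology by blast
  define W where "W = {x \<in> topspace (subtopology X (U \<inter> V)). (h 0 \<circ> \<phi>) x \<in> - {0}}"
  have oW: "openin X W" and sub: "W \<subseteq> U \<inter> V" and h: "\<And>x. x \<in> W \<Longrightarrow> h 0 (\<phi> x) \<noteq> 0"
    using W unfolding W_def by auto
  have "m \<in> W"
    using U V nz oV in_topspace[OF U] unfolding W_def val h_def by auto
  have fW: "restr A U W f \<in> sect A W 0"
    using U oW sub f by (auto intro: A.restr_in)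
  have "restr A U W f = restr A (U \<inter> V) W (restr A U (U \<inter> V) f)"
    using U oV oW sub f by (intro A.restr_restr[symmetric]) auto
  then have h': "\<psi> W (restr A U W f) = restr ?B (\<phi> ` (U \<inter> V)) (\<phi> ` W) h"
    unfolding h_def using oV oW sub fV by (simp, intro chartD(7)[OF ch]) auto
  have sub_V: "W \<subseteq> V" using sub by auto
  note bij = chartD(3)[OF ch oW this]
  obtain g' where g': "g' \<in> sect ?B (\<phi> ` W) 0"
    "gmult ?B (\<phi> ` W) (\<psi> W (restr A U W f)) g' = gone ?B (\<phi> ` W)"
  proof (atomize_elim, rule bexE[OF local_model_inverse])
    show "\<psi> W (restr A U W f) \<in> sect ?B (\<phi> ` W) 0"
      using bij_betwE[OF bij[of 0]] fW by auto
    show "\<psi> W (restr A U W f) 0 y \<noteq> 0" if "y \<in> \<phi> ` W" for y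
      using that h unfolding h' by (auto simp: local_model_restr)
  qed blast
  obtain g where g: "g \<in> sect A W 0" "\<psi> W g = g'"
    using g'(1) bij_betw_imp_surj_on[OF bij[of 0]] by (metis imageE)
  have "\<psi> W (gmult A W (restr A U W f) g) = \<psi> W (gone A W)"
    using chartD(6)[OF ch oW _ fW g(1)] chartD(5)[OF ch oW] sub g g' by simp
  then have "gmult A W (restr A U W f) g = gone A W"
    using bij_betw_imp_inj_on[OF bij[of 0]] gmult_in[OF oW fW g(1)] gone_in[OF oW]
    by (simp add: inj_on_def)
  then show thesis using that oW \<open>m \<in> W\<close> sub g(1) by blast
qed

end

section \<open>Sheaves of modules and frames\<close>

locale module_sheaf = gmanifold X A
  for X :: "'m topology" and A :: "('m, 'a::real_vector) galgebra" +
  fixes S :: "('m, 'a, 's::real_vector) gmodule"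
  assumes module: "sheaf_of_modules X A S"
begin

sublocale S: vsheaf X S
  using module by unfold_locales (simp add: sheaf_of_modules_def)

lemma module_axioms:
  assumes U: "openin X U"
  shows act_bilinear: "graded_bilinear (sect A U) (sect S U) (sect S U) (act S U)"
    and act_gone: "s \<in> sect S U k \<Longrightarrow> act S U (gone A U) s = s"
    and act_gmult: "a \<in> sect A U i \<Longrightarrow> b \<in> sect A U j \<Longrightarrow> s \<in> sect S U k \<Longrightarrow>
      act S U (gmult A U a b) s = act S U a (act S U b s)"
proof -
  note * = module[unfolded sheaf_of_modules_def, THEN conjunct2, THEN conjunct1, THEN spec, THEN mp, OF U]
  show "graded_bilinear (sect A U) (sect S U) (sect S U) (act S U)"
    by (rule *[THEN conjunct1])
  show "s \<in> sect S U k \<Longrightarrow> act S U (gone A U) s = s"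
    using *[THEN conjunct2, THEN conjunct1] by blast
  show "a \<in> sect A U i \<Longrightarrow> b \<in> sect A U j \<Longrightarrow> s \<in> sect S U k \<Longrightarrow>
      act S U (gmult A U a b) s = act S U a (act S U b s)"
    using *[THEN conjunct2, THEN conjunct2] by blast
qed

lemma restr_act:
  "openin X U \<Longrightarrow> openin X V \<Longrightarrow> V \<subseteq> U \<Longrightarrow> a \<in> sect A U i \<Longrightarrow> s \<in> sect S U k \<Longrightarrow>
    restr S U V (act S U a s) = act S V (restr A U V a) (restr S U V s)"
  using module[unfolded sheaf_of_modules_def, THEN conjunct2, THEN conjunct2] by blast

lemma act_in:
  assumes "openin X U" "a \<in> sect A U (k - i)" "s \<in> sect S U i"
  shows "act S U a s \<in> sect S U k"
proof -
  have "act S U a s \<in> sect S U (k - i + i)"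
    using act_bilinear[OF assms(1)] assms(2,3) unfolding graded_bilinear_def by blast
  then show ?thesis by simp
qed

lemma act_linear_left:
  "openin X U \<Longrightarrow> s \<in> sect S U j \<Longrightarrow> linear_map_on (sect A U i) (\<lambda>a. act S U a s)"
  using act_bilinear[of U] unfolding graded_bilinear_def by simp

lemma act_linear_right:
  "openin X U \<Longrightarrow> a \<in> sect A U i \<Longrightarrow> linear_map_on (sect S U j) (act S U a)"
  using act_bilinear[of U] unfolding graded_bilinear_def by simp

lemma act_zero_left: "openin X U \<Longrightarrow> s \<in> sect S U j \<Longrightarrow> act S U 0 s = 0"
  using linear_map_on_zero[OF act_linear_left A.zero_in] .

lemma act_add_left:
  "openin X U \<Longrightarrow> a \<in> sect A U i \<Longrightarrow> b \<in> sect A U i \<Longrightarrow> s \<in> sect S U j \<Longrightarrow>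
    act S U (a + b) s = act S U a s + act S U b s"
  using act_linear_left unfolding linear_map_on_def by blast

lemma act_diff_left:
  "openin X U \<Longrightarrow> a \<in> sect A U i \<Longrightarrow> b \<in> sect A U i \<Longrightarrow> s \<in> sect S U j \<Longrightarrow>
    act S U (a - b) s = act S U a s - act S U b s"
  using linear_map_on_diff[OF act_linear_left A.subspace_sect] .

lemma act_scale_left:
  "openin X U \<Longrightarrow> a \<in> sect A U i \<Longrightarrow> s \<in> sect S U j \<Longrightarrow>
    act S U (c *\<^sub>R a) s = c *\<^sub>R act S U a s"
  using act_linear_left[of U s j i] unfolding linear_map_on_def by simp

lemma act_sum_right:
  "openin X U \<Longrightarrow> a \<in> sect A U i \<Longrightarrow> (\<And>l. l \<in> I \<Longrightarrow> x l \<in> sect S U j) \<Longrightarrow>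
    act S U a (\<Sum>l\<in>I. x l) = (\<Sum>l\<in>I. act S U a (x l))"
  using linear_map_on_sum[OF act_linear_right S.subspace_sect] .

section \<open>Combinations with graded coefficients\<close>

text \<open>Only the values on \<open>I\<close> matter, in contrast to the extensional families of
  \<open>freely_generates\<close>. Coefficients can thus be updated, subtracted and extended by 0
  without care for other arguments.\<close>

definition coefs :: "'m set \<Rightarrow> nat set \<Rightarrow> (nat \<Rightarrow> int) \<Rightarrow> int \<Rightarrow> (nat \<Rightarrow> 'a) \<Rightarrow> bool"
  where "coefs U I d k f \<longleftrightarrow> (\<forall>i\<in>I. f i \<in> sect A U (k - d i))"

text \<open>The body does not involve \<open>sect\<close>, so a combination has the same value in a
  module and in its subsheaves.\<close>

definition comb :: "'m set \<Rightarrow> nat set \<Rightarrow> (nat \<Rightarrow> 's) \<Rightarrow> (nat \<Rightarrow> 'a) \<Rightarrow> 's"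
  where "comb U I s f = (\<Sum>i\<in>I. act S U (f i) (s i))"

lemma coefsD: "coefs U I d k f \<Longrightarrow> i \<in> I \<Longrightarrow> f i \<in> sect A U (k - d i)"
  by (simp add: coefs_def)

lemma coefs_restr:
  "openin X U \<Longrightarrow> openin X V \<Longrightarrow> V \<subseteq> U \<Longrightarrow> coefs U I d k f \<Longrightarrow> coefs V I d k (\<lambda>i. restr A U V (f i))"
  by (simp add: coefs_def A.restr_in)

lemma coefs_gmult:
  assumes "openin X U" "a \<in> sect A U (k - l)" "coefs U I d l f"
  shows "coefs U I d k (\<lambda>i. gmult A U a (f i))"
  unfolding coefs_def
proof
  fix i assume "i \<in> I"
  then have "gmult A U a (f i) \<in> sect A U (k - l + (l - d i))"
    using assms by (intro gmult_in) (auto simp: coefs_def)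
  then show "gmult A U a (f i) \<in> sect A U (k - d i)" by (simp add: algebra_simps)
qed

lemma coefs_add:
  "openin X U \<Longrightarrow> coefs U I d k f \<Longrightarrow> coefs U I d k g \<Longrightarrow> coefs U I d k (\<lambda>i. f i + g i)"
  by (simp add: coefs_def A.add_in)

lemma coefs_diff:
  "openin X U \<Longrightarrow> coefs U I d k f \<Longrightarrow> coefs U I d k g \<Longrightarrow> coefs U I d k (\<lambda>i. f i - g i)"
  by (simp add: coefs_def A.diff_in)

lemma comb_cong:
  "(\<And>i. i \<in> I \<Longrightarrow> f i = g i) \<Longrightarrow> (\<And>i. i \<in> I \<Longrightarrow> s i = t i) \<Longrightarrow> comb U I s f = comb U I t g"
  by (simp add: comb_def cong: sum.cong)

context
  fixes U :: "'m set" and I :: "nat set" and d :: "nat \<Rightarrow> int" and s :: "nat \<Rightarrow> 's"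
  assumes U: "openin X U" and s: "\<And>i. i \<in> I \<Longrightarrow> s i \<in> sect S U (d i)"
begin

lemma comb_in: "coefs U I d k f \<Longrightarrow> comb U I s f \<in> sect S U k"
  unfolding comb_def using U s by (intro S.sum_in act_in) (auto simp: coefs_def)

lemma comb_add:
  "coefs U I d k f \<Longrightarrow> coefs U I d k g \<Longrightarrow> comb U I s (\<lambda>i. f i + g i) = comb U I s f + comb U I s g"
  unfolding comb_def sum.distrib[symmetric]
  using U s by (intro sum.cong act_add_left) (auto simp: coefs_def)

lemma comb_diff:
  "coefs U I d k f \<Longrightarrow> coefs U I d k g \<Longrightarrow> comb U I s (\<lambda>i. f i - g i) = comb U I s f - comb U I s g"
  unfolding comb_def sum_subtractf[symmetric]
  using U s by (intro sum.cong act_diff_left) (auto simp: coefs_def)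

lemma comb_zero: "comb U I s (\<lambda>i. 0) = 0"
  unfolding comb_def using U s by (intro sum.neutral ballI act_zero_left)

lemma comb_gmult:
  assumes "a \<in> sect A U l" "coefs U I d k f"
  shows "act S U a (comb U I s f) = comb U I s (\<lambda>i. gmult A U a (f i))"
proof -
  have "act S U a (comb U I s f) = (\<Sum>i\<in>I. act S U a (act S U (f i) (s i)))"
    unfolding comb_def using assms U s by (intro act_sum_right[where j = k] act_in) (auto simp: coefs_def)
  also have "\<dots> = comb U I s (\<lambda>i. gmult A U a (f i))"
    unfolding comb_def using assms U s
    by (intro sum.cong act_gmult[symmetric]) (auto simp: coefs_def)
  finally show ?thesis .
qed

lemma comb_restr:
  assumes "openin X V" "V \<subseteq> U" "coefs U I d k f"
  shows "restr S U V (comb U I s f) = comb V I (\<lambda>i. restr S U V (s i)) (\<lambda>i. restr A U V (f i))"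
proof -
  have "restr S U V (comb U I s f) = (\<Sum>i\<in>I. restr S U V (act S U (f i) (s i)))"
    unfolding comb_def using assms U s by (intro S.restr_sum[where k = k] act_in) (auto simp: coefs_def)
  also have "\<dots> = comb V I (\<lambda>i. restr S U V (s i)) (\<lambda>i. restr A U V (f i))"
    unfolding comb_def using assms U s
    by (intro sum.cong restr_act) (auto simp: coefs_def)
  finally show ?thesis .
qed

end

section \<open>Frames and the exchange of a frame element\<close>

text \<open>Unique existence of coefficients is generation plus independence, by taking differences
  of coefficient families. \<open>restrict\<close> mediates between arbitrary and extensional
  families.\<close>

lemma freely_generates_iff:
  assumes U: "openin X U"
  shows "freely_generates A S U I d s \<longleftrightarrow>
    finite I \<and> (\<forall>i\<in>I. s i \<in> sect S U (d i)) \<and>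
    (\<forall>k. \<forall>t\<in>sect S U k. \<exists>f. coefs U I d k f \<and> t = comb U I s f) \<and>
    (\<forall>k f. coefs U I d k f \<longrightarrow> comb U I s f = 0 \<longrightarrow> (\<forall>i\<in>I. f i = 0))" (is "?L \<longleftrightarrow> ?R")
proof
  assume L: ?L
  then have fin: "finite I" and s: "\<forall>i\<in>I. s i \<in> sect S U (d i)" and
    gen: "\<And>k t. t \<in> sect S U k \<Longrightarrow>
       \<exists>!f. f \<in> (\<Pi>\<^sub>E i\<in>I. sect A U (k - d i)) \<and> t = comb U I s f"
    by (auto simp: freely_generates_def comb_def)
  have "\<forall>i\<in>I. f i = 0" if f: "coefs U I d k f" "comb U I s f = 0" for k f
  proof -
    have "restrict f I \<in> (\<Pi>\<^sub>E i\<in>I. sect A U (k - d i)) \<and> 0 = comb U I s (restrict f I)"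
      using f comb_cong[of I "restrict f I" f s s U] by (auto simp: coefs_def)
    moreover have "(\<lambda>i\<in>I. 0) \<in> (\<Pi>\<^sub>E i\<in>I. sect A U (k - d i)) \<and> 0 = comb U I s (\<lambda>i\<in>I. 0)"
      using comb_zero[OF U, of I s d] comb_cong[of I "\<lambda>i\<in>I. 0" "\<lambda>i. 0" s s U] s A.zero_in[OF U] by auto
    ultimately have "restrict f I = (\<lambda>i\<in>I. 0)"
      using gen[OF S.zero_in[OF U, of k]] by blast
    then show ?thesis by (metis restrict_apply')
  qed
  moreover have "\<exists>f. coefs U I d k f \<and> t = comb U I s f" if "t \<in> sect S U k" for k t
    using gen[OF that] unfolding coefs_def by (meson PiE_mem)
  ultimately show ?R using fin s by (intro conjI allI ballI impI) simp_all
next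
  assume R: ?R
  note R2 = R[THEN conjunct2, THEN conjunct1, rule_format]
    and R3 = R[THEN conjunct2, THEN conjunct2, THEN conjunct1, rule_format]
    and R4 = R[THEN conjunct2, THEN conjunct2, THEN conjunct2, rule_format]
  have "\<exists>!f. f \<in> (\<Pi>\<^sub>E i\<in>I. sect A U (k - d i)) \<and> t = comb U I s f" if t: "t \<in> sect S U k" for k t
  proof (rule ex_ex1I)
    obtain f where "coefs U I d k f" "t = comb U I s f" using R3[OF t] by blast
    then have "restrict f I \<in> (\<Pi>\<^sub>E i\<in>I. sect A U (k - d i)) \<and> t = comb U I s (restrict f I)"
      using comb_cong[of I "restrict f I" f s s U] by (auto simp: coefs_def)
    then show "\<exists>f. f \<in> (\<Pi>\<^sub>E i\<in>I. sect A U (k - d i)) \<and> t = comb U I s f" by blast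
  next
    fix f g
    assume f: "f \<in> (\<Pi>\<^sub>E i\<in>I. sect A U (k - d i)) \<and> t = comb U I s f"
      and g: "g \<in> (\<Pi>\<^sub>E i\<in>I. sect A U (k - d i)) \<and> t = comb U I s g"
    then have fg: "coefs U I d k f" "coefs U I d k g" by (auto simp: coefs_def)
    then have "comb U I s (\<lambda>i. f i - g i) = 0"
      using comb_diff[OF U R2 fg] f g by simp
    then have "f i - g i = 0" if "i \<in> I" for i
      using R4[OF coefs_diff[OF U fg] _ that] by simp
    then show "f = g"
      using f g by (intro PiE_ext[of f I _ g]) auto
  qed
  then show ?L using R by (simp add: freely_generates_def comb_def)
qed

lemma freely_generatesD:
  assumes "openin X U" "freely_generates A S U I d s"
  shows "finite I" and "i \<in> I \<Longrightarrow> s i \<in> sect S U (d i)"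
    and "t \<in> sect S U k \<Longrightarrow> \<exists>f. coefs U I d k f \<and> t = comb U I s f"
    and "coefs U I d k f \<Longrightarrow> comb U I s f = 0 \<Longrightarrow> i \<in> I \<Longrightarrow> f i = 0"
proof -
  note R = assms(2)[unfolded freely_generates_iff[OF assms(1)]]
  show "finite I" by (rule R[THEN conjunct1])
  show "i \<in> I \<Longrightarrow> s i \<in> sect S U (d i)" by (rule R[THEN conjunct2, THEN conjunct1, rule_format])
  show "t \<in> sect S U k \<Longrightarrow> \<exists>f. coefs U I d k f \<and> t = comb U I s f"
    by (rule R[THEN conjunct2, THEN conjunct2, THEN conjunct1, rule_format])
  show "coefs U I d k f \<Longrightarrow> comb U I s f = 0 \<Longrightarrow> i \<in> I \<Longrightarrow> f i = 0"
    by (rule R[THEN conjunct2, THEN conjunct2, THEN conjunct2, rule_format])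
qed

lemma freely_generatesI:
  assumes "openin X U" "finite I" "\<And>i. i \<in> I \<Longrightarrow> s i \<in> sect S U (d i)"
    and "\<And>k t. t \<in> sect S U k \<Longrightarrow> \<exists>f. coefs U I d k f \<and> t = comb U I s f"
    and "\<And>k f i. coefs U I d k f \<Longrightarrow> comb U I s f = 0 \<Longrightarrow> i \<in> I \<Longrightarrow> f i = 0"
  shows "freely_generates A S U I d s"
  unfolding freely_generates_iff[OF assms(1)] using assms(2-5)
  by (intro conjI allI ballI impI) (assumption, simp, simp, rule assms(5))

lemma freely_generates_unique:
  assumes U: "openin X U" and gen: "freely_generates A S U I d s"
    and f: "coefs U I d k f" and g: "coefs U I d k g" and eq: "comb U I s f = comb U I s g" and i: "i \<in> I"
  shows "f i = g i"
proof -
  have "comb U I s (\<lambda>i. f i - g i) = 0"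
    using comb_diff[OF U freely_generatesD(2)[OF U gen] f g] eq by simp
  then show ?thesis
    using freely_generatesD(4)[OF U gen coefs_diff[OF U f g] _ i] by simp
qed

lemma freely_generates_cong:
  assumes "\<And>i. i \<in> I \<Longrightarrow> d i = e i" "\<And>i. i \<in> I \<Longrightarrow> s i = t i"
  shows "freely_generates A S U I d s \<longleftrightarrow> freely_generates A S U I e t"
proof -
  have "(\<Pi>\<^sub>E i\<in>I. sect A U (k - d i)) = (\<Pi>\<^sub>E i\<in>I. sect A U (k - e i))" for k
    using assms(1) by (intro PiE_cong) simp
  moreover have "(\<Sum>i\<in>I. act S U (f i) (s i)) = (\<Sum>i\<in>I. act S U (f i) (t i))" for f
    using assms(2) by simp
  ultimately show ?thesis using assms by (simp add: freely_generates_def)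
qed

lemma frameD:
  assumes "frame X A S U I d s"
  shows "openin X U" "freely_generates A S U I d s"
    "openin X V \<Longrightarrow> V \<subseteq> U \<Longrightarrow> freely_generates A S V I d (\<lambda>i. restr S U V (s i))"
    "finite I" "i \<in> I \<Longrightarrow> s i \<in> sect S U (d i)"
proof -
  show *: "openin X U" "freely_generates A S U I d s"
    "openin X V \<Longrightarrow> V \<subseteq> U \<Longrightarrow> freely_generates A S V I d (\<lambda>i. restr S U V (s i))"
    using assms unfolding frame_def by simp_all
  show "finite I" "i \<in> I \<Longrightarrow> s i \<in> sect S U (d i)"
    using freely_generatesD(1,2)[OF *(1,2)] by auto
qed

text \<open>Looking at restrictions suffices: the case V = U is among them, and there restriction is
  the identity.\<close>

lemma frameI:
  assumes U: "openin X U" and s: "\<And>i. i \<in> I \<Longrightarrow> s i \<in> sect S U (d i)"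
    and "\<And>V. openin X V \<Longrightarrow> V \<subseteq> U \<Longrightarrow> freely_generates A S V I d (\<lambda>i. restr S U V (s i))"
  shows "frame X A S U I d s"
proof -
  have "freely_generates A S U I d (\<lambda>i. restr S U U (s i))" using assms by blast
  then have "freely_generates A S U I d s"
    using freely_generates_cong[of I d d "\<lambda>i. restr S U U (s i)" s U] S.restr_id[OF U s] by simp
  then show ?thesis using assms by (simp add: frame_def)
qed

lemma frame_restr:
  assumes fr: "frame X A S U I d s" and W: "openin X W" "W \<subseteq> U"
  shows "frame X A S W I d (\<lambda>i. restr S U W (s i))"
proof (rule frameI[OF W(1)])
  note U = frameD(1)[OF fr] and s = frameD(5)[OF fr]
  show "i \<in> I \<Longrightarrow> restr S U W (s i) \<in> sect S W (d i)" for i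
    using S.restr_in[OF U W s] .
  fix V assume V: "openin X V" "V \<subseteq> W"
  have "freely_generates A S V I d (\<lambda>i. restr S U V (s i))"
    using frameD(3)[OF fr V(1)] V W by blast
  then show "freely_generates A S V I d (\<lambda>i. restr S W V (restr S U W (s i)))"
    using freely_generates_cong[of I d d "\<lambda>i. restr S W V (restr S U W (s i))" "\<lambda>i. restr S U V (s i)" V]
      S.restr_restr[OF U W(1) V(1) V(2) W(2) s] by simp
qed

text \<open>Replacing \<open>s j\<close> by a combination \<open>t\<close> of the \<open>s i\<close> changes coefficients by a triangular
  substitution, which is invertible as soon as the coefficient of \<open>s j\<close> in \<open>t\<close> is a unit.\<close>

lemma comb_exchange:
  assumes U: "openin X U" and fin: "finite I" and s: "\<And>i. i \<in> I \<Longrightarrow> s i \<in> sect S U (d i)" and j: "j \<in> I"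
    and f: "coefs U I d (d j) f" and h: "coefs U I d k h"
  shows "comb U I (s(j := comb U I s f)) h =
    comb U I s (\<lambda>i. if i = j then gmult A U (h j) (f j) else h i + gmult A U (h j) (f i))"
proof -
  note hj = coefsD[OF h j]
  have hf: "coefs U I d k (\<lambda>i. gmult A U (h j) (f i))"
    by (rule coefs_gmult[OF U hj f])
  let ?h = "\<lambda>i. if i = j then 0 else h i"
  have h': "coefs U I d k ?h" using h A.zero_in[OF U] by (simp add: coefs_def)
  have "comb U I (s(j := comb U I s f)) h =
      act S U (h j) (comb U I s f) + (\<Sum>i\<in>I - {j}. act S U (h i) (s i))"
    using fin j by (simp add: comb_def sum.remove)
  also have "(\<Sum>i\<in>I - {j}. act S U (h i) (s i)) = comb U I s ?h"
    unfolding comb_def using fin j act_zero_left[OF U s[OF j]] by (simp add: sum.remove)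
  also have "act S U (h j) (comb U I s f) + comb U I s ?h =
      comb U I s (\<lambda>i. gmult A U (h j) (f i) + ?h i)"
    using comb_gmult[OF U s hj f] comb_add[OF U s hf h'] by simp
  also have "\<dots> = comb U I s (\<lambda>i. if i = j then gmult A U (h j) (f j) else h i + gmult A U (h j) (f i))"
    by (intro comb_cong) auto
  finally show ?thesis .
qed

lemma freely_generates_exchange:
  assumes U: "openin X U" and gen: "freely_generates A S U I d s" and j: "j \<in> I"
    and f: "coefs U I d (d j) f" and g: "g \<in> sect A U 0" "gmult A U (f j) g = gone A U"
  shows "freely_generates A S U I d (s(j := comb U I s f))"
proof -
  note s = freely_generatesD(2)[OF U gen] and fin = freely_generatesD(1)[OF U gen]
  let ?t = "s(j := comb U I s f)"
  have fj: "f j \<in> sect A U 0" using coefsD[OF f j] by simp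
  \<comment> \<open>\<open>g\<close> is a right inverse of \<open>f j\<close> by assumption; in
    degree 0 the commutation sign is +1, so it is a left inverse too.\<close>
  have gf: "gmult A U g (f j) = gone A U"
    using gmult_commute_even[OF U g(1) fj] g(2) by simp
  have t: "?t i \<in> sect S U (d i)" if "i \<in> I" for i
    using that comb_in[OF U s f] s by simp
  have span: "\<exists>h. coefs U I d k h \<and> x = comb U I ?t h" if x: "x \<in> sect S U k" for k x
  proof -
    obtain h where h: "coefs U I d k h" "x = comb U I s h"
      using freely_generatesD(3)[OF U gen x] by blast
    note hj = coefsD[OF h(1) j]
    \<comment> \<open>The coefficient c of the new element has to solve c f_j = h_j; the other
      coefficients are then corrected by c f_i.\<close>
    define c where "c = gmult A U (h j) g"
    have c: "c \<in> sect A U (k - d j)" using gmult_in[OF U hj g(1)] by (simp add: c_def)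
    have cf: "gmult A U c (f j) = h j"
      using gmult_assoc[OF U hj g(1) fj] gf gone_right[OF U hj] by (simp add: c_def)
    define h' where "h' = (\<lambda>i. if i = j then c else h i - gmult A U c (f i))"
    have h': "coefs U I d k h'"
      using coefs_diff[OF U h(1) coefs_gmult[OF U c f]] c by (simp add: coefs_def h'_def)
    have "comb U I ?t h' = comb U I s h"
      by (rule trans[OF comb_exchange[OF U fin s j f h'] comb_cong]) (auto simp: h'_def cf)
    then show ?thesis using h h' by metis
  qed
  have indep: "h i = 0" if h: "coefs U I d k h" "comb U I ?t h = 0" and i: "i \<in> I" for k h i
  proof -
    note hj = coefsD[OF h(1) j]
    let ?h = "\<lambda>i. if i = j then gmult A U (h j) (f j) else h i + gmult A U (h j) (f i)"
    have "coefs U I d k ?h"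
      using coefs_add[OF U h(1) coefs_gmult[OF U hj f]] coefs_gmult[OF U hj f] by (simp add: coefs_def)
    moreover have "comb U I s ?h = 0"
      using comb_exchange[OF U fin s j f h(1)] h(2) by simp
    ultimately have z: "?h i = 0" if "i \<in> I" for i
      using freely_generatesD(4)[OF U gen _ _ that, of k ?h] by blast
    \<comment> \<open>Independence of the old frame gives h_j f_j = 0; multiplying by the inverse of
      f_j recovers h_j, and the other coefficients follow.\<close>
    have "h j = gmult A U (gmult A U (h j) (f j)) g"
      using gmult_assoc[OF U hj fj g(1)] g(2) gone_right[OF U hj] by simp
    then have "h j = 0"
      using z[OF j] linear_map_on_zero[OF gmult_linear_left[OF U g(1)] A.zero_in[OF U]] by simp
    moreover have "gmult A U 0 (f i) = 0" if "i \<in> I" for i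
      using linear_map_on_zero[OF gmult_linear_left[OF U coefsD[OF f that]] A.zero_in[OF U]] .
    ultimately show ?thesis using z[OF i] i by (auto split: if_splits)
  qed
  show ?thesis
    by (rule freely_generatesI[OF U fin]) (erule t span indep; assumption)+
qed

text \<open>Exchange commutes with restriction: units restrict to units and combinations to
  combinations, so \<open>freely_generates_exchange\<close> applies over each smaller open
  set.\<close>

lemma frame_exchange:
  assumes fr: "frame X A S U I d s" and j: "j \<in> I"
    and f: "coefs U I d (d j) f" and g: "g \<in> sect A U 0" "gmult A U (f j) g = gone A U"
  shows "frame X A S U I d (s(j := comb U I s f))"
proof (rule frameI)
  show U: "openin X U" by (rule frameD(1)[OF fr])
  note s = frameD(5)[OF fr]
  show "(s(j := comb U I s f)) i \<in> sect S U (d i)" if "i \<in> I" for i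
    using that comb_in[OF U s f] s by simp
  fix V assume V: "openin X V" "V \<subseteq> U"
  let ?s = "\<lambda>i. restr S U V (s i)" and ?f = "\<lambda>i. restr A U V (f i)"
  have "freely_generates A S V I d (?s(j := comb V I ?s ?f))"
  proof (rule freely_generates_exchange[OF V(1) frameD(3)[OF fr V] j])
    show "coefs V I d (d j) ?f" by (rule coefs_restr[OF U V f])
    show "restr A U V g \<in> sect A V 0" by (rule A.restr_in[OF U V g(1)])
    show "gmult A V (restr A U V (f j)) (restr A U V g) = gone A V"
      using restr_gmult[OF U V coefsD[OF f j] g(1)] g(2) restr_gone[OF U V] by simp
  qed
  moreover have "(\<lambda>i. restr S U V ((s(j := comb U I s f)) i)) = ?s(j := comb V I ?s ?f)"
    using comb_restr[OF U s V f] by auto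
  ultimately show "freely_generates A S V I d (\<lambda>i. restr S U V ((s(j := comb U I s f)) i))"
    by simp
qed

end

section \<open>Fibers\<close>

context vsheaf
begin

text \<open>Three germs are treated at once because transitivity of \<open>fiber_rel\<close>
  compares three.\<close>

lemma stalk_common:
  assumes "G \<in> vcarrier (stalk X S m k)" "H \<in> vcarrier (stalk X S m k)" "K \<in> vcarrier (stalk X S m k)"
  obtains U x y z where "openin X U" "m \<in> U" "x \<in> sect S U k" "y \<in> sect S U k" "z \<in> sect S U k"
    "G = germ X S m k U x" "H = germ X S m k U y" "K = germ X S m k U z"
proof -
  from assms obtain U x V y W z where
    U: "openin X U" "m \<in> U" "x \<in> sect S U k" "G = germ X S m k U x" and
    V: "openin X V" "m \<in> V" "y \<in> sect S V k" "H = germ X S m k V y" and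
    W: "openin X W" "m \<in> W" "z \<in> sect S W k" "K = germ X S m k W z"
    unfolding stalk_carrier by blast
  let ?B = "U \<inter> V \<inter> W"
  have B: "openin X ?B" "m \<in> ?B" "?B \<subseteq> U" "?B \<subseteq> V" "?B \<subseteq> W" using U V W by auto
  show thesis
    by (rule that[OF B(1,2) restr_in[OF U(1) B(1,3) U(3)] restr_in[OF V(1) B(1,4) V(3)]
          restr_in[OF W(1) B(1,5) W(3)]])
      (simp_all add: U V W germ_restr[OF U(1) B(2) U(3) B(1,3)] germ_restr[OF V(1) B(2) V(3) B(1,4)]
        germ_restr[OF W(1) B(2) W(3) B(1,5)])
qed

end

context module_sheaf
begin

lemma stalk_act_germ:
  assumes U: "openin X U" "m \<in> U" and a: "a \<in> sect A U i" and s: "s \<in> sect S U j" and k: "k = i + j"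
  shows "stalk_act X A S m k (germ X A m i U a) (germ X S m j U s) = germ X S m k U (act S U a s)"
proof -
  have act: "act S V b t \<in> sect S V k" if "openin X V" "b \<in> sect A V i" "t \<in> sect S V j" for V b t
    using act_in[of V b k j t] that k by simp
  have *: "germ X S m k (V \<inter> W) (act S (V \<inter> W) (restr A V (V \<inter> W) b) (restr S W (V \<inter> W) t)) =
      germ X S m k U (act S U a s)"
    if g: "(V, b) \<in> germ X A m i U a" "(W, t) \<in> germ X S m j U s" for V b W t
  proof -
    note V = A.germ_mem_eq[OF U a g(1)] and W = S.germ_mem_eq[OF U s g(2)]
    obtain B C where B: "openin X B" "m \<in> B" "B \<subseteq> U \<inter> V" "restr A U B a = restr A V B b" and
      C: "openin X C" "m \<in> C" "C \<subseteq> U \<inter> W" "restr S U C s = restr S W C t"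
      using g U s a by (auto simp: A.germ_mem S.germ_mem)
    have D: "openin X (B \<inter> C)" "m \<in> B \<inter> C" "B \<inter> C \<subseteq> U" "B \<inter> C \<subseteq> V \<inter> W" using B C by auto
    have VW: "openin X (V \<inter> W)" "V \<inter> W \<subseteq> V" "V \<inter> W \<subseteq> W" using V W by auto
    note b' = A.restr_in[OF V(1) VW(1,2) V(3)] and t' = S.restr_in[OF W(1) VW(1,3) W(3)]
    have "restr A U (B \<inter> C) a = restr A V (B \<inter> C) b"
      using B D U V a by (intro A.restr_eq_mono[OF _ _ _ _ _ _ _ _ _ B(4)]) auto
    moreover have "restr S U (B \<inter> C) s = restr S W (B \<inter> C) t"
      using C D U W s by (intro S.restr_eq_mono[OF _ _ _ _ _ _ _ _ _ C(4)]) auto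
    ultimately have "restr S (V \<inter> W) (B \<inter> C) (act S (V \<inter> W) (restr A V (V \<inter> W) b) (restr S W (V \<inter> W) t)) =
        restr S U (B \<inter> C) (act S U a s)"
      using restr_act[OF VW(1) D(1,4) b' t'] restr_act[OF U(1) D(1,3) a s]
        A.restr_restr[OF V(1) VW(1) D(1,4) VW(2) V(3)] S.restr_restr[OF W(1) VW(1) D(1,4) VW(3) W(3)]
      by simp
    then show ?thesis
      using D U(2) V(2) W(2) by (subst S.germ_eq_iff[OF VW(1) _ act[OF VW(1) b' t'] U(1) _ act[OF U(1) a s]]) auto
  qed
  have "(\<Union>(W, t)\<in>germ X S m j U s. germ X S m k (V \<inter> W)
      (act S (V \<inter> W) (restr A V (V \<inter> W) b) (restr S W (V \<inter> W) t))) = germ X S m k U (act S U a s)"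
    if "(V, b) \<in> germ X A m i U a" for V b
    by (rule UN_pairs_constant[OF S.germ_self[OF U s] *[OF that]])
  then show ?thesis
    unfolding stalk_act_def by (rule UN_pairs_constant[OF A.germ_self[OF U a]])
qed

text \<open>Vanishing of the fiber class of a section at \<open>m\<close>. This predicate keeps
  arguments about fibers on the level of sections.\<close>

definition nul :: "'m \<Rightarrow> int \<Rightarrow> 'm set \<Rightarrow> 's \<Rightarrow> bool"
  where "nul m k U x \<longleftrightarrow> germ X S m k U x \<in> ideal_stalk X A S m k"

lemma nul_zero: "openin X U \<Longrightarrow> m \<in> U \<Longrightarrow> nul m k U 0"
  using ideal_stalk.zero[of X S m k A] S.vzero_germ[of U m k] by (simp add: nul_def)

lemma nul_restr:
  "openin X U \<Longrightarrow> m \<in> V \<Longrightarrow> x \<in> sect S U k \<Longrightarrow> openin X V \<Longrightarrow> V \<subseteq> U \<Longrightarrow>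
    nul m k V (restr S U V x) \<longleftrightarrow> nul m k U x"
  by (simp add: nul_def S.germ_restr)

text \<open>Each index contributes one generator of the ideal. The \<open>s i\<close> are arbitrary
  sections, so the lemma also covers images of a frame under a morphism.\<close>

lemma nul_comb:
  assumes U: "openin X U" "m \<in> U" and fin: "finite I"
  shows "\<lbrakk>\<And>i. i \<in> I \<Longrightarrow> s i \<in> sect S U (d i); coefs U I d k f;
    \<And>i. i \<in> I \<Longrightarrow> val m (k - d i) U (f i) = 0\<rbrakk> \<Longrightarrow> nul m k U (comb U I s f)"
  using fin
proof (induction I)
  case empty
  then show ?case using nul_zero[OF U] by (simp add: comb_def)
next
  case (insert i I)
  have fi: "f i \<in> sect A U (k - d i)" and si: "s i \<in> sect S U (d i)" and c: "coefs U I d k f"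
    using insert.prems by (auto simp: coefs_def)
  \<comment> \<open>In the rule \<open>add\<close> the function has degree k - d i, so the section
    must be presented in degree k - (k - d i).\<close>
  have k: "k - (k - d i) = d i" by simp
  have "vadd (stalk X S m k) (stalk_act X A S m k (germ X A m (k - d i) U (f i)) (germ X S m (d i) U (s i)))
      (germ X S m k U (comb U I s f)) \<in> ideal_stalk X A S m k"
  proof (rule ideal_stalk.add)
    show "germ X A m (k - d i) U (f i) \<in> vanishing_germs X A m (k - d i)"
      using U fi insert.prems(3)[of i] by (auto simp: vanishing_germs_def nbhd_sections_def)
    show "germ X S m (d i) U (s i) \<in> vcarrier (stalk X S m (k - (k - d i)))"
      unfolding k by (rule S.germ_in_carrier[OF U si])
    show "germ X S m k U (comb U I s f) \<in> ideal_stalk X A S m k"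
      using insert.IH[OF insert.prems(1) c] insert.prems(3) unfolding nul_def by blast
  qed
  then have "germ X S m k U (act S U (f i) (s i) + comb U I s f) \<in> ideal_stalk X A S m k"
    using stalk_act_germ[OF U fi si] S.vadd_germ[OF U act_in[OF U(1) fi si] comb_in[OF U(1) _ c, of s]]
      insert.prems(1) by simp
  then show ?case using insert.hyps by (simp add: nul_def comb_def)
qed

text \<open>The converse of \<open>nul_comb\<close>, by induction on the sums that make up the
  ideal. The neighborhood shrinks with each summand. A function vanishing at \<open>m\<close> times
  a section has coefficients vanishing at \<open>m\<close>, by multiplicativity of values.\<close>

lemma ideal_stalk_comb:
  assumes fr: "frame X A S U I d s" and m: "m \<in> U" and H: "H \<in> ideal_stalk X A S m k"
  shows "\<exists>W f. openin X W \<and> m \<in> W \<and> W \<subseteq> U \<and> coefs W I d k f \<and>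
    (\<forall>i\<in>I. val m (k - d i) W (f i) = 0) \<and>
    H = germ X S m k W (comb W I (\<lambda>i. restr S U W (s i)) f)"
  using H
proof induction
  note U = frameD(1)[OF fr] and s = frameD(5)[OF fr]
  case zero
  have "coefs U I d k (\<lambda>i. 0)" by (simp add: coefs_def A.zero_in[OF U])
  moreover have "\<forall>i\<in>I. val m (k - d i) U 0 = 0" using val_zero[OF U m] by blast
  moreover have "vzero (stalk X S m k) = germ X S m k U (comb U I (\<lambda>i. restr S U U (s i)) (\<lambda>i. 0))"
    using S.vzero_germ[OF U m] comb_zero[OF U, of I "\<lambda>i. restr S U U (s i)" d] S.restr_in[OF U U order_refl s]
    by simp
  ultimately show ?case using U m by blast
next
  note U = frameD(1)[OF fr] and s = frameD(5)[OF fr]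
  case (add f i G H)
  obtain W h where W: "openin X W" "m \<in> W" "W \<subseteq> U" and h: "coefs W I d k h"
    "\<forall>i\<in>I. val m (k - d i) W (h i) = 0" and
    H: "H = germ X S m k W (comb W I (\<lambda>i. restr S U W (s i)) h)"
    using add.IH by blast
  obtain V a where V: "openin X V" "m \<in> V" "a \<in> sect A V i" "val m i V a = 0" and
    a: "f = germ X A m i V a"
    using add.hyps(1) by (auto simp: vanishing_germs_def nbhd_sections_def)
  obtain V' z where V': "openin X V'" "m \<in> V'" "z \<in> sect S V' (k - i)" and
    z: "G = germ X S m (k - i) V' z"
    using add.hyps(2) by (auto simp: S.stalk_carrier)
  define B where "B = V \<inter> V' \<inter> W"
  have B: "openin X B" "m \<in> B" "B \<subseteq> V" "B \<subseteq> V'" "B \<subseteq> W" "B \<subseteq> U"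
    using V V' W by (auto simp: B_def)
  let ?s = "\<lambda>i. restr S U B (s i)"
  note sB = S.restr_in[OF U B(1,6) s]
  note gen = frameD(3)[OF fr B(1,6)]
  have zB: "restr S V' B z \<in> sect S B (k - i)" by (rule S.restr_in[OF V'(1) B(1,4) V'(3)])
  obtain g where g: "coefs B I d (k - i) g" "restr S V' B z = comb B I ?s g"
    using freely_generatesD(3)[OF B(1) gen zB] by blast
  let ?a = "restr A V B a"
  have aB: "?a \<in> sect A B i" by (rule A.restr_in[OF V(1) B(1,3) V(3)])
  have "val m i B ?a = 0" using val_restr[OF V(1) B(1,3,2) V(3)] V(4) by simp
  have aB': "?a \<in> sect A B (k - (k - i))" using aB by simp
  note ag = coefs_gmult[OF B(1) aB' g(1)]
  have hB: "coefs B I d k (\<lambda>i. restr A W B (h i))" by (rule coefs_restr[OF W(1) B(1,5) h(1)])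
  let ?f = "\<lambda>l. gmult A B ?a (g l) + restr A W B (h l)"
  have f: "coefs B I d k ?f" by (rule coefs_add[OF B(1) ag hB])
  have "val m (k - d l) B (?f l) = 0" if l: "l \<in> I" for l
  proof -
    have "val m (i + (k - i - d l)) B (gmult A B ?a (g l)) = 0"
      using val_gmult[OF B(1,2) aB coefsD[OF g(1) l]] \<open>val m i B ?a = 0\<close> by simp
    then have "val m (k - d l) B (gmult A B ?a (g l)) = 0" by (simp add: algebra_simps)
    moreover have "val m (k - d l) B (restr A W B (h l)) = 0"
      using val_restr[OF W(1) B(1,5,2) coefsD[OF h(1) l]] h(2) l by simp
    ultimately show ?thesis
      using val_add[OF B(1,2) coefsD[OF ag l] coefsD[OF hB l]] by simp
  qed
  moreover have "vadd (stalk X S m k) (stalk_act X A S m k f G) H = germ X S m k B (comb B I ?s ?f)"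
  proof -
    have "f = germ X A m i B ?a" using A.germ_restr[OF V(1) B(2) V(3) B(1,3)] a by simp
    moreover have "G = germ X S m (k - i) B (comb B I ?s g)"
      using S.germ_restr[OF V'(1) B(2) V'(3) B(1,4)] z g(2) by simp
    ultimately have "stalk_act X A S m k f G = germ X S m k B (act S B ?a (comb B I ?s g))"
      using stalk_act_germ[OF B(1,2) aB comb_in[OF B(1) sB g(1)], of k] by simp
    also have "act S B ?a (comb B I ?s g) = comb B I ?s (\<lambda>i. gmult A B ?a (g i))"
      by (rule comb_gmult[OF B(1) sB aB g(1)])
    finally have fG: "stalk_act X A S m k f G = germ X S m k B (comb B I ?s (\<lambda>i. gmult A B ?a (g i)))" .
    have sW: "restr S U W (s l) \<in> sect S W (d l)" if "l \<in> I" for l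
      by (rule S.restr_in[OF U W(1,3) s[OF that]])
    have "restr S W B (comb W I (\<lambda>i. restr S U W (s i)) h) = comb B I ?s (\<lambda>i. restr A W B (h i))"
      using S.restr_restr[OF U W(1) B(1,5) W(3) s]
      by (subst comb_restr[OF W(1) sW B(1,5) h(1)]) (auto intro!: comb_cong)
    then have "H = germ X S m k B (comb B I ?s (\<lambda>i. restr A W B (h i)))"
      using S.germ_restr[OF W(1) B(2) comb_in[OF W(1) sW h(1)] B(1,5)] H by simp
    then show ?thesis
      using fG S.vadd_germ[OF B(1,2) comb_in[OF B(1) sB ag] comb_in[OF B(1) sB hB]]
        comb_add[OF B(1) sB ag hB] by simp
  qed
  ultimately show ?case using B f by blast
qed

text \<open>The values of the coefficients at \<open>m\<close> are the coordinates of the fiber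
  class. For the forward direction, the combination supplied by \<open>ideal_stalk_comb\<close>
  agrees with the given one near \<open>m\<close>, and uniqueness of coefficients there transfers
  the values.\<close>

lemma nul_iff:
  assumes fr: "frame X A S U I d s" and m: "m \<in> U" and f: "coefs U I d k f"
  shows "nul m k U (comb U I s f) \<longleftrightarrow> (\<forall>i\<in>I. val m (k - d i) U (f i) = 0)"
proof
  note U = frameD(1)[OF fr] and s = frameD(5)[OF fr]
  assume "nul m k U (comb U I s f)"
  then have "germ X S m k U (comb U I s f) \<in> ideal_stalk X A S m k" by (simp add: nul_def)
  from ideal_stalk_comb[OF fr m this] obtain W h where W: "openin X W" "m \<in> W" "W \<subseteq> U" and h: "coefs W I d k h"
    "\<forall>i\<in>I. val m (k - d i) W (h i) = 0" and
    eq: "germ X S m k U (comb U I s f) = germ X S m k W (comb W I (\<lambda>i. restr S U W (s i)) h)"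
    by blast
  have sW: "restr S U W (s l) \<in> sect S W (d l)" if "l \<in> I" for l
    by (rule S.restr_in[OF U W(1,3) s[OF that]])
  obtain B where B: "openin X B" "m \<in> B" "B \<subseteq> U \<inter> W" and
    eq: "restr S U B (comb U I s f) = restr S W B (comb W I (\<lambda>i. restr S U W (s i)) h)"
    using eq S.germ_eq_iff[OF U m comb_in[OF U s f] W(1,2) comb_in[OF W(1) sW h(1)]] by blast
  have BU: "B \<subseteq> U" and BW: "B \<subseteq> W" using B by auto
  let ?s = "\<lambda>i. restr S U B (s i)"
  have "restr S W B (comb W I (\<lambda>i. restr S U W (s i)) h) = comb B I ?s (\<lambda>i. restr A W B (h i))"
    using S.restr_restr[OF U W(1) B(1) BW W(3) s]
    by (subst comb_restr[OF W(1) sW B(1) BW h(1)]) (auto intro!: comb_cong)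
  moreover have "restr S U B (comb U I s f) = comb B I ?s (\<lambda>i. restr A U B (f i))"
    by (rule comb_restr[OF U s B(1) BU f])
  ultimately have fh: "restr A U B (f i) = restr A W B (h i)" if "i \<in> I" for i
    using freely_generates_unique[OF B(1) frameD(3)[OF fr B(1) BU] coefs_restr[OF U B(1) BU f]
      coefs_restr[OF W(1) B(1) BW h(1)] _ that] eq by simp
  show "\<forall>i\<in>I. val m (k - d i) U (f i) = 0"
  proof
    fix i assume i: "i \<in> I"
    show "val m (k - d i) U (f i) = 0"
      using val_restr[OF U B(1) BU B(2) coefsD[OF f i]] val_restr[OF W(1) B(1) BW B(2) coefsD[OF h(1) i]]
        h(2) i fh[OF i] by simp
  qed
next
  assume "\<forall>i\<in>I. val m (k - d i) U (f i) = 0"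
  then show "nul m k U (comb U I s f)"
    using nul_comb[OF frameD(1)[OF fr] m frameD(4)[OF fr] frameD(5)[OF fr] f] by blast
qed

lemma fiber_rel_germ:
  assumes U: "openin X U" "m \<in> U" and x: "x \<in> sect S U k" and y: "y \<in> sect S U k"
  shows "(germ X S m k U x, germ X S m k U y) \<in> fiber_rel X A S m k \<longleftrightarrow> nul m k U (x - y)"
  using S.germ_in_carrier[OF U x] S.germ_in_carrier[OF U y] S.vscale_germ[OF U y, of "-1"]
    S.vadd_germ[OF U x S.scale_in[OF U(1) y], of "-1"]
  by (simp add: fiber_rel_def nul_def)

end

locale vbundle = module_sheaf X A S
  for X :: "'m topology" and A :: "('m, 'a::real_vector) galgebra"
    and S :: "('m, 'a, 's::real_vector) gmodule" +
  assumes vector_bundle: "graded_vector_bundle X A S"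
begin

lemma frame_near:
  assumes "m \<in> topspace X"
  obtains U I d s where "m \<in> U" "frame X A S U I d s"
  using vector_bundle assms unfolding graded_vector_bundle_def by blast

text \<open>A subbundle prescribes fixed index sets but no fixed degrees, so of the graded rank only
  the total number of frame elements is kept.\<close>

lemma constant_rank:
  obtains r where "\<forall>m\<in>topspace X. \<exists>U I d s. m \<in> U \<and> frame X A S U I d s \<and> card I = r"
proof -
  have "card I = sum (frame_rank I d) {j. frame_rank I d j \<noteq> 0}" if "finite I" for I :: "nat set" and d
  proof -
    have "{j. frame_rank I d j \<noteq> 0} = d ` I" using that by (auto simp: frame_rank_def)
    then show ?thesis
      using sum.image_gen[OF that, of "\<lambda>_. 1::nat" d] by (simp add: frame_rank_def)
  qed
  then have *: "frame X A S U I d s \<and> frame_rank I d = \<rho> \<Longrightarrow>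
      frame X A S U I d s \<and> card I = sum \<rho> {j. \<rho> j \<noteq> 0}" for U I d s \<rho>
    using frameD(4) by blast
  obtain \<rho> where "\<forall>m\<in>topspace X.
      \<exists>U I d s. m \<in> U \<and> frame X A S U I d s \<and> frame_rank I d = \<rho>"
    using vector_bundle unfolding graded_vector_bundle_def by blast
  then have "\<forall>m\<in>topspace X. \<exists>U I d s. m \<in> U \<and> frame X A S U I d s \<and> card I = sum \<rho> {j. \<rho> j \<noteq> 0}"
    using * by meson
  then show thesis by (rule that)
qed

text \<open>The rules of \<open>ideal_stalk\<close> add one product at a time, which makes closure
  under sums awkward to read off. In a frame near \<open>m\<close>, \<open>nul_iff\<close> reduces
  it to linearity of values.\<close>

lemma nul_subspace:
  assumes U: "openin X U" "m \<in> U"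
  shows "subspace {x \<in> sect S U k. nul m k U x}"
proof -
  obtain V I d s where V: "m \<in> V" and fr: "frame X A S V I d s"
    using frame_near[OF in_topspace[OF U]] by blast
  define W where "W = U \<inter> V"
  have W: "openin X W" "m \<in> W" "W \<subseteq> U" "W \<subseteq> V"
    using U V frameD(1)[OF fr] by (auto simp: W_def)
  note frW = frame_restr[OF fr W(1,4)]
  let ?s = "\<lambda>i. restr S V W (s i)"
  note s = frameD(5)[OF frW]
  have ex: "\<exists>f. coefs W I d k f \<and> restr S U W x = comb W I ?s f \<and> (\<forall>i\<in>I. val m (k - d i) W (f i) = 0)"
    if x: "x \<in> sect S U k" "nul m k U x" for x
  proof -
    obtain f where f: "coefs W I d k f" "restr S U W x = comb W I ?s f"
      using freely_generatesD(3)[OF frameD(1,2)[OF frW] S.restr_in[OF U(1) W(1,3) x(1)]] by blast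
    then show ?thesis
      using nul_iff[OF frW W(2) f(1)] nul_restr[OF U(1) W(2) x(1) W(1,3)] x(2) by auto
  qed
  have nulI: "nul m k U x" if x: "x \<in> sect S U k" and f: "coefs W I d k f" "restr S U W x = comb W I ?s f"
    "\<And>i. i \<in> I \<Longrightarrow> val m (k - d i) W (f i) = 0" for x f
    using nul_iff[OF frW W(2) f(1)] nul_restr[OF U(1) W(2) x W(1,3)] f(2,3) by auto
  show ?thesis
  proof (rule subspaceI)
    show "0 \<in> {x \<in> sect S U k. nul m k U x}" using nul_zero[OF U] S.zero_in[OF U(1)] by simp
  next
    fix x y assume "x \<in> {x \<in> sect S U k. nul m k U x}" "y \<in> {x \<in> sect S U k. nul m k U x}"
    then have x: "x \<in> sect S U k" "nul m k U x" and y: "y \<in> sect S U k" "nul m k U y" by auto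
    obtain f where f: "coefs W I d k f" "restr S U W x = comb W I ?s f"
        "\<forall>i\<in>I. val m (k - d i) W (f i) = 0" using ex[OF x] by blast
    obtain g where g: "coefs W I d k g" "restr S U W y = comb W I ?s g"
        "\<forall>i\<in>I. val m (k - d i) W (g i) = 0" using ex[OF y] by blast
    have "nul m k U (x + y)"
    proof (rule nulI[OF S.add_in[OF U(1) x(1) y(1)] coefs_add[OF W(1) f(1) g(1)]])
      show "restr S U W (x + y) = comb W I ?s (\<lambda>i. f i + g i)"
        using S.restr_add[OF U(1) W(1,3) x(1) y(1)] comb_add[OF W(1) s f(1) g(1)] f g by simp
      show "val m (k - d i) W (f i + g i) = 0" if "i \<in> I" for i
        using val_add[OF W(1,2) coefsD[OF f(1) that] coefsD[OF g(1) that]] f g that by simp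
    qed
    then show "x + y \<in> {x \<in> sect S U k. nul m k U x}" using S.add_in[OF U(1) x(1) y(1)] by simp
  next
    fix c x assume "x \<in> {x \<in> sect S U k. nul m k U x}"
    then have x: "x \<in> sect S U k" "nul m k U x" by auto
    obtain f where f: "coefs W I d k f" "restr S U W x = comb W I ?s f"
        "\<forall>i\<in>I. val m (k - d i) W (f i) = 0" using ex[OF x] by blast
    have "nul m k U (c *\<^sub>R x)"
    proof (rule nulI[OF S.scale_in[OF U(1) x(1)], of "\<lambda>i. c *\<^sub>R f i"])
      show "coefs W I d k (\<lambda>i. c *\<^sub>R f i)" using f(1) by (simp add: coefs_def A.scale_in[OF W(1)])
      have "act S W (c *\<^sub>R f i) (?s i) = c *\<^sub>R act S W (f i) (?s i)" if "i \<in> I" for i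
        by (rule act_scale_left[OF W(1) coefsD[OF f(1) that] s[OF that]])
      then show "restr S U W (c *\<^sub>R x) = comb W I ?s (\<lambda>i. c *\<^sub>R f i)"
        using S.restr_scale[OF U(1) W(1,3) x(1)] f(2) by (simp add: comb_def scaleR_sum_right)
      show "val m (k - d i) W (c *\<^sub>R f i) = 0" if "i \<in> I" for i
        using val_scale[OF W(1,2) coefsD[OF f(1) that]] f that by simp
    qed
    then show "c *\<^sub>R x \<in> {x \<in> sect S U k. nul m k U x}" using S.scale_in[OF U(1) x(1)] by simp
  qed
qed

lemma nul_diff:
  assumes U: "openin X U" "m \<in> U" and x: "x \<in> sect S U k" "y \<in> sect S U k"
    and "nul m k U x" "nul m k U y"
  shows "nul m k U (x - y)"
  using subspace_diff[OF nul_subspace[OF U, of k], of x y] assms by simp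

text \<open>Each property is a closure property of null sections: 0 for reflexivity, 0 - (x - y) for
  symmetry, (x - y) + (y - z) for transitivity.\<close>

lemma equiv_fiber_rel: "equiv (vcarrier (stalk X S m k)) (fiber_rel X A S m k)"
proof (rule equivI)
  show "fiber_rel X A S m k \<subseteq> vcarrier (stalk X S m k) \<times> vcarrier (stalk X S m k)"
    by (auto simp: fiber_rel_def)
  show "refl_on (vcarrier (stalk X S m k)) (fiber_rel X A S m k)"
  proof (rule refl_onI)
    fix G assume G: "G \<in> vcarrier (stalk X S m k)"
    obtain U x y z where "openin X U" "m \<in> U" "x \<in> sect S U k" "y \<in> sect S U k" "z \<in> sect S U k"
      "G = germ X S m k U x" "G = germ X S m k U y" "G = germ X S m k U z"
      by (rule S.stalk_common[OF G G G])
    then show "(G, G) \<in> fiber_rel X A S m k" by (simp add: fiber_rel_germ nul_zero)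
  qed
  show "sym (fiber_rel X A S m k)"
  proof (rule symI)
    fix G H assume GH: "(G, H) \<in> fiber_rel X A S m k"
    then have c: "G \<in> vcarrier (stalk X S m k)" "H \<in> vcarrier (stalk X S m k)"
      by (auto simp: fiber_rel_def)
    obtain U x y z where U: "openin X U" "m \<in> U" and x: "x \<in> sect S U k" and y: "y \<in> sect S U k"
      and "z \<in> sect S U k"
      and G: "G = germ X S m k U x" "H = germ X S m k U y" and "H = germ X S m k U z"
      by (rule S.stalk_common[OF c c(2)])
    have "nul m k U (x - y)" using GH fiber_rel_germ[OF U x y] G by simp
    then have "nul m k U (0 - (x - y))"
      by (rule nul_diff[OF U S.zero_in[OF U(1)] S.diff_in[OF U(1) x y] nul_zero[OF U]])
    then show "(H, G) \<in> fiber_rel X A S m k" using fiber_rel_germ[OF U y x] G by simp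
  qed
  show "trans (fiber_rel X A S m k)"
  proof (rule transI)
    fix G H K assume GH: "(G, H) \<in> fiber_rel X A S m k" and HK: "(H, K) \<in> fiber_rel X A S m k"
    then have c: "G \<in> vcarrier (stalk X S m k)" "H \<in> vcarrier (stalk X S m k)" "K \<in> vcarrier (stalk X S m k)"
      by (auto simp: fiber_rel_def)
    obtain U x y z where U: "openin X U" "m \<in> U" and x: "x \<in> sect S U k" and y: "y \<in> sect S U k"
      and z: "z \<in> sect S U k"
      and G: "G = germ X S m k U x" "H = germ X S m k U y" "K = germ X S m k U z"
      by (rule S.stalk_common[OF c])
    have "nul m k U (x - y)" "nul m k U (y - z)"
      using GH HK fiber_rel_germ[OF U] x y z G by auto
    then have "nul m k U ((x - y) + (y - z))"
      using subspace_add[OF nul_subspace[OF U, of k], of "x - y" "y - z"] S.diff_in[OF U(1)] x y z by simp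
    then show "(G, K) \<in> fiber_rel X A S m k" using fiber_rel_germ[OF U x z] G by simp
  qed
qed

lemma fiber_carrier:
  "vcarrier (fiber X A S m k) = vcarrier (stalk X S m k) // fiber_rel X A S m k"
  and fiber_vzero: "vzero (fiber X A S m k) = fiber_rel X A S m k `` {vzero (stalk X S m k)}"
  by (simp_all add: fiber_def Let_def)

lemma fiber_class_null:
  assumes U: "openin X U" "m \<in> U" and x: "x \<in> sect S U k"
  shows "fiber_rel X A S m k `` {germ X S m k U x} = vzero (fiber X A S m k) \<longleftrightarrow> nul m k U x"
proof -
  note z = S.zero_in[OF U(1), of k]
  have "fiber_rel X A S m k `` {germ X S m k U x} = vzero (fiber X A S m k) \<longleftrightarrow>
      (germ X S m k U x, germ X S m k U 0) \<in> fiber_rel X A S m k"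
    unfolding fiber_vzero S.vzero_germ[OF U]
    by (rule eq_equiv_class_iff[OF equiv_fiber_rel S.germ_in_carrier[OF U x] S.germ_in_carrier[OF U z]])
  then show ?thesis using fiber_rel_germ[OF U x z] by simp
qed

end

section \<open>Extending independent sections to a frame\<close>

context module_sheaf
begin

text \<open>Real numbers enter as multiples of the unit, which have degree 0. The multiple by 0 lies
  in every degree, hence the conditional hypothesis.\<close>

lemma scaled_gone_in:
  assumes "openin X U" "c \<noteq> 0 \<Longrightarrow> k = 0"
  shows "c *\<^sub>R gone A U \<in> sect A U k"
  using assms A.scale_in[OF assms(1) gone_in[OF assms(1)], of c] A.zero_in[OF assms(1), of k]
  by (cases "c = 0") auto

lemma val_scaled_gone:
  assumes "openin X U" "m \<in> U" "c \<noteq> 0 \<Longrightarrow> k = 0"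
  shows "val m k U (c *\<^sub>R gone A U) = c"
  using assms val_scale[OF assms(1,2) gone_in[OF assms(1)], of c] val_gone[OF assms(1,2)]
    val_zero[OF assms(1,2)]
  by (cases "c = 0") auto

lemma act_scaled_gone:
  "openin X U \<Longrightarrow> s \<in> sect S U k \<Longrightarrow> act S U (c *\<^sub>R gone A U) s = c *\<^sub>R s"
  using act_scale_left[OF _ gone_in] act_gone by simp

text \<open>The real coefficients become constant functions \<open>c i *\<^sub>R gone A U\<close>.
  Their values at \<open>m\<close> are the numbers \<open>c i\<close>, which are thus the fiber
  coordinates of a null section.\<close>

lemma frame_independent:
  assumes fr: "frame X A S U I d s" and m: "m \<in> U" and c: "\<And>i. i \<in> I \<Longrightarrow> c i \<noteq> 0 \<Longrightarrow> d i = k"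
    and nul: "nul m k U (\<Sum>i\<in>I. c i *\<^sub>R s i)" and i: "i \<in> I"
  shows "c i = 0"
proof -
  note U = frameD(1)[OF fr] and s = frameD(5)[OF fr]
  have "coefs U I d k (\<lambda>i. c i *\<^sub>R gone A U)"
    unfolding coefs_def using c by (intro ballI scaled_gone_in[OF U]) auto
  moreover have "(\<Sum>i\<in>I. c i *\<^sub>R s i) = comb U I s (\<lambda>i. c i *\<^sub>R gone A U)"
    unfolding comb_def using act_scaled_gone[OF U s] by simp
  ultimately have "val m (k - d i) U (c i *\<^sub>R gone A U) = 0"
    using nul_iff[OF fr m] nul i by simp
  then show ?thesis using val_scaled_gone[OF U m, of "c i" "k - d i"] c[OF i] by simp
qed

text \<open>Each round occupies one more slot of \<open>I\<close>, recorded by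
  \<open>\<tau>\<close>. The degrees \<open>d\<close> of the slots stay fixed; only the sections and
  the neighborhood change. Independence is asked at the single point \<open>m\<close>, with real
  coefficients.\<close>

theorem extend_to_frame:
  fixes t :: "nat \<Rightarrow> 's"
  assumes fr: "frame X A S U I d s" and m: "m \<in> U" and fin: "finite T"
    and t: "\<And>j. j \<in> T \<Longrightarrow> t j \<in> sect S U (e j)"
    and indep: "\<And>k c j. (\<And>j. j \<in> T \<Longrightarrow> c j \<noteq> 0 \<Longrightarrow> e j = k) \<Longrightarrow>
      nul m k U (\<Sum>j\<in>T. c j *\<^sub>R t j) \<Longrightarrow> j \<in> T \<Longrightarrow> c j = 0"
  shows "\<exists>W \<tau> s'. m \<in> W \<and> W \<subseteq> U \<and> frame X A S W I d s' \<and> inj_on \<tau> T \<and> \<tau> ` T \<subseteq> I \<and>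
    (\<forall>j\<in>T. d (\<tau> j) = e j \<and> s' (\<tau> j) = restr S U W (t j))"
proof -
  note U = frameD(1)[OF fr]
  \<comment> \<open>The trivial premise brings the goal into the form of an induction over subsets,
    which keeps \<open>j \<in> T\<close>, and so the hypotheses on \<open>t j\<close>,
    available.\<close>
  have "T \<subseteq> T \<Longrightarrow> ?thesis"
    using fin
  proof (induction T rule: finite_subset_induct')
    case empty
    show ?case using fr m by (intro exI[of _ U] exI[of _ s]) auto
  next
    case (insert j T')
    obtain W \<tau> s' where IH: "m \<in> W \<and> W \<subseteq> U \<and> frame X A S W I d s' \<and> inj_on \<tau> T' \<and> \<tau> ` T' \<subseteq> I \<and>
      (\<forall>j\<in>T'. d (\<tau> j) = e j \<and> s' (\<tau> j) = restr S U W (t j))"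
      using insert.IH by (elim exE)
    then have W: "m \<in> W" "W \<subseteq> U" and fr': "frame X A S W I d s'"
      and \<tau>: "inj_on \<tau> T'" "\<tau> ` T' \<subseteq> I" and
      s': "\<And>l. l \<in> T' \<Longrightarrow> d (\<tau> l) = e l" "\<And>l. l \<in> T' \<Longrightarrow> s' (\<tau> l) = restr S U W (t l)"
      by simp_all
    note W = frameD(1)[OF fr'] W and s'_in = frameD(5)[OF fr']
    note tW = S.restr_in[OF U W(1,3) t]
    obtain f where f: "coefs W I d (e j) f" "restr S U W (t j) = comb W I s' f"
      using freely_generatesD(3)[OF frameD(1,2)[OF fr'] tW[OF \<open>j \<in> T\<close>]] by blast
    \<comment> \<open>The values of the coefficients of \<open>t j\<close> in the occupied slots,
      that is, the part of its fiber class in the span of the sections already placed.\<close>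
    define v where "v i = (if i \<in> \<tau> ` T' then val m (e j - d i) W (f i) else 0)" for i
    have v0: "d i = e j" if "v i \<noteq> 0" for i
      using that val_nonzero_degree[of "e j - d i" m W "f i"]
      by (cases "d i = e j") (auto simp: v_def split: if_splits)
    \<comment> \<open>If every free slot had value 0, then \<open>t j\<close> minus the combination
      of the placed sections with coefficients \<open>v\<close> would be null at \<open>m\<close>,
      although \<open>t j\<close> enters with coefficient 1.\<close>
    have "\<exists>i\<in>I - \<tau> ` T'. val m (e j - d i) W (f i) \<noteq> 0"
    proof (rule ccontr)
      assume neg: "\<not> ?thesis"
      define c where "c l = (if l = j then 1 else if l \<in> T' then - v (\<tau> l) else 0)" for l
      have ce: "e l = e j" if "c l \<noteq> 0" for l
        using that v0[of "\<tau> l"] s'(1)[of l] by (auto simp: c_def split: if_splits)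
      have ct: "c l *\<^sub>R t l \<in> sect S U (e j)" if l: "l \<in> T" for l
        using S.scale_in[OF U t[OF l], of "c l"] ce[of l] S.zero_in[OF U] by (cases "c l = 0") auto
      have sum_in: "(\<Sum>l\<in>T. c l *\<^sub>R t l) \<in> sect S U (e j)"
        by (rule S.sum_in[OF U]) (rule ct)
      let ?w = "\<lambda>i. v i *\<^sub>R gone A W"
      have w: "coefs W I d (e j) ?w"
        unfolding coefs_def using v0 by (intro ballI scaled_gone_in[OF W(1)]) auto
      have fw: "coefs W I d (e j) (\<lambda>i. f i - ?w i)" by (rule coefs_diff[OF W(1) f(1) w])
      have scale_restr: "restr S U W (c l *\<^sub>R t l) = c l *\<^sub>R restr S U W (t l)" if "l \<in> T" for l
        by (rule S.restr_scale[OF U W(1,3) t[OF that]])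
      have "restr S U W (\<Sum>l\<in>T. c l *\<^sub>R t l) = (\<Sum>l\<in>T. restr S U W (c l *\<^sub>R t l))"
        by (rule S.restr_sum[OF U W(1,3)]) (rule ct)
      also have "\<dots> = (\<Sum>l\<in>T. c l *\<^sub>R restr S U W (t l))"
        using scale_restr by simp
      also have "\<dots> = (\<Sum>l\<in>insert j T'. c l *\<^sub>R restr S U W (t l))"
        using insert.hyps fin by (intro sum.mono_neutral_right) (auto simp: c_def)
      also have "\<dots> = restr S U W (t j) - (\<Sum>l\<in>T'. v (\<tau> l) *\<^sub>R s' (\<tau> l))"
        using insert.hyps s'(2) by (simp add: c_def sum_negf[symmetric]) (auto intro!: sum.cong)
      also have "(\<Sum>l\<in>T'. v (\<tau> l) *\<^sub>R s' (\<tau> l)) = (\<Sum>i\<in>\<tau> ` T'. v i *\<^sub>R s' i)"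
        using \<tau>(1) by (simp add: sum.reindex)
      also have "\<dots> = (\<Sum>i\<in>I. v i *\<^sub>R s' i)"
        using \<tau>(2) frameD(4)[OF fr] by (intro sum.mono_neutral_left) (auto simp: v_def)
      also have "\<dots> = comb W I s' ?w"
        unfolding comb_def using act_scaled_gone[OF W(1) s'_in] by simp
      also have "restr S U W (t j) - comb W I s' ?w = comb W I s' (\<lambda>i. f i - ?w i)"
        using comb_diff[OF W(1) s'_in f(1) w] f(2) by simp
      finally have eq: "restr S U W (\<Sum>l\<in>T. c l *\<^sub>R t l) = comb W I s' (\<lambda>i. f i - ?w i)" .
      have "val m (e j - d i) W (f i - ?w i) = 0" if i: "i \<in> I" for i
      proof -
        have "val m (e j - d i) W (f i - ?w i) = val m (e j - d i) W (f i) - v i"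
          using val_diff[OF W(1,2) coefsD[OF f(1) i] coefsD[OF w i]]
            val_scaled_gone[OF W(1,2), of "v i" "e j - d i"] v0[of i] by simp
        then show ?thesis using neg i by (simp add: v_def)
      qed
      then have "nul m (e j) W (comb W I s' (\<lambda>i. f i - ?w i))"
        using nul_iff[OF fr' W(2) fw] by blast
      then have "nul m (e j) U (\<Sum>l\<in>T. c l *\<^sub>R t l)"
        using nul_restr[OF U W(2) sum_in W(1,3)] eq by simp
      then have "c j = 0" using indep[of c "e j"] ce \<open>j \<in> T\<close> by blast
      then show False by (simp add: c_def)
    qed
    then obtain i where i: "i \<in> I" "i \<notin> \<tau> ` T'" and nz: "val m (e j - d i) W (f i) \<noteq> 0" by blast
    \<comment> \<open>Only functions of degree 0 have nonzero values, so the free slot has exactly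
      the degree of the new section.\<close>
    have ij: "d i = e j" using nz val_nonzero_degree[of "e j - d i" m W "f i"] by (cases "d i = e j") auto
    have fi: "f i \<in> sect A W 0" "val m 0 W (f i) \<noteq> 0" using coefsD[OF f(1) i(1)] nz ij by auto
    obtain B g where B: "openin X B" "m \<in> B" "B \<subseteq> W" and g: "g \<in> sect A B 0"
      "gmult A B (restr A W B (f i)) g = gone A B"
      by (rule unit_near[OF W(1,2) fi])
    have BU: "B \<subseteq> U" using B W by blast
    let ?s = "\<lambda>i. restr S W B (s' i)"
    have tj: "restr S U B (t j) = comb B I ?s (\<lambda>i. restr A W B (f i))"
      using comb_restr[OF W(1) s'_in B(1,3) f(1)] f(2)
        S.restr_restr[OF U W(1) B(1) B(3) W(3) t[OF \<open>j \<in> T\<close>]] by simp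
    have "frame X A S B I d (?s(i := restr S U B (t j)))"
      unfolding tj using coefs_restr[OF W(1) B(1,3) f(1)] ij g
      by (intro frame_exchange[OF frame_restr[OF fr' B(1,3)] i(1), of _ g]) simp_all
    moreover have "inj_on (\<tau>(j := i)) (insert j T')" "(\<tau>(j := i)) ` insert j T' \<subseteq> I"
      using \<tau> i insert.hyps by (auto simp: inj_on_def)
    moreover have "\<forall>l\<in>insert j T'. d ((\<tau>(j := i)) l) = e l \<and>
      (?s(i := restr S U B (t j))) ((\<tau>(j := i)) l) = restr S U B (t l)"
    proof (rule ballI, goal_cases)
      case (1 l)
      note l = this
      show ?case
      proof (cases "l = j")
        case False
        then have l: "l \<in> T'" "l \<in> T" "\<tau> l \<noteq> i" using l i insert.hyps by auto
        then show ?thesis using False s'[OF l(1)] S.restr_restr[OF U W(1) B(1) B(3) W(3) t[OF l(2)]] by simp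
      qed (simp add: ij)
    qed
    ultimately show ?case using B(2) BU
      by (intro exI[of _ B] exI[of _ "\<tau>(j := i)"] exI[of _ "?s(i := restr S U B (t j))"] conjI)
  qed
  then show ?thesis by blast
qed

text \<open>The replacements can be made one after the other: each \<open>f i\<close> is 0 at the
  other indices of \<open>K\<close>, so elements already replaced do not enter, and the unit
  required by the exchange is the coefficient 1 at i.\<close>

lemma frame_replace:
  assumes fr: "frame X A S U I d s" and K: "K \<subseteq> I"
    and f: "\<And>i. i \<in> K \<Longrightarrow> coefs U I d (d i) (f i)" "\<And>i. i \<in> K \<Longrightarrow> f i i = gone A U"
      "\<And>i j. i \<in> K \<Longrightarrow> j \<in> K \<Longrightarrow> j \<noteq> i \<Longrightarrow> f i j = 0"
  shows "frame X A S U I d (\<lambda>i. if i \<in> K then comb U I s (f i) else s i)"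
proof -
  note U = frameD(1)[OF fr] and s = frameD(5)[OF fr]
  have "finite K" using K frameD(4)[OF fr] finite_subset by blast
  then have "K \<subseteq> K \<Longrightarrow> ?thesis"
  proof (induction K rule: finite_subset_induct')
    case empty
    then show ?case using fr by simp
  next
    case (insert i K')
    let ?s = "\<lambda>i. if i \<in> K' then comb U I s (f i) else s i"
    have i: "i \<in> I" "i \<in> K" using insert.hyps K by auto
    have "comb U I ?s (f i) = comb U I s (f i)"
      unfolding comb_def[of U I _ "f i"]
    proof (rule sum.cong[OF refl])
      fix j assume j: "j \<in> I"
      show "act S U (f i j) (?s j) = act S U (f i j) (s j)"
      proof (cases "j \<in> K'")
        case True
        then have "f i j = 0" "j \<in> K" using f(3)[OF i(2)] insert.hyps by auto
        then show ?thesis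
          using act_zero_left[OF U comb_in[OF U s f(1)]] act_zero_left[OF U s[OF j]] by simp
      qed simp
    qed
    moreover have "frame X A S U I d (?s(i := comb U I ?s (f i)))"
      using f(2)[OF i(2)] gone_left[OF U gone_in[OF U]] gone_in[OF U]
      by (intro frame_exchange[OF insert.IH i(1) f(1)[OF i(2)], of "gone A U"]) simp_all
    moreover have "?s(i := comb U I s (f i)) = (\<lambda>j. if j \<in> insert i K' then comb U I s (f j) else s j)"
      by auto
    ultimately show ?case by simp
  qed
  then show ?thesis by blast
qed

text \<open>Subbundles ask for frames indexed by \<open>{1..r}\<close>, while bundles and the
  exchange argument provide arbitrary finite index sets.\<close>

lemma freely_generates_reindex:
  assumes U: "openin X U" and gen: "freely_generates A S U I d s" and h: "bij_betw h J I"
  shows "freely_generates A S U J (d \<circ> h) (s \<circ> h)"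
proof (rule freely_generatesI[OF U])
  note fin = freely_generatesD(1)[OF U gen] and s = freely_generatesD(2)[OF U gen]
  show "finite J" using fin h bij_betw_finite by blast
  have hI: "h j \<in> I" if "j \<in> J" for j using h that by (rule bij_betw_apply)
  then show "(s \<circ> h) j \<in> sect S U ((d \<circ> h) j)" if "j \<in> J" for j
    using that s by simp
  have comb: "comb U J (s \<circ> h) (f \<circ> h) = comb U I s f" for f
    using sum.reindex_bij_betw[OF h, of "\<lambda>i. act S U (f i) (s i)"] by (simp add: comb_def)
  show "\<exists>f. coefs U J (d \<circ> h) k f \<and> t = comb U J (s \<circ> h) f" if t: "t \<in> sect S U k" for k t
  proof -
    obtain f where "coefs U I d k f" "t = comb U I s f" using freely_generatesD(3)[OF U gen t] by blast
    then show ?thesis using comb[of f] hI by (intro exI[of _ "f \<circ> h"]) (simp add: coefs_def)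
  qed
  fix k f j assume f: "coefs U J (d \<circ> h) k f" "comb U J (s \<circ> h) f = 0" and j: "j \<in> J"
  define g where "g = f \<circ> inv_into J h"
  have gh: "(g \<circ> h) j = f j" if "j \<in> J" for j
    using that bij_betw_inv_into_left[OF h] by (simp add: g_def)
  have "coefs U I d k g"
    unfolding coefs_def
  proof
    fix i assume "i \<in> I"
    then obtain j where "j \<in> J" "i = h j" using h by (metis bij_betw_imp_surj_on imageE)
    then show "g i \<in> sect A U (k - d i)" using gh[of j] coefsD[OF f(1)] by simp
  qed
  moreover have "comb U I s g = comb U J (s \<circ> h) f"
    unfolding comb[symmetric] by (intro comb_cong gh) simp_all
  ultimately have "g (h j) = 0"
    using freely_generatesD(4)[OF U gen] f(2) hI[OF j] by simp
  then show "f j = 0" using gh[OF j] by simp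
qed

lemma frame_reindex:
  assumes fr: "frame X A S U I d s" and h: "bij_betw h J I"
  shows "frame X A S U J (d \<circ> h) (s \<circ> h)"
proof (rule frameI[OF frameD(1)[OF fr]])
  show "(s \<circ> h) j \<in> sect S U ((d \<circ> h) j)" if "j \<in> J" for j
    using frameD(5)[OF fr bij_betw_apply[OF h that]] by simp
  show "freely_generates A S V J (d \<circ> h) (\<lambda>i. restr S U V ((s \<circ> h) i))" if "openin X V" "V \<subseteq> U" for V
    using freely_generates_reindex[OF that(1) frameD(3)[OF fr that] h] by (simp add: comp_def)
qed

text \<open>Coefficients on \<open>K\<close> extend by 0 to \<open>I\<close>, which leaves the
  combination unchanged.\<close>

lemma freely_generates_independent_subset:
  assumes U: "openin X U" and gen: "freely_generates A S U I d s" and K: "K \<subseteq> I"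
    and f: "coefs U K d k f" "comb U K s f = 0" and i: "i \<in> K"
  shows "f i = 0"
proof -
  let ?f = "\<lambda>i. if i \<in> K then f i else 0"
  have "coefs U I d k ?f" using f(1) A.zero_in[OF U] by (simp add: coefs_def)
  moreover have "comb U I s ?f = comb U K s f"
    unfolding comb_def using K freely_generatesD(1)[OF U gen] act_zero_left[OF U freely_generatesD(2)[OF U gen]]
    by (intro sum.mono_neutral_cong_right) auto
  ultimately show ?thesis using freely_generatesD(4)[OF U gen, of k ?f i] f(2) i K by auto
qed

end

section \<open>Subbundles\<close>

context module_sheaf
begin

text \<open>Glued sections exist and are unique in S already. What remains of the gluing axiom is
  that membership in \<open>L\<close> can be tested locally.\<close>

lemma submodule_sheafI:
  assumes sub: "\<And>U k. openin X U \<Longrightarrow> L U k \<subseteq> sect S U k"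
    and subspace: "\<And>U k. openin X U \<Longrightarrow> subspace (L U k)"
    and restr: "\<And>U V k s. openin X U \<Longrightarrow> openin X V \<Longrightarrow> V \<subseteq> U \<Longrightarrow> s \<in> L U k \<Longrightarrow> restr S U V s \<in> L V k"
    and act: "\<And>U i k a s. openin X U \<Longrightarrow> a \<in> sect A U i \<Longrightarrow> s \<in> L U k \<Longrightarrow> act S U a s \<in> L U (i + k)"
    and glue: "\<And>\<U> k s. (\<And>U. U \<in> \<U> \<Longrightarrow> openin X U) \<Longrightarrow> s \<in> sect S (\<Union>\<U>) k \<Longrightarrow>
      (\<And>U. U \<in> \<U> \<Longrightarrow> restr S (\<Union>\<U>) U s \<in> L U k) \<Longrightarrow> s \<in> L (\<Union>\<U>) k"
  shows "submodule_sheaf X A S L"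
proof -
  have mem: "s \<in> sect S U k" if "openin X U" "s \<in> L U k" for U k s
    using sub that by blast
  have lin: "linear_map_on (L U k) g" if "openin X U" "linear_map_on (sect S U k) g"
    for U k and g :: "'s \<Rightarrow> 's"
    using that mem[OF that(1)] unfolding linear_map_on_def by blast
  have graded: "graded_vector_space (L U)" if U: "openin X U" for U
  proof -
    have "graded_vector_space (sect S U)"
      using S.vsheaf[unfolded sheaf_of_graded_vector_spaces_def, THEN conjunct1] U by blast
    then have int: "sect S U i \<inter> sect S U j = {0}" if "i \<noteq> j" for i j
      using that by (simp add: graded_vector_space_def)
    have "L U i \<inter> L U j = {0}" if "i \<noteq> j" for i j
    proof -
      have "L U i \<inter> L U j \<subseteq> {0}"
        using Int_mono[OF sub[OF U, of i] sub[OF U, of j]] int[OF that] by simp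
      then show ?thesis using subspace_0[OF subspace[OF U]] by auto
    qed
    then show ?thesis using subspace[OF U] by (simp add: graded_vector_space_def)
  qed
  have gluing: "\<exists>!s. s \<in> L (\<Union>\<U>) k \<and> (\<forall>U\<in>\<U>. restr S (\<Union>\<U>) U s = \<sigma> U)"
    if \<U>: "\<forall>U\<in>\<U>. openin X U \<and> \<sigma> U \<in> L U k"
      "\<forall>U\<in>\<U>. \<forall>V\<in>\<U>. restr S U (U \<inter> V) (\<sigma> U) = restr S V (U \<inter> V) (\<sigma> V)" for \<U> k \<sigma>
  proof -
    have "\<exists>!s. s \<in> sect S (\<Union>\<U>) k \<and> (\<forall>U\<in>\<U>. restr S (\<Union>\<U>) U s = \<sigma> U)"
      using \<U> mem by (intro S.glue) auto
    then obtain s where s: "s \<in> sect S (\<Union>\<U>) k" "\<forall>U\<in>\<U>. restr S (\<Union>\<U>) U s = \<sigma> U"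
      and uniq: "\<And>t. t \<in> sect S (\<Union>\<U>) k \<Longrightarrow> (\<forall>U\<in>\<U>. restr S (\<Union>\<U>) U t = \<sigma> U) \<Longrightarrow> t = s"
      by blast
    have "s \<in> L (\<Union>\<U>) k" using \<U>(1) s by (intro glue) auto
    moreover have "openin X (\<Union>\<U>)" using \<U>(1) by blast
    ultimately show ?thesis using s(2) uniq mem by (intro ex1I[of _ s]) auto
  qed
  let ?L = "S\<lparr>sect := L\<rparr>"
  have sel: "sect ?L = L" "restr ?L = restr S" by simp_all
  have "sheaf_of_graded_vector_spaces X ?L"
    unfolding sheaf_of_graded_vector_spaces_def
  proof (intro conjI allI impI)
    show "graded_vector_space (sect ?L U)" if "openin X U" for U
      using graded[OF that] by simp
    show "restr ?L U V ` sect ?L U k \<subseteq> sect ?L V k"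
      and "linear_map_on (sect ?L U k) (restr ?L U V)"
      if "openin X U \<and> openin X V \<and> V \<subseteq> U" for U V k
      using that restr lin[OF _ S.restr_linear] by auto
    show "\<forall>s\<in>sect ?L U k. restr ?L U U s = s" if "openin X U" for U k
      using S.restr_id[OF that mem[OF that]] by simp
    show "\<forall>s\<in>sect ?L U k. restr ?L V W (restr ?L U V s) =
        restr ?L U W s"
      if "openin X U \<and> openin X V \<and> openin X W \<and> W \<subseteq> V \<and> V \<subseteq> U" for U V W k
      using that S.restr_restr[OF _ _ _ _ _ mem] by simp
    show "\<exists>!s. s \<in> sect ?L (\<Union>\<U>) k \<and> (\<forall>U\<in>\<U>. restr ?L (\<Union>\<U>) U s = \<sigma> U)"
      if "(\<forall>U\<in>\<U>. openin X U \<and> \<sigma> U \<in> sect ?L U k) \<and>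
       (\<forall>U\<in>\<U>. \<forall>V\<in>\<U>. restr ?L U (U \<inter> V) (\<sigma> U) =
          restr ?L V (U \<inter> V) (\<sigma> V))" for \<U> k \<sigma>
      using that unfolding sel by (elim conjE) (rule gluing)
  qed
  moreover have "graded_bilinear (sect A U) (L U) (L U) (act S U)" if U: "openin X U" for U
    unfolding graded_bilinear_def
  proof (intro allI conjI ballI)
    show "act S U a s \<in> L U (i + j)" if "a \<in> sect A U i" "s \<in> L U j" for i j a s
      using act[OF U that] .
    show "linear_map_on (sect A U i) (\<lambda>a. act S U a s)" if "s \<in> L U j" for i j s
      using act_linear_left[OF U mem[OF U that]] .
    show "linear_map_on (L U j) (act S U a)" if "a \<in> sect A U i" for i j a
      using lin[OF U act_linear_right[OF U that]] .
  qed
  ultimately have "sheaf_of_modules X A ?L"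
    unfolding sheaf_of_modules_def
    using act_gone[OF _ mem] act_gmult[OF _ _ _ mem] restr_act[OF _ _ _ _ mem] by simp
  then show ?thesis using sub by (simp add: submodule_sheaf_def)
qed

text \<open>The index sets \<open>I\<close> and \<open>K\<close> may vary with the point as long as
  their sizes do not: a bijection from \<open>{1..r}\<close> to \<open>I\<close> that takes
  \<open>{1..n}\<close> onto \<open>K\<close> makes both uniform.\<close>

lemma subbundleI:
  assumes L: "submodule_sheaf X A S L"
    and fr: "\<And>m. m \<in> topspace X \<Longrightarrow> \<exists>U I d s K. m \<in> U \<and> frame X A S U I d s \<and> K \<subseteq> I \<and>
      card I = r \<and> card K = n \<and> frame X A (S\<lparr>sect := L\<rparr>) U K d s"
  shows "subbundle X A S L"
proof -
  interpret L: module_sheaf X A "S\<lparr>sect := L\<rparr>"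
    using L by unfold_locales (simp add: submodule_sheaf_def)
  \<comment> \<open>The bound n \<le> r becomes available only at a point of the space. The
    intersection lies in \<open>{1..r}\<close> in any case, also if the space is empty.\<close>
  have "\<exists>U d s. m \<in> U \<and> frame X A S U {1..r} d s \<and> frame X A (S\<lparr>sect := L\<rparr>) U ({1..r} \<inter> {1..n}) d s"
    if m: "m \<in> topspace X" for m
  proof -
    obtain U I d s K where U: "m \<in> U" and fr: "frame X A S U I d s"
      and K: "K \<subseteq> I" "card I = r" "card K = n" and frL: "frame X A (S\<lparr>sect := L\<rparr>) U K d s"
      using fr[OF m] by blast
    note fin = frameD(4)[OF fr]
    have finK: "finite K" using fin K(1) finite_subset by blast
    have nr: "n \<le> r" using K fin card_mono by blast
    obtain h1 where h1: "bij_betw h1 {1..n} K"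
      using ex_bij_betw_nat_finite_1[OF finK] K(3) by blast
    have "card {Suc n..r} = card (I - K)" using K finK nr by (simp add: card_Diff_subset)
    then obtain h2 where h2: "bij_betw h2 {Suc n..r} (I - K)"
      using finite_same_card_bij fin by blast
    define h where "h i = (if i \<in> {1..n} then h1 i else h2 i)" for i
    have "bij_betw h ({1..n} \<union> {Suc n..r}) (K \<union> (I - K))"
      unfolding h_def by (intro bij_betw_disjoint_Un h1 h2) auto
    moreover have "{1..n} \<union> {Suc n..r} = {1..r}" "K \<union> (I - K) = I" using nr K by auto
    ultimately have h: "bij_betw h {1..r} I" by simp
    have "bij_betw h {1..n} K"
      using h1 by (rule bij_betw_cong[THEN iffD1, rotated]) (simp add: h_def)
    moreover have "{1..r} \<inter> {1..n} = {1..n}" using nr by auto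
    ultimately show ?thesis
      using U frame_reindex[OF fr h] L.frame_reindex[OF frL] by metis
  qed
  then show ?thesis
    unfolding subbundle_def using L by (intro conjI exI[of _ r] exI[of _ "{1..r} \<inter> {1..n}"]) auto
qed

end

section \<open>Morphisms of bundles\<close>

locale bundle_map = S: vbundle X A S + P: vbundle X A P
  for X :: "'m topology" and A :: "('m, 'a::real_vector) galgebra"
    and S :: "('m, 'a, 's::real_vector) gmodule" and P :: "('m, 'a, 'p::real_vector) gmodule" +
  fixes F :: "'m set \<Rightarrow> 's \<Rightarrow> 'p"
  assumes morphism: "bundle_morphism X A S P F"
begin

lemma F_in: "openin X U \<Longrightarrow> s \<in> sect S U k \<Longrightarrow> F U s \<in> sect P U k"
  using morphism unfolding bundle_morphism_def by (metis image_subset_iff)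

lemma F_linear: "openin X U \<Longrightarrow> linear_map_on (sect S U k) (F U)"
  using morphism unfolding bundle_morphism_def by metis

lemma F_act: "openin X U \<Longrightarrow> a \<in> sect A U i \<Longrightarrow> s \<in> sect S U k \<Longrightarrow>
    F U (act S U a s) = act P U a (F U s)"
  using morphism unfolding bundle_morphism_def by metis

lemma F_restr: "openin X U \<Longrightarrow> openin X V \<Longrightarrow> V \<subseteq> U \<Longrightarrow> s \<in> sect S U k \<Longrightarrow>
    F V (restr S U V s) = restr P U V (F U s)"
  using morphism[unfolded bundle_morphism_def, THEN conjunct2] by blast

lemma F_add: "openin X U \<Longrightarrow> s \<in> sect S U k \<Longrightarrow> t \<in> sect S U k \<Longrightarrow> F U (s + t) = F U s + F U t"
  using F_linear unfolding linear_map_on_def by blast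

lemma F_scale: "openin X U \<Longrightarrow> s \<in> sect S U k \<Longrightarrow> F U (c *\<^sub>R s) = c *\<^sub>R F U s"
  using F_linear unfolding linear_map_on_def by blast

lemma F_zero: "openin X U \<Longrightarrow> F U 0 = 0"
  using linear_map_on_zero[OF F_linear S.S.zero_in] .

lemma F_diff: "openin X U \<Longrightarrow> s \<in> sect S U k \<Longrightarrow> t \<in> sect S U k \<Longrightarrow> F U (s - t) = F U s - F U t"
  using linear_map_on_diff[OF F_linear S.S.subspace_sect] .

lemma F_sum: "openin X U \<Longrightarrow> (\<And>i. i \<in> I \<Longrightarrow> f i \<in> sect S U k) \<Longrightarrow>
    F U (\<Sum>i\<in>I. f i) = (\<Sum>i\<in>I. F U (f i))"
  using linear_map_on_sum[OF F_linear S.S.subspace_sect] .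

lemma F_comb:
  assumes U: "openin X U" and s: "\<And>i. i \<in> I \<Longrightarrow> s i \<in> sect S U (d i)" and f: "S.coefs U I d k f"
  shows "F U (S.comb U I s f) = P.comb U I (\<lambda>i. F U (s i)) f"
proof -
  have "F U (S.comb U I s f) = (\<Sum>i\<in>I. F U (act S U (f i) (s i)))"
    unfolding S.comb_def using s S.coefsD[OF f] by (intro F_sum[OF U] S.act_in[OF U]) auto
  also have "\<dots> = P.comb U I (\<lambda>i. F U (s i)) f"
    unfolding P.comb_def using F_act[OF U S.coefsD[OF f] s] by simp
  finally show ?thesis .
qed

lemma stalk_map_germ:
  assumes U: "openin X U" "m \<in> U" and s: "s \<in> sect S U k"
  shows "stalk_map X P F m k (germ X S m k U s) = germ X P m k U (F U s)"
  unfolding stalk_map_def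
proof (rule UN_pairs_constant[OF S.S.germ_self[OF U s]])
  fix V t assume g: "(V, t) \<in> germ X S m k U s"
  note V = S.S.germ_mem_eq[OF U s g]
  obtain B where B: "openin X B" "m \<in> B" "B \<subseteq> U \<inter> V" "restr S U B s = restr S V B t"
    using g S.S.germ_mem[OF U s] by blast
  have "B \<subseteq> U" "B \<subseteq> V" using B(3) by auto
  then have "restr P V B (F V t) = restr P U B (F U s)"
    using F_restr[OF V(1) B(1) _ V(3)] F_restr[OF U(1) B(1) _ s] B(4) by simp
  then show "germ X P m k V (F V t) = germ X P m k U (F U s)"
    using B(1-3) U V F_in s
    by (subst P.S.germ_eq_iff) (auto intro!: exI[of _ B])
qed

text \<open>This is what makes \<open>F\<close> act on fibers. By linearity \<open>F U x\<close> has
  near \<open>m\<close> the same coefficients as x, now with respect to the images of a frame, and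
  \<open>nul_comb\<close> applies to these.\<close>

lemma nul_F:
  assumes U: "openin X U" "m \<in> U" and x: "x \<in> sect S U k" "S.nul m k U x"
  shows "P.nul m k U (F U x)"
proof -
  obtain V I d s where V: "m \<in> V" and fr: "frame X A S V I d s"
    using S.frame_near[OF S.in_topspace[OF U]] by blast
  define W where "W = U \<inter> V"
  have W: "openin X W" "m \<in> W" "W \<subseteq> U" "W \<subseteq> V"
    using U V S.frameD(1)[OF fr] by (auto simp: W_def)
  note frW = S.frame_restr[OF fr W(1,4)]
  let ?s = "\<lambda>i. restr S V W (s i)"
  note s = S.frameD(5)[OF frW]
  obtain f where f: "S.coefs W I d k f" "restr S U W x = S.comb W I ?s f"
    using S.freely_generatesD(3)[OF S.frameD(1,2)[OF frW] S.S.restr_in[OF U(1) W(1,3) x(1)]] by blast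
  have v: "S.val m (k - d i) W (f i) = 0" if "i \<in> I" for i
    using S.nul_iff[OF frW W(2) f(1)] S.nul_restr[OF U(1) W(2) x(1) W(1,3)] x(2) f(2) that by auto
  have "P.nul m k W (P.comb W I (\<lambda>i. F W (?s i)) f)"
    using F_in[OF W(1) s] f(1) v
    by (intro P.nul_comb[OF W(1,2) S.frameD(4)[OF fr], where d = d]) auto
  moreover have "P.comb W I (\<lambda>i. F W (?s i)) f = restr P U W (F U x)"
    using F_comb[OF W(1) s f(1)] f(2) F_restr[OF U(1) W(1,3) x(1)] by simp
  ultimately show ?thesis
    using P.nul_restr[OF U(1) W(2) F_in[OF U(1) x(1)] W(1,3)] by simp
qed

text \<open>\<open>fiber_map\<close> is a union over all germs of a class, so each representative
  has to be controlled. The lemma serves the injective case as well as the counterexample.\<close>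

lemma fiber_map_zero:
  assumes C: "C \<in> vcarrier (fiber X A S m k)"
    and nul: "\<And>V y. openin X V \<Longrightarrow> m \<in> V \<Longrightarrow> y \<in> sect S V k \<Longrightarrow> germ X S m k V y \<in> C \<Longrightarrow>
      P.nul m k V (F V y)"
  shows "fiber_map X A P F m k C = vzero (fiber X A P m k)"
proof -
  have sub: "C \<subseteq> vcarrier (stalk X S m k)" and "C \<noteq> {}"
    using C in_quotient_imp_subset[OF S.equiv_fiber_rel] in_quotient_imp_non_empty[OF S.equiv_fiber_rel]
    unfolding S.fiber_carrier by blast+
  moreover have "fiber_rel X A P m k `` {stalk_map X P F m k G} = vzero (fiber X A P m k)"
    if G: "G \<in> C" for G
  proof -
    obtain V y where V: "openin X V" "m \<in> V" and y: "y \<in> sect S V k" "G = germ X S m k V y"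
      using sub G unfolding S.S.stalk_carrier by blast
    then show ?thesis
      using P.fiber_class_null[OF V F_in[OF V(1) y(1)]] nul[OF V y(1)] G stalk_map_germ[OF V y(1)] by simp
  qed
  ultimately show ?thesis unfolding fiber_map_def by auto
qed

text \<open>Triviality of the kernel of the fiber map, phrased for sections: the classes of x and of
  0 have the same image, so they coincide.\<close>

lemma fiber_injective_nul:
  assumes inj: "fiber_injective X A S P F m"
    and U: "openin X U" "m \<in> U" and x: "x \<in> sect S U k" and nul: "P.nul m k U (F U x)"
  shows "S.nul m k U x"
proof -
  have zero: "fiber_map X A P F m k (fiber_rel X A S m k `` {germ X S m k U y}) = vzero (fiber X A P m k)"
    and car: "fiber_rel X A S m k `` {germ X S m k U y} \<in> vcarrier (fiber X A S m k)"
    if y: "y \<in> sect S U k" "P.nul m k U (F U y)" for y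
  proof -
    show car: "fiber_rel X A S m k `` {germ X S m k U y} \<in> vcarrier (fiber X A S m k)"
      unfolding S.fiber_carrier by (rule quotientI[OF S.S.germ_in_carrier[OF U y(1)]])
    show "fiber_map X A P F m k (fiber_rel X A S m k `` {germ X S m k U y}) = vzero (fiber X A P m k)"
    proof (rule fiber_map_zero[OF car])
      fix V z assume V: "openin X V" "m \<in> V" and z: "z \<in> sect S V k"
        and g: "germ X S m k V z \<in> fiber_rel X A S m k `` {germ X S m k U y}"
      define W where "W = U \<inter> V"
      have W: "openin X W" "m \<in> W" "W \<subseteq> U" "W \<subseteq> V" using U V by (auto simp: W_def)
      note yW = S.S.restr_in[OF U(1) W(1,3) y(1)] and zW = S.S.restr_in[OF V(1) W(1,4) z]
      have "(germ X S m k W (restr S U W y), germ X S m k W (restr S V W z)) \<in> fiber_rel X A S m k"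
        using g S.S.germ_restr[OF U(1) W(2) y(1) W(1,3)] S.S.germ_restr[OF V(1) W(2) z W(1,4)] by simp
      \<comment> \<open>Another representative z differs from y by a null section over
        \<open>W\<close>, and F z = F y - F (y - z) is a difference of null sections.\<close>
      then have "S.nul m k W (restr S U W y - restr S V W z)"
        using S.fiber_rel_germ[OF W(1,2) yW zW] by simp
      then have "P.nul m k W (F W (restr S U W y - restr S V W z))"
        by (rule nul_F[OF W(1,2) S.S.diff_in[OF W(1) yW zW]])
      moreover have "P.nul m k W (F W (restr S U W y))"
        using P.nul_restr[OF U(1) W(2) F_in[OF U(1) y(1)] W(1,3)] y(2) F_restr[OF U(1) W(1,3) y(1)] by simp
      ultimately have "P.nul m k W (F W (restr S U W y) - F W (restr S U W y - restr S V W z))"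
        using W yW zW by (intro P.nul_diff F_in S.S.diff_in)
      then have "P.nul m k W (F W (restr S V W z))" using F_diff[OF W(1) yW zW] by simp
      then show "P.nul m k V (F V z)"
        using P.nul_restr[OF V(1) W(2) F_in[OF V(1) z] W(1,4)] F_restr[OF V(1) W(1,4) z] by simp
    qed
  qed
  have z: "(0::'s) \<in> sect S U k" "P.nul m k U (F U 0)"
    using S.S.zero_in[OF U(1)] P.nul_zero[OF U] F_zero[OF U(1)] by auto
  have "fiber_rel X A S m k `` {germ X S m k U x} = fiber_rel X A S m k `` {germ X S m k U 0}"
    using inj zero[OF x nul] zero[OF z] car[OF x nul] car[OF z]
    unfolding fiber_injective_def inj_on_def by metis
  then show ?thesis
    using S.fiber_class_null[OF U x] S.fiber_class_null[OF U z(1)] S.nul_zero[OF U, of k] by simp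
qed

end

section \<open>Images and kernels\<close>

context bundle_map
begin

lemma image_frame_near:
  assumes inj: "fiber_injective X A S P F m"
    and frS: "frame X A S U I d s" "m \<in> U" and frP: "frame X A P V J e p" "m \<in> V"
  obtains W \<sigma> \<pi> \<tau> where "m \<in> W" "W \<subseteq> U" "frame X A S W I d \<sigma>" "frame X A P W J e \<pi>"
    "inj_on \<tau> I" "\<tau> ` I \<subseteq> J" "\<forall>i\<in>I. e (\<tau> i) = d i" "\<forall>i\<in>I. \<pi> (\<tau> i) = F W (\<sigma> i)"
proof -
  define W where "W = U \<inter> V"
  have W: "openin X W" "m \<in> W" "W \<subseteq> U" "W \<subseteq> V"
    using frS frP S.frameD(1) P.frameD(1) by (auto simp: W_def)
  let ?s = "\<lambda>i. restr S U W (s i)"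
  note frS' = S.frame_restr[OF frS(1) W(1,3)] and frP' = P.frame_restr[OF frP(1) W(1,4)]
  note s = S.frameD(5)[OF frS']
  \<comment> \<open>A real combination of the images is the image of the same combination of the
    frame elements. Injectivity on the fiber moves nullity back to S, where the frame is
    independent.\<close>
  have indep: "c i = 0" if c: "\<And>i. i \<in> I \<Longrightarrow> c i \<noteq> 0 \<Longrightarrow> d i = k"
    and nul: "P.nul m k W (\<Sum>i\<in>I. c i *\<^sub>R F W (?s i))" and i: "i \<in> I" for k c i
  proof -
    have cs: "c i *\<^sub>R ?s i \<in> sect S W k" if "i \<in> I" for i
      using S.S.scale_in[OF W(1) s[OF that], of "c i"] c[OF that] S.S.zero_in[OF W(1), of k]
      by (cases "c i = 0") auto
    have "F W (\<Sum>i\<in>I. c i *\<^sub>R ?s i) = (\<Sum>i\<in>I. c i *\<^sub>R F W (?s i))"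
      using F_sum[OF W(1), of I "\<lambda>i. c i *\<^sub>R ?s i" k] cs F_scale[OF W(1) s] by simp
    moreover have "(\<Sum>i\<in>I. c i *\<^sub>R ?s i) \<in> sect S W k"
      by (rule S.S.sum_in[OF W(1)]) (rule cs)
    ultimately have "S.nul m k W (\<Sum>i\<in>I. c i *\<^sub>R ?s i)"
      using fiber_injective_nul[OF inj W(1,2)] nul by simp
    then show ?thesis
      using S.frame_independent[OF frS' W(2) c] i by blast
  qed
  have "\<exists>B \<tau> \<pi>. m \<in> B \<and> B \<subseteq> W \<and> frame X A P B J e \<pi> \<and> inj_on \<tau> I \<and> \<tau> ` I \<subseteq> J \<and>
      (\<forall>i\<in>I. e (\<tau> i) = d i \<and> \<pi> (\<tau> i) = restr P W B (F W (?s i)))"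
    using F_in[OF W(1) s] indep
    by (intro P.extend_to_frame[OF frP' W(2) S.frameD(4)[OF frS']]) blast+
  then obtain B \<tau> \<pi> where B: "m \<in> B" "B \<subseteq> W" and fr: "frame X A P B J e \<pi>" and
    \<tau>: "inj_on \<tau> I" "\<tau> ` I \<subseteq> J" and
    \<pi>: "\<forall>i\<in>I. e (\<tau> i) = d i \<and> \<pi> (\<tau> i) = restr P W B (F W (?s i))"
    by (elim exE conjE)
  note oB = P.frameD(1)[OF fr]
  show thesis
  proof (rule that[OF B(1) _ S.frame_restr[OF frS' oB B(2)] fr \<tau>])
    show "B \<subseteq> U" using B W by blast
    show "\<forall>i\<in>I. e (\<tau> i) = d i" using \<pi> by blast
    show "\<forall>i\<in>I. \<pi> (\<tau> i) = F B (restr S W B (?s i))"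
      using \<pi> F_restr[OF W(1) oB B(2) s] by simp
  qed
qed

lemma kernel_frame_near:
  assumes surj: "surjective_morphism X S P F"
    and frS: "frame X A S U I d s" "m \<in> U" and frP: "frame X A P V J e p" "m \<in> V"
  obtains W \<sigma> \<pi> \<tau> where "m \<in> W" "frame X A S W I d \<sigma>" "frame X A P W J e \<pi>"
    "inj_on \<tau> J" "\<tau> ` J \<subseteq> I" "\<forall>j\<in>J. d (\<tau> j) = e j" "\<forall>j\<in>J. F W (\<sigma> (\<tau> j)) = \<pi> j"
    "\<forall>i\<in>I - \<tau> ` J. F W (\<sigma> i) = 0"
proof -
  define W where "W = U \<inter> V"
  have W: "openin X W" "m \<in> W" "W \<subseteq> U" "W \<subseteq> V"
    using frS frP S.frameD(1) P.frameD(1) by (auto simp: W_def)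
  let ?p = "\<lambda>j. restr P V W (p j)"
  note frS' = S.frame_restr[OF frS(1) W(1,3)] and frP' = P.frame_restr[OF frP(1) W(1,4)]
  note p = P.frameD(5)[OF frP']
  \<comment> \<open>Surjectivity is used over \<open>W\<close> itself, to lift the frame elements of
    P restricted to \<open>W\<close>.\<close>
  have "\<forall>j\<in>J. \<exists>x. x \<in> sect S W (e j) \<and> F W x = ?p j"
    using surj W(1) p unfolding surjective_morphism_def by (metis imageE)
  then obtain t where t: "\<And>j. j \<in> J \<Longrightarrow> t j \<in> sect S W (e j)" "\<And>j. j \<in> J \<Longrightarrow> F W (t j) = ?p j"
    by metis
  \<comment> \<open>\<open>F\<close> preserves nullity, so it turns a null combination of the lifts
    into a null combination of the frame of P.\<close>
  have indep: "c i = 0" if c: "\<And>i. i \<in> J \<Longrightarrow> c i \<noteq> 0 \<Longrightarrow> e i = k"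
    and nul: "S.nul m k W (\<Sum>i\<in>J. c i *\<^sub>R t i)" and i: "i \<in> J" for k c i
  proof -
    have ct: "c i *\<^sub>R t i \<in> sect S W k" if "i \<in> J" for i
      using S.S.scale_in[OF W(1) t(1)[OF that], of "c i"] c[OF that] S.S.zero_in[OF W(1), of k]
      by (cases "c i = 0") auto
    have "F W (\<Sum>i\<in>J. c i *\<^sub>R t i) = (\<Sum>i\<in>J. c i *\<^sub>R ?p i)"
      using F_sum[OF W(1), of J "\<lambda>i. c i *\<^sub>R t i" k] ct F_scale[OF W(1) t(1)] t(2) by simp
    moreover have "(\<Sum>i\<in>J. c i *\<^sub>R t i) \<in> sect S W k"
      by (rule S.S.sum_in[OF W(1)]) (rule ct)
    ultimately have "P.nul m k W (\<Sum>i\<in>J. c i *\<^sub>R ?p i)"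
      using nul_F[OF W(1,2) _ nul] by simp
    then show ?thesis
      using P.frame_independent[OF frP' W(2) c] i by blast
  qed
  have "\<exists>B \<tau> \<sigma>. m \<in> B \<and> B \<subseteq> W \<and> frame X A S B I d \<sigma> \<and> inj_on \<tau> J \<and> \<tau> ` J \<subseteq> I \<and>
      (\<forall>j\<in>J. d (\<tau> j) = e j \<and> \<sigma> (\<tau> j) = restr S W B (t j))"
    using t(1) indep
    by (intro S.extend_to_frame[OF frS' W(2) P.frameD(4)[OF frP']]) blast+
  then obtain B \<tau> \<sigma> where B: "m \<in> B" "B \<subseteq> W" and fr: "frame X A S B I d \<sigma>" and
    \<tau>: "inj_on \<tau> J" "\<tau> ` J \<subseteq> I" and
    \<sigma>: "\<forall>j\<in>J. d (\<tau> j) = e j \<and> \<sigma> (\<tau> j) = restr S W B (t j)"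
    by (elim exE conjE)
  note oB = S.frameD(1)[OF fr] and \<sigma>_in = S.frameD(5)[OF fr]
  note frP'' = P.frame_restr[OF frP' oB B(2)]
  let ?\<pi> = "\<lambda>j. restr P W B (?p j)"
  note \<pi>_in = P.frameD(5)[OF frP'']
  have F\<sigma>: "F B (\<sigma> (\<tau> j)) = ?\<pi> j" if "j \<in> J" for j
    using \<sigma> that t F_restr[OF W(1) oB B(2) t(1)[OF that]] by simp
  define K where "K = I - \<tau> ` J"
  have "\<forall>i\<in>K. \<exists>b. S.coefs B J e (d i) b \<and> F B (\<sigma> i) = P.comb B J ?\<pi> b"
    using P.freely_generatesD(3)[OF P.frameD(1,2)[OF frP'']] F_in[OF oB \<sigma>_in] unfolding K_def by blast
  then obtain b where b: "\<And>i. i \<in> K \<Longrightarrow> S.coefs B J e (d i) (b i)"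
    "\<And>i. i \<in> K \<Longrightarrow> F B (\<sigma> i) = P.comb B J ?\<pi> (b i)"
    by metis
  \<comment> \<open>The coefficients of the corrected element: 1 at i, and in the slots of the lifts
    the negated coefficients of \<open>F B (\<sigma> i)\<close> in the frame of P. At the remaining
    indices they are 0, as \<open>frame_replace\<close> demands.\<close>
  define f where "f i l = (if l = i then gone A B
    else if l \<in> \<tau> ` J then - b i (inv_into J \<tau> l) else 0)" for i l
  have f_in: "S.coefs B I d (d i) (f i)" if i: "i \<in> K" for i
    unfolding S.coefs_def
  proof
    fix l assume "l \<in> I"
    have "- b i j \<in> sect A B (d i - e j)" if "j \<in> J" for j
      using S.A.scale_in[OF oB S.coefsD[OF b(1)[OF i] that], of "-1"] by simp
    then have "- b i (inv_into J \<tau> l) \<in> sect A B (d i - d l)" if "l \<in> \<tau> ` J"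
      using that \<sigma> \<tau>(1) by auto
    then show "f i l \<in> sect A B (d i - d l)"
      using S.gone_in[OF oB] S.A.zero_in[OF oB] by (auto simp: f_def)
  qed
  let ?\<sigma> = "\<lambda>i. if i \<in> K then S.comb B I \<sigma> (f i) else \<sigma> i"
  have fr': "frame X A S B I d ?\<sigma>"
    by (rule S.frame_replace[OF fr]) (auto simp: K_def f_def f_in[unfolded K_def])
  \<comment> \<open>The index set splits into i, the slots of the lifts and a rest with coefficient
    0. The slots of the lifts contribute exactly the negative of
    \<open>F B (\<sigma> i)\<close>.\<close>
  have "F B (?\<sigma> i) = 0" if i: "i \<in> K" for i
  proof -
    have zero: "act P B 0 (F B (\<sigma> l)) = 0" if "l \<in> I" for l
      by (rule P.act_zero_left[OF oB F_in[OF oB \<sigma>_in[OF that]]])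
    have minus: "act P B (- b i j) (?\<pi> j) = - act P B (b i j) (?\<pi> j)" if "j \<in> J" for j
      using P.act_scale_left[OF oB S.coefsD[OF b(1)[OF i] that] \<pi>_in[OF that], of "-1"] by simp
    have iI: "i \<in> I" "i \<notin> \<tau> ` J" using i by (auto simp: K_def)
    have fin: "finite I" by (rule S.frameD(4)[OF fr])
    have "F B (S.comb B I \<sigma> (f i)) = (\<Sum>l\<in>I. act P B (f i l) (F B (\<sigma> l)))"
      using F_comb[OF oB \<sigma>_in f_in[OF i]] by (simp add: P.comb_def)
    also have "\<dots> = act P B (f i i) (F B (\<sigma> i)) + (\<Sum>l\<in>I - {i}. act P B (f i l) (F B (\<sigma> l)))"
      using fin iI by (simp add: sum.remove)
    also have "act P B (f i i) (F B (\<sigma> i)) = F B (\<sigma> i)"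
      using P.act_gone[OF oB F_in[OF oB \<sigma>_in[OF iI(1)]]] by (simp add: f_def)
    also have "(\<Sum>l\<in>I - {i}. act P B (f i l) (F B (\<sigma> l))) = (\<Sum>l\<in>\<tau> ` J. act P B (f i l) (F B (\<sigma> l)))"
      using fin iI \<tau>(2) zero by (intro sum.mono_neutral_right) (auto simp: f_def)
    also have "\<dots> = (\<Sum>j\<in>J. act P B (f i (\<tau> j)) (?\<pi> j))"
      using F\<sigma> by (simp add: sum.reindex[OF \<tau>(1)])
    also have "\<dots> = (\<Sum>j\<in>J. - act P B (b i j) (?\<pi> j))"
    proof (rule sum.cong[OF refl])
      fix j assume j: "j \<in> J"
      then have "f i (\<tau> j) = - b i j" using iI \<tau>(1) by (auto simp: f_def)
      then show "act P B (f i (\<tau> j)) (?\<pi> j) = - act P B (b i j) (?\<pi> j)" using minus[OF j] by simp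
    qed
    also have "\<dots> = - F B (\<sigma> i)"
      using b(2)[OF i] by (simp add: P.comb_def sum_negf)
    finally show ?thesis using i by simp
  qed
  moreover have "?\<sigma> (\<tau> j) = \<sigma> (\<tau> j)" if "j \<in> J" for j
    using that by (simp add: K_def)
  ultimately show thesis
    using \<sigma> F\<sigma> by (intro that[OF B(1) fr' frP'' \<tau>]) (simp_all add: K_def)
qed

text \<open>Generation comes from the frame of S, by transporting the coefficients of a preimage
  along the inverse of \<open>\<tau>\<close>; independence holds because the generators are part of
  a free family of P.\<close>

lemma image_freely_generates:
  assumes L: "submodule_sheaf X A P L" and LF: "\<And>k. L U k = F U ` sect S U k"
    and U: "openin X U" and S: "freely_generates A S U I d \<sigma>" and P: "freely_generates A P U J e \<pi>"
    and \<tau>: "inj_on \<tau> I" "\<tau> ` I \<subseteq> J" "\<And>i. i \<in> I \<Longrightarrow> e (\<tau> i) = d i" "\<And>i. i \<in> I \<Longrightarrow> \<pi> (\<tau> i) = F U (\<sigma> i)"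
  shows "freely_generates A (P\<lparr>sect := L\<rparr>) U (\<tau> ` I) e \<pi>"
proof -
  interpret L: module_sheaf X A "P\<lparr>sect := L\<rparr>"
    using L by unfold_locales (simp add: submodule_sheaf_def)
  have comb: "L.comb = P.comb" by (simp add: fun_eq_iff L.comb_def P.comb_def)
  note \<sigma> = S.freely_generatesD(2)[OF U S]
  show ?thesis
  proof (rule L.freely_generatesI[OF U])
    show "finite (\<tau> ` I)" using S.freely_generatesD(1)[OF U S] by blast
    show "\<pi> j \<in> sect (P\<lparr>sect := L\<rparr>) U (e j)" if "j \<in> \<tau> ` I" for j
      using that \<tau>(3,4) \<sigma> LF by auto
    show "f i = 0" if "L.coefs U (\<tau> ` I) e k f" "L.comb U (\<tau> ` I) \<pi> f = 0" "i \<in> \<tau> ` I" for k f i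
      using P.freely_generates_independent_subset[OF U P \<tau>(2) that(1)] that(2,3) comb by simp
    fix k y assume "y \<in> sect (P\<lparr>sect := L\<rparr>) U k"
    then obtain x where x: "x \<in> sect S U k" "y = F U x" using LF by auto
    obtain f where f: "S.coefs U I d k f" "x = S.comb U I \<sigma> f"
      using S.freely_generatesD(3)[OF U S x(1)] by blast
    let ?f = "\<lambda>j. f (inv_into I \<tau> j)"
    have "L.coefs U (\<tau> ` I) e k ?f"
      using f(1) \<tau>(1,3) by (auto simp: L.coefs_def)
    moreover have "y = L.comb U (\<tau> ` I) \<pi> ?f"
      using x(2) f(2) F_comb[OF U \<sigma> f(1)] \<tau>(1,4) by (simp add: comb P.comb_def sum.reindex)
    ultimately show "\<exists>f. L.coefs U (\<tau> ` I) e k f \<and> y = L.comb U (\<tau> ` I) \<pi> f" by blast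
  qed
qed

text \<open>Applying \<open>F\<close> to a combination leaves only the terms in the slots
  \<open>\<tau> j\<close>, where it yields the frame elements \<open>\<pi> j\<close>. For a section
  of the kernel their independence kills these coefficients.\<close>

lemma kernel_freely_generates:
  assumes L: "submodule_sheaf X A S L" and LF: "\<And>k. L U k = {x \<in> sect S U k. F U x = 0}"
    and U: "openin X U" and S: "freely_generates A S U I d \<sigma>" and P: "freely_generates A P U J e \<pi>"
    and \<tau>: "inj_on \<tau> J" "\<tau> ` J \<subseteq> I" "\<And>j. j \<in> J \<Longrightarrow> d (\<tau> j) = e j" "\<And>j. j \<in> J \<Longrightarrow> F U (\<sigma> (\<tau> j)) = \<pi> j"
    and zero: "\<And>i. i \<in> I - \<tau> ` J \<Longrightarrow> F U (\<sigma> i) = 0"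
  shows "freely_generates A (S\<lparr>sect := L\<rparr>) U (I - \<tau> ` J) d \<sigma>"
proof -
  interpret L: module_sheaf X A "S\<lparr>sect := L\<rparr>"
    using L by unfold_locales (simp add: submodule_sheaf_def)
  have comb: "L.comb = S.comb" by (simp add: fun_eq_iff L.comb_def S.comb_def)
  note \<sigma> = S.freely_generatesD(2)[OF U S] and fin = S.freely_generatesD(1)[OF U S]
  show ?thesis
  proof (rule L.freely_generatesI[OF U])
    show "finite (I - \<tau> ` J)" using fin by blast
    show "\<sigma> i \<in> sect (S\<lparr>sect := L\<rparr>) U (d i)" if "i \<in> I - \<tau> ` J" for i
      using that \<sigma> zero LF by auto
    show "f i = 0" if "L.coefs U (I - \<tau> ` J) d k f" "L.comb U (I - \<tau> ` J) \<sigma> f = 0" "i \<in> I - \<tau> ` J" for k f i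
      using S.freely_generates_independent_subset[OF U S Diff_subset that(1)] that(2,3) comb by simp
    fix k x assume "x \<in> sect (S\<lparr>sect := L\<rparr>) U k"
    then have x: "x \<in> sect S U k" "F U x = 0" using LF by auto
    obtain f where f: "S.coefs U I d k f" "x = S.comb U I \<sigma> f"
      using S.freely_generatesD(3)[OF U S x(1)] by blast
    have aF: "act P U (f i) 0 = 0" if "i \<in> I" for i
      by (rule linear_map_on_zero[OF P.act_linear_right[OF U S.coefsD[OF f(1) that]] P.S.zero_in[OF U]])
    have "0 = (\<Sum>i\<in>I. act P U (f i) (F U (\<sigma> i)))"
      using F_comb[OF U \<sigma> f(1)] x f(2) by (simp add: P.comb_def)
    also have "\<dots> = (\<Sum>i\<in>\<tau> ` J. act P U (f i) (F U (\<sigma> i)))"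
      using fin \<tau>(2) zero aF by (intro sum.mono_neutral_right) auto
    also have "\<dots> = P.comb U J \<pi> (\<lambda>j. f (\<tau> j))"
      using \<tau>(4) by (simp add: P.comb_def sum.reindex[OF \<tau>(1)])
    finally have z: "P.comb U J \<pi> (\<lambda>j. f (\<tau> j)) = 0" by simp
    have "P.coefs U J e k (\<lambda>j. f (\<tau> j))"
      unfolding P.coefs_def
    proof
      fix j assume j: "j \<in> J"
      then show "f (\<tau> j) \<in> sect A U (k - e j)" using S.coefsD[OF f(1), of "\<tau> j"] \<tau>(2,3) by force
    qed
    then have f0: "f (\<tau> j) = 0" if "j \<in> J" for j
      using P.freely_generatesD(4)[OF U P _ z that] by simp
    have "x = S.comb U (I - \<tau> ` J) \<sigma> f"
      unfolding f(2) S.comb_def using fin f0 \<tau>(2) S.act_zero_left[OF U \<sigma>]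
      by (intro sum.mono_neutral_right) auto
    moreover have "L.coefs U (I - \<tau> ` J) d k f" using f(1) by (simp add: L.coefs_def)
    ultimately show "\<exists>f. L.coefs U (I - \<tau> ` J) d k f \<and> x = L.comb U (I - \<tau> ` J) \<sigma> f"
      unfolding comb by blast
  qed
qed


text \<open>Locally the images of a frame of S are part of a frame of P, so F x = 0 forces the
  coefficients of x to vanish. Separatedness passes from local to global vanishing.\<close>

lemma injective_sections:
  assumes inj: "\<And>m. m \<in> topspace X \<Longrightarrow> fiber_injective X A S P F m"
    and U: "openin X U" and x: "x \<in> sect S U k" and Fx: "F U x = 0"
  shows "x = 0"
proof (rule S.S.separated[OF U x S.S.zero_in[OF U]])
  fix m assume m: "m \<in> U"
  note mX = S.in_topspace[OF U m]
  obtain V I d s where V: "m \<in> V" "frame X A S V I d s" by (rule S.frame_near[OF mX])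
  obtain V' J e p where V': "m \<in> V'" "frame X A P V' J e p" by (rule P.frame_near[OF mX])
  define B where "B = U \<inter> V"
  have B: "openin X B" "m \<in> B" "B \<subseteq> U" "B \<subseteq> V"
    using U m V S.frameD(1) by (auto simp: B_def)
  obtain W \<sigma> \<pi> \<tau> where W: "m \<in> W" "W \<subseteq> B" and frS: "frame X A S W I d \<sigma>" and frP: "frame X A P W J e \<pi>"
    and *: "inj_on \<tau> I" "\<tau> ` I \<subseteq> J" "\<forall>i\<in>I. e (\<tau> i) = d i" "\<forall>i\<in>I. \<pi> (\<tau> i) = F W (\<sigma> i)"
    by (rule image_frame_near[OF inj[OF mX] S.frame_restr[OF V(2) B(1,4)] B(2) V'(2,1)])
  note \<tau> = *(1,2) *(3,4)[rule_format]
  note oW = S.frameD(1)[OF frS]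
  have WU: "W \<subseteq> U" using W B by blast
  obtain f where f: "S.coefs W I d k f" "restr S U W x = S.comb W I \<sigma> f"
    using S.freely_generatesD(3)[OF S.frameD(1,2)[OF frS] S.S.restr_in[OF U oW WU x]] by blast
  let ?f = "\<lambda>j. f (inv_into I \<tau> j)"
  have "P.coefs W (\<tau> ` I) e k ?f"
    using f(1) \<tau>(1,3) by (auto simp: P.coefs_def)
  moreover have "P.comb W (\<tau> ` I) \<pi> ?f = 0"
    using F_comb[OF oW S.frameD(5)[OF frS] f(1)] f(2) F_restr[OF U oW WU x] Fx \<tau>(1,4) P.S.restr_zero[OF U oW WU]
    by (simp add: P.comb_def sum.reindex)
  ultimately have "?f j = 0" if "j \<in> \<tau> ` I" for j
    using P.freely_generates_independent_subset[OF oW P.frameD(2)[OF frP] \<tau>(2)] that by blast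
  then have "f i = 0" if "i \<in> I" for i using that \<tau>(1) by force
  then have "restr S U W x = 0"
    unfolding f(2) using S.comb_cong[of I f "\<lambda>i. 0" \<sigma> \<sigma> W] S.comb_zero[OF oW, of I \<sigma> d] S.frameD(5)[OF frS]
    by simp
  then show "\<exists>W. openin X W \<and> m \<in> W \<and> W \<subseteq> U \<and> restr S U W x = restr S U W 0"
    using oW W(1) WU S.S.restr_zero[OF U oW WU] by auto
qed

section \<open>Sheaf axioms for image and kernel, and the subbundle theorems\<close>

lemma image_subspace:
  assumes U: "openin X U"
  shows "subspace (image_sheaf S F U k)"
  unfolding image_sheaf_def
proof (rule subspaceI)
  show "0 \<in> F U ` sect S U k"
    by (rule image_eqI[of _ _ 0]) (simp_all add: F_zero[OF U] S.S.zero_in[OF U])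
  fix x y assume "x \<in> F U ` sect S U k" "y \<in> F U ` sect S U k"
  then obtain x' y' where "x = F U x'" "x' \<in> sect S U k" "y = F U y'" "y' \<in> sect S U k"
    by (elim imageE)
  then show "x + y \<in> F U ` sect S U k"
    by (intro image_eqI[of _ _ "x' + y'"]) (simp_all add: F_add[OF U] S.S.add_in[OF U])
next
  fix c x assume "x \<in> F U ` sect S U k"
  then obtain x' where "x = F U x'" "x' \<in> sect S U k"
    by (elim imageE)
  then show "c *\<^sub>R x \<in> F U ` sect S U k"
    by (intro image_eqI[of _ _ "c *\<^sub>R x'"]) (simp_all add: F_scale[OF U] S.S.scale_in[OF U])
qed

text \<open>Gluing is the one axiom that may fail for an image, so it is left as a hypothesis.
  Injectivity on sections supplies it in one application, the topology of a point in the
  other.\<close>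

lemma image_submoduleI:
  assumes "\<And>\<U> k s. (\<And>U. U \<in> \<U> \<Longrightarrow> openin X U) \<Longrightarrow> s \<in> sect P (\<Union>\<U>) k \<Longrightarrow>
      (\<And>U. U \<in> \<U> \<Longrightarrow> restr P (\<Union>\<U>) U s \<in> image_sheaf S F U k) \<Longrightarrow> s \<in> image_sheaf S F (\<Union>\<U>) k"
  shows "submodule_sheaf X A P (image_sheaf S F)"
proof (rule P.submodule_sheafI)
  show "subspace (image_sheaf S F U k)" if "openin X U" for U k
    by (rule image_subspace[OF that])
  show "s \<in> image_sheaf S F (\<Union>\<U>) k"
    if "\<And>U. U \<in> \<U> \<Longrightarrow> openin X U" "s \<in> sect P (\<Union>\<U>) k"
      "\<And>U. U \<in> \<U> \<Longrightarrow> restr P (\<Union>\<U>) U s \<in> image_sheaf S F U k" for \<U> k s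
    using that by (rule assms)
  show "image_sheaf S F U k \<subseteq> sect P U k" if "openin X U" for U k
    using F_in[OF that] by (auto simp: image_sheaf_def)
  show "restr P U V s \<in> image_sheaf S F V k"
    if o: "openin X U" "openin X V" "V \<subseteq> U" and s: "s \<in> image_sheaf S F U k" for U V k s
  proof -
    obtain x where x: "x \<in> sect S U k" "s = F U x" using s by (auto simp: image_sheaf_def)
    show ?thesis unfolding image_sheaf_def
      using F_restr[OF o x(1)] S.S.restr_in[OF o x(1)] x(2)
      by (intro image_eqI[of _ _ "restr S U V x"]) simp_all
  qed
  show "act P U a s \<in> image_sheaf S F U (i + k)"
    if U: "openin X U" and a: "a \<in> sect A U i" and s: "s \<in> image_sheaf S F U k" for U i k a s
  proof -
    obtain x where x: "x \<in> sect S U k" "s = F U x" using s by (auto simp: image_sheaf_def)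
    have "act S U a x \<in> sect S U (i + k)" using S.act_in[OF U, of a "i + k" k] a x by simp
    then show ?thesis
      unfolding image_sheaf_def using F_act[OF U a x(1)] x(2)
      by (intro image_eqI[of _ _ "act S U a x"]) simp_all
  qed
qed

theorem image_subbundle:
  assumes inj: "\<And>m. m \<in> topspace X \<Longrightarrow> fiber_injective X A S P F m"
  shows "subbundle X A P (image_sheaf S F)"
proof -
  have sub: "submodule_sheaf X A P (image_sheaf S F)"
  proof (rule image_submoduleI)
    fix \<U> k s
    assume o: "\<And>U. U \<in> \<U> \<Longrightarrow> openin X U" and s: "s \<in> sect P (\<Union>\<U>) k"
      and loc: "\<And>U. U \<in> \<U> \<Longrightarrow> restr P (\<Union>\<U>) U s \<in> image_sheaf S F U k"
    have oU: "openin X (\<Union>\<U>)" using o by blast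
    have "\<forall>U\<in>\<U>. \<exists>x. x \<in> sect S U k \<and> F U x = restr P (\<Union>\<U>) U s"
      using loc unfolding image_sheaf_def by (metis imageE)
    then obtain \<sigma> where \<sigma>: "\<And>U. U \<in> \<U> \<Longrightarrow> \<sigma> U \<in> sect S U k"
      "\<And>U. U \<in> \<U> \<Longrightarrow> F U (\<sigma> U) = restr P (\<Union>\<U>) U s" by metis
    \<comment> \<open>The local preimages were chosen separately; on overlaps \<open>F\<close> sends
      their difference to 0, so they agree.\<close>
    have "\<exists>!x. x \<in> sect S (\<Union>\<U>) k \<and> (\<forall>U\<in>\<U>. restr S (\<Union>\<U>) U x = \<sigma> U)"
    proof (rule S.S.glue[OF o \<sigma>(1)])
      fix U V assume UV: "U \<in> \<U>" "V \<in> \<U>"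
      note oUV = o[OF UV(1)] o[OF UV(2)] openin_Int[OF o[OF UV(1)] o[OF UV(2)]]
      note r1 = S.S.restr_in[OF oUV(1,3) Int_lower1 \<sigma>(1)[OF UV(1)]]
        and r2 = S.S.restr_in[OF oUV(2,3) Int_lower2 \<sigma>(1)[OF UV(2)]]
      have "F (U \<inter> V) (restr S U (U \<inter> V) (\<sigma> U)) = restr P (\<Union>\<U>) (U \<inter> V) s"
        using F_restr[OF oUV(1,3) Int_lower1 \<sigma>(1)[OF UV(1)]] \<sigma>(2)[OF UV(1)]
          P.S.restr_restr[OF oU oUV(1,3) Int_lower1 Union_upper[OF UV(1)] s] by simp
      moreover have "F (U \<inter> V) (restr S V (U \<inter> V) (\<sigma> V)) = restr P (\<Union>\<U>) (U \<inter> V) s"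
        using F_restr[OF oUV(2,3) Int_lower2 \<sigma>(1)[OF UV(2)]] \<sigma>(2)[OF UV(2)]
          P.S.restr_restr[OF oU oUV(2,3) Int_lower2 Union_upper[OF UV(2)] s] by simp
      ultimately have "F (U \<inter> V) (restr S U (U \<inter> V) (\<sigma> U) - restr S V (U \<inter> V) (\<sigma> V)) = 0"
        using F_diff[OF oUV(3) r1 r2] by simp
      then show "restr S U (U \<inter> V) (\<sigma> U) = restr S V (U \<inter> V) (\<sigma> V)"
        using injective_sections[OF inj oUV(3) S.S.diff_in[OF oUV(3) r1 r2]] by simp
    qed
    then obtain x where x: "x \<in> sect S (\<Union>\<U>) k" "\<And>U. U \<in> \<U> \<Longrightarrow> restr S (\<Union>\<U>) U x = \<sigma> U" by blast
    have "F (\<Union>\<U>) x = s"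
    proof (rule P.S.separated[OF oU F_in[OF oU x(1)] s])
      fix m assume "m \<in> \<Union>\<U>"
      then obtain U where U: "U \<in> \<U>" "m \<in> U" by blast
      have "restr P (\<Union>\<U>) U (F (\<Union>\<U>) x) = restr P (\<Union>\<U>) U s"
        using F_restr[OF oU o[OF U(1)] Union_upper[OF U(1)] x(1)] x(2)[OF U(1)] \<sigma>(2)[OF U(1)] by simp
      then show "\<exists>W. openin X W \<and> m \<in> W \<and> W \<subseteq> \<Union>\<U> \<and> restr P (\<Union>\<U>) W (F (\<Union>\<U>) x) = restr P (\<Union>\<U>) W s"
        using U o by blast
    qed
    then show "s \<in> image_sheaf S F (\<Union>\<U>) k" using x(1) by (auto simp: image_sheaf_def)
  qed
  let ?L = "P\<lparr>sect := image_sheaf S F\<rparr>"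
  obtain n where n: "\<forall>m\<in>topspace X. \<exists>U I d s. m \<in> U \<and> frame X A S U I d s \<and> card I = n"
    by (rule S.constant_rank)
  obtain r where r: "\<forall>m\<in>topspace X. \<exists>U I d s. m \<in> U \<and> frame X A P U I d s \<and> card I = r"
    by (rule P.constant_rank)
  show ?thesis
  proof (rule P.subbundleI[OF sub])
    fix m assume m: "m \<in> topspace X"
    obtain U I d s where U: "m \<in> U" "frame X A S U I d s" and cI: "card I = n" using bspec[OF n m] by blast
    obtain V J e p where V: "m \<in> V" "frame X A P V J e p" and cJ: "card J = r" using bspec[OF r m] by blast
    obtain W \<sigma> \<pi> \<tau> where W: "m \<in> W" "W \<subseteq> U" and frS: "frame X A S W I d \<sigma>" and frP: "frame X A P W J e \<pi>"
      and *: "inj_on \<tau> I" "\<tau> ` I \<subseteq> J" "\<forall>i\<in>I. e (\<tau> i) = d i" "\<forall>i\<in>I. \<pi> (\<tau> i) = F W (\<sigma> i)"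
      by (rule image_frame_near[OF inj[OF m] U(2,1) V(2,1)])
    note \<tau> = *(1,2) *(3,4)[rule_format]
    note oW = S.frameD(1)[OF frS]
    interpret L: module_sheaf X A ?L
      using sub by unfold_locales (simp add: submodule_sheaf_def)
    have "frame X A ?L W (\<tau> ` I) e \<pi>"
    proof (rule L.frameI[OF oW])
      show "\<pi> j \<in> sect ?L W (e j)" if "j \<in> \<tau> ` I" for j
        using that \<tau>(3,4) S.frameD(5)[OF frS] by (auto simp: image_sheaf_def)
      fix B assume B: "openin X B" "B \<subseteq> W"
      have "freely_generates A ?L B (\<tau> ` I) e (\<lambda>i. restr P W B (\<pi> i))"
      proof (rule image_freely_generates[OF sub _ B(1) S.frameD(3)[OF frS B] P.frameD(3)[OF frP B] \<tau>(1-3)])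
        show "image_sheaf S F B k = F B ` sect S B k" for k by (simp add: image_sheaf_def)
        show "restr P W B (\<pi> (\<tau> i)) = F B (restr S W B (\<sigma> i))" if "i \<in> I" for i
          using F_restr[OF oW B S.frameD(5)[OF frS that]] \<tau>(4)[OF that] by simp
      qed
      then show "freely_generates A ?L B (\<tau> ` I) e
          (\<lambda>i. restr ?L W B (\<pi> i))" by simp
    qed
    moreover have "card (\<tau> ` I) = n" using card_image[OF \<tau>(1)] cI by simp
    ultimately show "\<exists>U I d s K. m \<in> U \<and> frame X A P U I d s \<and> K \<subseteq> I \<and> card I = r \<and> card K = n \<and>
        frame X A ?L U K d s"
      using W(1) frP \<tau>(2) cJ by blast
  qed
qed

theorem kernel_subbundle:
  assumes surj: "surjective_morphism X S P F"
  shows "subbundle X A S (kernel_sheaf S F)"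
proof -
  have sub: "submodule_sheaf X A S (kernel_sheaf S F)"
  proof (rule S.submodule_sheafI)
    show "kernel_sheaf S F U k \<subseteq> sect S U k" for U k by (auto simp: kernel_sheaf_def)
    show "subspace (kernel_sheaf S F U k)" if U: "openin X U" for U k
      using S.S.zero_in[OF U] S.S.add_in[OF U] S.S.scale_in[OF U] F_zero[OF U] F_add[OF U] F_scale[OF U]
      unfolding kernel_sheaf_def by (intro subspaceI) auto
    show "restr S U V s \<in> kernel_sheaf S F V k"
      if o: "openin X U" "openin X V" "V \<subseteq> U" and s: "s \<in> kernel_sheaf S F U k" for U V k s
      using s F_restr[OF o, of s k] S.S.restr_in[OF o, of s k] P.S.restr_zero[OF o]
      by (simp add: kernel_sheaf_def)
    show "act S U a s \<in> kernel_sheaf S F U (i + k)"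
      if U: "openin X U" and a: "a \<in> sect A U i" and s: "s \<in> kernel_sheaf S F U k" for U i k a s
      using S.act_in[OF U, of a "i + k" k s] F_act[OF U a, of s k] a s
        linear_map_on_zero[OF P.act_linear_right[OF U a] P.S.zero_in[OF U, of k]]
      by (simp add: kernel_sheaf_def)
    fix \<U> k s
    assume o: "\<And>U. U \<in> \<U> \<Longrightarrow> openin X U" and s: "s \<in> sect S (\<Union>\<U>) k"
      and loc: "\<And>U. U \<in> \<U> \<Longrightarrow> restr S (\<Union>\<U>) U s \<in> kernel_sheaf S F U k"
    have oU: "openin X (\<Union>\<U>)" using o by blast
    \<comment> \<open>Vanishing can be tested on the members of the cover, since P is
      separated.\<close>
    have "F (\<Union>\<U>) s = 0"
    proof (rule P.S.separated[OF oU F_in[OF oU s] P.S.zero_in[OF oU]])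
      fix m assume "m \<in> \<Union>\<U>"
      then obtain U where U: "U \<in> \<U>" "m \<in> U" by blast
      have "restr P (\<Union>\<U>) U (F (\<Union>\<U>) s) = restr P (\<Union>\<U>) U 0"
        using F_restr[OF oU o[OF U(1)] Union_upper[OF U(1)] s] loc[OF U(1)]
          P.S.restr_zero[OF oU o[OF U(1)] Union_upper[OF U(1)]] by (simp add: kernel_sheaf_def)
      then show "\<exists>W. openin X W \<and> m \<in> W \<and> W \<subseteq> \<Union>\<U> \<and> restr P (\<Union>\<U>) W (F (\<Union>\<U>) s) = restr P (\<Union>\<U>) W 0"
        using U o by blast
    qed
    then show "s \<in> kernel_sheaf S F (\<Union>\<U>) k" using s by (simp add: kernel_sheaf_def)
  qed
  let ?L = "S\<lparr>sect := kernel_sheaf S F\<rparr>"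
  obtain n where n: "\<forall>m\<in>topspace X. \<exists>U I d s. m \<in> U \<and> frame X A S U I d s \<and> card I = n"
    by (rule S.constant_rank)
  obtain r where r: "\<forall>m\<in>topspace X. \<exists>U I d s. m \<in> U \<and> frame X A P U I d s \<and> card I = r"
    by (rule P.constant_rank)
  show ?thesis
  proof (rule S.subbundleI[OF sub])
    fix m assume m: "m \<in> topspace X"
    obtain U I d s where U: "m \<in> U" "frame X A S U I d s" and cI: "card I = n" using bspec[OF n m] by blast
    obtain V J e p where V: "m \<in> V" "frame X A P V J e p" and cJ: "card J = r" using bspec[OF r m] by blast
    obtain W \<sigma> \<pi> \<tau> where W: "m \<in> W" and frS: "frame X A S W I d \<sigma>" and frP: "frame X A P W J e \<pi>"
      and *: "inj_on \<tau> J" "\<tau> ` J \<subseteq> I" "\<forall>j\<in>J. d (\<tau> j) = e j" "\<forall>j\<in>J. F W (\<sigma> (\<tau> j)) = \<pi> j"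
        "\<forall>i\<in>I - \<tau> ` J. F W (\<sigma> i) = 0"
      by (rule kernel_frame_near[OF surj U(2,1) V(2,1)])
    note \<tau> = *(1,2) *(3,4)[rule_format] and zero = *(5)[rule_format]
    note oW = S.frameD(1)[OF frS] and \<sigma> = S.frameD(5)[OF frS]
    interpret L: module_sheaf X A ?L
      using sub by unfold_locales (simp add: submodule_sheaf_def)
    have "frame X A ?L W (I - \<tau> ` J) d \<sigma>"
    proof (rule L.frameI[OF oW])
      show "\<sigma> i \<in> sect ?L W (d i)" if "i \<in> I - \<tau> ` J" for i
        using that zero \<sigma> by (auto simp: kernel_sheaf_def)
      fix B assume B: "openin X B" "B \<subseteq> W"
      have "freely_generates A ?L B (I - \<tau> ` J) d (\<lambda>i. restr S W B (\<sigma> i))"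
      proof (rule kernel_freely_generates[OF sub _ B(1) S.frameD(3)[OF frS B] P.frameD(3)[OF frP B] \<tau>(1-3)])
        show "kernel_sheaf S F B k = {x \<in> sect S B k. F B x = 0}" for k by (simp add: kernel_sheaf_def)
        show "F B (restr S W B (\<sigma> (\<tau> j))) = restr P W B (\<pi> j)" if "j \<in> J" for j
          using F_restr[OF oW B \<sigma>] \<tau>(2,4) that by auto
        show "F B (restr S W B (\<sigma> i)) = 0" if "i \<in> I - \<tau> ` J" for i
          using F_restr[OF oW B \<sigma>] zero[OF that] that P.S.restr_zero[OF oW B] by auto
      qed
      then show "freely_generates A ?L B (I - \<tau> ` J) d
          (\<lambda>i. restr ?L W B (\<sigma> i))" by simp
    qed
    \<comment> \<open>The r distinct slots of the lifts are removed from n slots, so the same number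
      is left at each point.\<close>
    moreover have "card (I - \<tau> ` J) = n - r"
      using card_image[OF \<tau>(1)] cI cJ \<tau>(2) S.frameD(4)[OF frS] by (simp add: card_Diff_subset finite_subset)
    ultimately show "\<exists>U I d s K. m \<in> U \<and> frame X A S U I d s \<and> K \<subseteq> I \<and> card I = n \<and> card K = n - r \<and>
        frame X A ?L U K d s"
      using W frS cI by blast
  qed
qed

end

section \<open>Multiplication by an odd function\<close>

text \<open>The sections of the counterexample have type \<open>nat \<Rightarrow> 'a\<close>. Rank one modules are embedded there as
  constant sequences, with degrees shifted by \<open>c\<close>.\<close>

definition free_module :: "('m, 'a::real_vector) galgebra \<Rightarrow> int \<Rightarrow> ('m, 'a, nat \<Rightarrow> 'a) gmodule"
  where "free_module A c = \<lparr>
    sect = (\<lambda>U k. {(\<lambda>_. f) | f. f \<in> sect A U (k - c)}),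
    restr = (\<lambda>U V s i. restr A U V (s i)),
    act = (\<lambda>U a s i. gmult A U a (s i)) \<rparr>"

lemma free_module_simps:
  "sect (free_module A c) U k = {(\<lambda>_. f) | f. f \<in> sect A U (k - c)}"
  "restr (free_module A c) U V s = (\<lambda>i. restr A U V (s i))"
  "act (free_module A c) U a s = (\<lambda>i. gmult A U a (s i))"
  by (simp_all add: free_module_def)

context gmanifold
begin

lemma free_module_sheaf: "sheaf_of_modules X A (free_module A c)"
proof -
  let ?S = "free_module A c"
  have glue: "\<exists>!s. s \<in> sect ?S (\<Union>\<U>) k \<and> (\<forall>U\<in>\<U>. restr ?S (\<Union>\<U>) U s = \<sigma> U)"
    if o: "\<forall>U\<in>\<U>. openin X U \<and> \<sigma> U \<in> sect ?S U k"
      and c: "\<forall>U\<in>\<U>. \<forall>V\<in>\<U>. restr ?S U (U \<inter> V) (\<sigma> U) = restr ?S V (U \<inter> V) (\<sigma> V)" for \<U> k \<sigma>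
  proof -
    \<comment> \<open>Evaluation at one index inverts the embedding as constant sequences, which
      transfers gluing from A.\<close>
    define \<tau> where "\<tau> U = \<sigma> U 0" for U
    have \<tau>: "\<tau> U \<in> sect A U (k - c)" "\<sigma> U = (\<lambda>_. \<tau> U)" if "U \<in> \<U>" for U
      using o that by (auto simp: \<tau>_def free_module_simps)
    have "\<exists>!f. f \<in> sect A (\<Union>\<U>) (k - c) \<and> (\<forall>U\<in>\<U>. restr A (\<Union>\<U>) U f = \<tau> U)"
    proof (rule A.glue)
      show "restr A U (U \<inter> V) (\<tau> U) = restr A V (U \<inter> V) (\<tau> V)" if "U \<in> \<U>" "V \<in> \<U>" for U V
        using fun_cong[OF bspec[OF bspec[OF c that(1)] that(2)], of 0]
        by (simp add: free_module_simps \<tau>_def)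
    qed (use o \<tau> in auto)
    then obtain f where f: "f \<in> sect A (\<Union>\<U>) (k - c)" "\<forall>U\<in>\<U>. restr A (\<Union>\<U>) U f = \<tau> U"
      and uniq: "\<And>g. g \<in> sect A (\<Union>\<U>) (k - c) \<Longrightarrow> \<forall>U\<in>\<U>. restr A (\<Union>\<U>) U g = \<tau> U \<Longrightarrow> g = f"
      by blast
    show ?thesis
    proof (rule ex1I[of _ "\<lambda>_. f"])
      show "(\<lambda>_. f) \<in> sect ?S (\<Union>\<U>) k \<and> (\<forall>U\<in>\<U>. restr ?S (\<Union>\<U>) U (\<lambda>_. f) = \<sigma> U)"
        using f \<tau>(2) by (auto simp: free_module_simps)
      fix s assume s: "s \<in> sect ?S (\<Union>\<U>) k \<and> (\<forall>U\<in>\<U>. restr ?S (\<Union>\<U>) U s = \<sigma> U)"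
      then obtain g where g: "s = (\<lambda>_. g)" "g \<in> sect A (\<Union>\<U>) (k - c)"
        by (auto simp: free_module_simps)
      have "\<forall>U\<in>\<U>. restr A (\<Union>\<U>) U g = \<tau> U"
        using s \<tau>(2) g(1) by (auto simp: free_module_simps fun_eq_iff)
      then show "s = (\<lambda>_. f)" using uniq[OF g(2)] g(1) by simp
    qed
  qed
  have graded: "graded_vector_space (sect ?S U)" if U: "openin X U" for U
    unfolding graded_vector_space_def
  proof (intro conjI allI impI)
    show "subspace (sect ?S U k)" for k
      using A.zero_in[OF U] A.add_in[OF U] A.scale_in[OF U]
      by (intro subspaceI) (auto simp: free_module_simps zero_fun_def plus_fun_def scaleR_fun_def)
    have gA: "sect A U i \<inter> sect A U j = {0}" if "i \<noteq> j" for i j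
      using A.vsheaf[unfolded sheaf_of_graded_vector_spaces_def, THEN conjunct1, THEN spec, THEN mp, OF U]
        that by (simp add: graded_vector_space_def)
    show "sect ?S U i \<inter> sect ?S U j = {0}" if "i \<noteq> j" for i j
    proof -
      have "sect ?S U i \<inter> sect ?S U j = {(\<lambda>_. f) | f. f \<in> sect A U (i - c) \<inter> sect A U (j - c)}"
        by (auto simp: free_module_simps fun_eq_iff)
      also have "\<dots> = {0}" using gA[of "i - c" "j - c"] that by (auto simp: zero_fun_def)
      finally show ?thesis .
    qed
  qed
  have 1: "sheaf_of_graded_vector_spaces X ?S"
    unfolding sheaf_of_graded_vector_spaces_def
  proof (intro conjI allI impI, goal_cases)
    case (1 U)
    then show ?case by (rule graded)
  next
    case (2 U V k)
    then show ?case using A.restr_in[of U V] by (auto simp: free_module_simps)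
  next
    case (3 U V k)
    then show ?case using A.restr_add[of U V] A.restr_scale[of U V]
      by (auto simp: linear_map_on_def free_module_simps plus_fun_def scaleR_fun_def)
  next
    case (4 U k)
    then show ?case using A.restr_id[of U] by (auto simp: free_module_simps)
  next
    case (5 U V W k)
    then show ?case using A.restr_restr[of U V W] by (auto simp: free_module_simps)
  next
    case (6 \<U> k \<sigma>)
    then show ?case by (elim conjE) (rule glue)
  qed
  have 2: "graded_bilinear (sect A U) (sect ?S U) (sect ?S U) (act ?S U)" if U: "openin X U" for U
    unfolding graded_bilinear_def
  proof (intro allI conjI ballI)
    show "act ?S U a s \<in> sect ?S U (i + j)" if "a \<in> sect A U i" "s \<in> sect ?S U j" for i j a s
      using gmult_in[OF U that(1), of _ "j - c"] that(2) by (auto simp: free_module_simps algebra_simps)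
    show "linear_map_on (sect A U i) (\<lambda>a. act ?S U a s)" if "s \<in> sect ?S U j" for i j s
      using that gmult_linear_left[OF U]
      by (auto simp: free_module_simps linear_map_on_def plus_fun_def scaleR_fun_def)
    show "linear_map_on (sect ?S U j) (act ?S U a)" if "a \<in> sect A U i" for i j a
      using gmult_linear_right[OF U that]
      by (auto simp: free_module_simps linear_map_on_def plus_fun_def scaleR_fun_def)
  qed
  have 3: "act ?S U (gone A U) s = s" if "openin X U" "s \<in> sect ?S U k" for U s k
    using that gone_left by (auto simp: free_module_simps)
  have 4: "act ?S U (gmult A U a b) s = act ?S U a (act ?S U b s)"
    if "openin X U" "a \<in> sect A U i" "b \<in> sect A U j" "s \<in> sect ?S U k" for U a b s i j k
    using that gmult_assoc by (auto simp: free_module_simps)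
  have 5: "restr ?S U V (act ?S U a s) = act ?S V (restr A U V a) (restr ?S U V s)"
    if "openin X U" "openin X V" "V \<subseteq> U" "a \<in> sect A U i" "s \<in> sect ?S U k" for U V a s i k
    using that restr_gmult by (auto simp: free_module_simps)
  show ?thesis
    unfolding sheaf_of_modules_def
    by (intro conjI allI impI ballI; (elim conjE)?; rule 1 2 3 4 5; assumption)
qed

lemma free_module_frame:
  assumes U: "openin X U"
  shows "frame X A (free_module A c) U {1} (\<lambda>_. c) (\<lambda>_ _. gone A U)"
proof -
  interpret S: module_sheaf X A "free_module A c"
    by unfold_locales (rule free_module_sheaf)
  have gen: "freely_generates A (free_module A c) V {1} (\<lambda>_. c) (\<lambda>_ _. gone A V)" if V: "openin X V" for V
  proof (rule S.freely_generatesI[OF V])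
    have comb: "S.comb V {1} (\<lambda>_ _. gone A V) f = (\<lambda>_. f 1)" if "S.coefs V {1} (\<lambda>_. c) k f" for f k
      using that gone_right[OF V] by (simp add: S.comb_def S.coefs_def free_module_simps)
    show "(\<lambda>_. gone A V) \<in> sect (free_module A c) V c"
      using gone_in[OF V] by (auto simp: free_module_simps)
    show "\<exists>f. S.coefs V {1} (\<lambda>_. c) k f \<and> t = S.comb V {1} (\<lambda>_ _. gone A V) f"
      if t: "t \<in> sect (free_module A c) V k" for k t
    proof -
      obtain g where g: "t = (\<lambda>_. g)" "g \<in> sect A V (k - c)" using t by (auto simp: free_module_simps)
      then have "S.coefs V {1} (\<lambda>_. c) k (\<lambda>_. g)" by (simp add: S.coefs_def)
      then show ?thesis using comb g(1) by (intro exI[of _ "\<lambda>_. g"]) simp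
    qed
    show "f i = 0" if "S.coefs V {1} (\<lambda>_. c) k f" "S.comb V {1} (\<lambda>_ _. gone A V) f = 0" "i \<in> {1}" for k f i
      using comb[OF that(1)] that(2,3) by (simp add: fun_eq_iff)
  qed simp
  show ?thesis
  proof (rule S.frameI[OF U])
    show "(\<lambda>_. gone A U) \<in> sect (free_module A c) U c"
      using gone_in[OF U] by (auto simp: free_module_simps)
    show "freely_generates A (free_module A c) V {1} (\<lambda>_. c) (\<lambda>i. restr (free_module A c) U V (\<lambda>_. gone A U))"
      if "openin X V" "V \<subseteq> U" for V
      using gen[OF that(1)] restr_gone[OF U that] by (simp add: free_module_simps)
  qed
qed

lemma free_module_bundle: "graded_vector_bundle X A (free_module A c)"
  unfolding graded_vector_bundle_def
proof (intro conjI exI ballI)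
  show "m \<in> topspace X" if "m \<in> topspace X" for m using that .
  show "frame X A (free_module A c) (topspace X) {1} (\<lambda>_. c) (\<lambda>_ _. gone A (topspace X))"
    by (rule free_module_frame) simp
qed (rule free_module_sheaf refl)+

end

text \<open>Multiplication by a global function of degree 1 over any graded manifold. To refute the
  subbundle property, an example has to supply a point and the nonvanishing of the function on
  nonempty open sets.\<close>

locale odd_function = gmanifold X A
  for X :: "'m topology" and A :: "('m, 'a::real_vector) galgebra" +
  fixes \<xi> :: 'a
  assumes odd: "\<xi> \<in> sect A (topspace X) 1"
begin

definition \<xi>_on :: "'m set \<Rightarrow> 'a"
  where "\<xi>_on U = restr A (topspace X) U \<xi>"

text \<open>The factor stands on the right, so the map is linear for the action from the left
  without a sign. Shifting the generator of the source to degree 1 makes the map one of degree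
  0.\<close>

definition times_\<xi> :: "'m set \<Rightarrow> (nat \<Rightarrow> 'a) \<Rightarrow> nat \<Rightarrow> 'a"
  where "times_\<xi> U s = (\<lambda>i. gmult A U (s i) (\<xi>_on U))"

lemma \<xi>_on_in: "openin X U \<Longrightarrow> \<xi>_on U \<in> sect A U 1"
  unfolding \<xi>_on_def using odd by (intro A.restr_in) (auto simp: openin_subset)

lemma \<xi>_on_restr: "openin X U \<Longrightarrow> openin X V \<Longrightarrow> V \<subseteq> U \<Longrightarrow> restr A U V (\<xi>_on U) = \<xi>_on V"
  unfolding \<xi>_on_def using odd by (intro A.restr_restr) (auto simp: openin_subset)

text \<open>Factors of odd degree anticommute, so the square equals its own negative.\<close>

lemma \<xi>_square:
  assumes U: "openin X U"
  shows "gmult A U (\<xi>_on U) (\<xi>_on U) = 0"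
proof -
  let ?x = "gmult A U (\<xi>_on U) (\<xi>_on U)"
  have "?x = - ?x" using gmult_commute[OF U \<xi>_on_in[OF U] \<xi>_on_in[OF U]] by simp
  then have "2 *\<^sub>R ?x = 0" by (metis eq_neg_iff_add_eq_0 scaleR_2)
  then show ?thesis by simp
qed

lemma gmult_\<xi>_in: "openin X U \<Longrightarrow> f \<in> sect A U (k - 1) \<Longrightarrow> gmult A U f (\<xi>_on U) \<in> sect A U k"
  using gmult_in[of U f "k - 1" "\<xi>_on U" 1] \<xi>_on_in[of U] by simp

text \<open>Moving \<xi> past the product costs at most a sign, which is harmless because the result
  contains the square of \<xi>.\<close>

lemma \<xi>_annihilates:
  assumes U: "openin X U" and f: "f \<in> sect A U k"
  shows "gmult A U (\<xi>_on U) (gmult A U f (\<xi>_on U)) = 0"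
proof -
  note \<xi> = \<xi>_on_in[OF U]
  have zero: "gmult A U f 0 = 0"
    using linear_map_on_zero[OF gmult_linear_right[OF U f] A.zero_in[OF U]] .
  have "gmult A U (\<xi>_on U) (gmult A U f (\<xi>_on U)) = gmult A U (gmult A U f (\<xi>_on U)) (\<xi>_on U) \<or>
      gmult A U (\<xi>_on U) (gmult A U f (\<xi>_on U)) = - gmult A U (gmult A U f (\<xi>_on U)) (\<xi>_on U)"
    using gmult_commute[OF U \<xi> gmult_in[OF U f \<xi>]] by (simp split: if_splits)
  moreover have "gmult A U (gmult A U f (\<xi>_on U)) (\<xi>_on U) = 0"
    using gmult_assoc[OF U f \<xi> \<xi>] \<xi>_square[OF U] zero by simp
  ultimately show ?thesis by auto
qed

lemma times_\<xi>_morphism: "bundle_morphism X A (free_module A 1) (free_module A 0) times_\<xi>"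
  unfolding bundle_morphism_def
proof (intro conjI allI impI ballI)
  fix U k assume U: "openin X U"
  note \<xi> = \<xi>_on_in[OF U]
  show "times_\<xi> U ` sect (free_module A 1) U k \<subseteq> sect (free_module A 0) U k"
    using gmult_\<xi>_in[OF U] by (auto simp: times_\<xi>_def free_module_simps)
  show "linear_map_on (sect (free_module A 1) U k) (times_\<xi> U)"
    using gmult_linear_left[OF U \<xi>]
    by (auto simp: linear_map_on_def times_\<xi>_def free_module_simps plus_fun_def scaleR_fun_def)
  show "times_\<xi> U (act (free_module A 1) U a s) = act (free_module A 0) U a (times_\<xi> U s)"
    if "a \<in> sect A U i" "s \<in> sect (free_module A 1) U k" for i a s
    using that gmult_assoc[OF U _ _ \<xi>] by (auto simp: times_\<xi>_def free_module_simps)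
next
  fix U V k s assume o: "openin X U \<and> openin X V \<and> V \<subseteq> U" and s: "s \<in> sect (free_module A 1) U k"
  obtain f where "s = (\<lambda>_. f)" "f \<in> sect A U (k - 1)" using s by (auto simp: free_module_simps)
  then show "times_\<xi> V (restr (free_module A 1) U V s) = restr (free_module A 0) U V (times_\<xi> U s)"
    using o restr_gmult[of U V f "k - 1" "\<xi>_on U" 1] \<xi>_on_in[of U] \<xi>_on_restr[of U V]
    by (simp add: times_\<xi>_def free_module_simps)
qed

sublocale \<xi>: bundle_map X A "free_module A 1" "free_module A 0" times_\<xi>
  by unfold_locales (rule free_module_sheaf free_module_bundle times_\<xi>_morphism)+

lemma image_\<xi>: "image_sheaf (free_module A 1) times_\<xi> U k = {(\<lambda>_. gmult A U f (\<xi>_on U)) | f. f \<in> sect A U (k - 1)}"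
  by (auto simp: image_sheaf_def times_\<xi>_def free_module_simps)

text \<open>Values are multiplicative and \<xi> has nonzero degree, so the coefficient of the image
  with respect to the unit section vanishes at \<open>m\<close>.\<close>

lemma times_\<xi>_nul:
  assumes U: "openin X U" "m \<in> U" and s: "s \<in> sect (free_module A 1) U k"
  shows "\<xi>.P.nul m k U (times_\<xi> U s)"
proof -
  obtain f where f: "s = (\<lambda>_. f)" "f \<in> sect A U (k - 1)" using s by (auto simp: free_module_simps)
  note \<xi> = \<xi>_on_in[OF U(1)] and f\<xi> = gmult_\<xi>_in[OF U(1) f(2)]
  have "val m (k - 1 + 1) U (gmult A U f (\<xi>_on U)) = 0"
    using val_gmult[OF U f(2) \<xi>] by (simp add: val_nonzero_degree)
  then have "\<xi>.P.nul m k U (\<xi>.P.comb U {1} (\<lambda>_ _. gone A U) (\<lambda>_. gmult A U f (\<xi>_on U)))"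
    using f\<xi> gone_in[OF U(1)]
    by (intro \<xi>.P.nul_comb[OF U, where d = "\<lambda>_. 0"]) (auto simp: \<xi>.P.coefs_def free_module_simps)
  then show ?thesis
    using gone_right[OF U(1) f\<xi>] f(1) by (simp add: \<xi>.P.comb_def free_module_simps times_\<xi>_def)
qed

text \<open>The image of the fiber consists of the zero class alone, with the empty list as basis.
  The source fiber must be nonempty for the zero class to be attained.\<close>

lemma fiber_image_zero: "has_dimension (fiber_image X A (free_module A 1) (free_module A 0) times_\<xi> m k) 0"
  if m: "m \<in> topspace X"
proof -
  have "fiber_map X A (free_module A 0) times_\<xi> m k C = vzero (fiber X A (free_module A 0) m k)"
    if "C \<in> vcarrier (fiber X A (free_module A 1) m k)" for C
    using that times_\<xi>_nul by (rule \<xi>.fiber_map_zero)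
  moreover have "vcarrier (fiber X A (free_module A 1) m k) \<noteq> {}"
    using \<xi>.S.S.germ_in_carrier[OF openin_topspace m \<xi>.S.S.zero_in[OF openin_topspace]]
    unfolding \<xi>.S.fiber_carrier by (auto simp: quotient_def)
  ultimately have "fiber_map X A (free_module A 0) times_\<xi> m k ` vcarrier (fiber X A (free_module A 1) m k) =
      {vzero (fiber X A (free_module A 0) m k)}" by force
  then show ?thesis
    by (auto simp: has_dimension_def fiber_image_def lincomb_def)
qed

lemma image_\<xi>_not_subbundle:
  assumes nonempty: "topspace X \<noteq> {}" and nz: "\<And>U. openin X U \<Longrightarrow> U \<noteq> {} \<Longrightarrow> \<xi>_on U \<noteq> 0"
  shows "\<not> subbundle X A (free_module A 0) (image_sheaf (free_module A 1) times_\<xi>)"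
proof
  let ?L = "image_sheaf (free_module A 1) times_\<xi>" and ?P = "free_module A 0"
  assume sub: "subbundle X A ?P ?L"
  interpret L: module_sheaf X A "?P\<lparr>sect := ?L\<rparr>"
    using sub by unfold_locales (simp add: subbundle_def submodule_sheaf_def)
  obtain m where "m \<in> topspace X" using nonempty by blast
  then obtain U J d s where m: "m \<in> U" and fr: "frame X A (?P\<lparr>sect := ?L\<rparr>) U J d s"
    using sub unfolding subbundle_def by blast
  note U = L.frameD(1)[OF fr] and gen = L.frameD(2)[OF fr]
  have \<xi>0: "\<xi>_on U \<noteq> 0" using nz[OF U] m by blast
  note \<xi> = \<xi>_on_in[OF U]
  \<comment> \<open>The function itself, as image of the unit, is a nonzero section; hence a frame
    of the image has at least one element.\<close>
  have "(\<lambda>_. \<xi>_on U) \<in> ?L U 1"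
    unfolding image_\<xi> using gone_in[OF U] gone_left[OF U \<xi>] by force
  then obtain f where "(\<lambda>_. \<xi>_on U) = L.comb U J s f"
    using L.freely_generatesD(3)[OF U gen, of _ 1] by auto
  moreover have "(\<lambda>_. \<xi>_on U) \<noteq> (0 :: nat \<Rightarrow> 'a)" using \<xi>0 by (auto simp: fun_eq_iff)
  ultimately have "J \<noteq> {}" by (auto simp: L.comb_def)
  then obtain j where j: "j \<in> J" by blast
  obtain f where f: "s j = (\<lambda>_. gmult A U f (\<xi>_on U))" "f \<in> sect A U (d j - 1)"
    using L.freely_generatesD(2)[OF U gen j] by (auto simp: image_\<xi>)
  \<comment> \<open>The relation that contradicts freeness: the nonzero coefficient \<xi> at the
    single index j annihilates \<open>s j\<close>.\<close>
  let ?g = "\<lambda>i. if i = j then \<xi>_on U else 0"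
  have "L.coefs U J d (d j + 1) ?g" using \<xi> A.zero_in[OF U] by (simp add: L.coefs_def)
  moreover have "L.comb U J s ?g = act (?P\<lparr>sect := ?L\<rparr>) U (\<xi>_on U) (s j)"
    using L.freely_generatesD(1)[OF U gen] j L.act_zero_left[OF U L.freely_generatesD(2)[OF U gen]]
    by (simp add: L.comb_def sum.remove)
  moreover have "act (?P\<lparr>sect := ?L\<rparr>) U (\<xi>_on U) (s j) = 0"
    using \<xi>_annihilates[OF U f(2)] by (simp add: f(1) free_module_simps zero_fun_def)
  ultimately have "?g j = 0" using L.freely_generatesD(4)[OF U gen _ _ j, of "d j + 1" ?g] by simp
  then show False using \<xi>0 by simp
qed

end

section \<open>The point with one odd coordinate\<close>

abbreviation pt :: "(nat \<Rightarrow> real) topology"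
  where "pt \<equiv> Euclidean_space 0"

abbreviation odd_model :: "(nat \<Rightarrow> real, power_series) galgebra"
  where "odd_model \<equiv> local_model 0 [1]"

text \<open>The exponent of the monomial \<xi>, a function on all naturals like every
  multi-index.\<close>

definition odd_index :: "nat \<Rightarrow> nat"
  where "odd_index i = (if i = 0 then 1 else 0)"

definition odd_coordinate :: power_series
  where "odd_coordinate p x = (if p = odd_index \<and> x = 0 then 1 else 0)"

lemma topspace_pt: "topspace pt = {0}"
  by (auto simp: topspace_Euclidean_space fun_eq_iff)

lemma openin_pt: "openin pt U \<longleftrightarrow> U = {} \<or> U = {0}"
  using openin_subset[of pt U] openin_topspace[of pt] by (auto simp: topspace_pt subset_singleton_iff)

text \<open>On at most one point every map is continuous, and in dimension 0 there are no partial
  derivatives.\<close>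

lemma smooth_on_pt: "smooth_on 0 U f"
proof -
  have "continuous_map (subtopology pt U) euclideanreal f"
  proof -
    define T where "T = subtopology pt U"
    have "openin T {x \<in> topspace T. f x \<in> V}" for V
    proof -
      define W where "W = {x \<in> topspace T. f x \<in> V}"
      have "topspace T \<subseteq> {0}" unfolding T_def by (auto simp: topspace_pt)
      then have "W = {} \<or> W = topspace T" unfolding W_def by blast
      then have "openin T W" by (elim disjE) simp_all
      then show ?thesis unfolding W_def .
    qed
    then show ?thesis unfolding T_def by (simp add: continuous_map_def)
  qed
  then have "C_on k 0 U f" for k
    by (cases k) (auto simp: C_on.simps)
  then show ?thesis by (simp add: smooth_on_def)
qed

lemma odd_index_neq_zero: "odd_index \<noteq> 0" "0 \<noteq> odd_index"
  by (auto simp: fun_eq_iff odd_index_def)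

lemma zero_or_odd_index:
  assumes "\<And>i. i \<noteq> 0 \<Longrightarrow> p i = 0"
  shows "p 0 = 0 \<Longrightarrow> p = 0" and "p 0 = 1 \<Longrightarrow> p = odd_index"
proof -
  show "p = 0" if "p 0 = 0"
  proof
    fix i show "p i = 0 i" using assms that by (cases "i = 0") auto
  qed
  show "p = odd_index" if "p 0 = 1"
  proof
    fix i show "p i = odd_index i" using assms that by (cases "i = 0") (auto simp: odd_index_def)
  qed
qed

lemma multi_index_odd: "multi_index [1] p \<longleftrightarrow> p = 0 \<or> p = odd_index"
proof
  assume p: "multi_index [1] p"
  then have "p i = 0" if "i \<noteq> 0" for i using that by (simp add: multi_index_def)
  moreover have "p 0 = 0 \<or> p 0 = 1" using p by (auto simp: multi_index_def)
  ultimately show "p = 0 \<or> p = odd_index" using zero_or_odd_index[of p] by blast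
qed (auto simp: multi_index_def odd_index_def)

lemma mdegree_odd: "mdegree [1] 0 = 0" "mdegree [1] odd_index = 1"
  by (simp_all add: mdegree_def odd_index_def)

text \<open>Over the point, homogeneous sections are real numbers a in degree 0 and multiples b
  \<xi> in degree 1. As a condition on supports this no longer mentions smoothness, and the sheaf
  axioms reduce to case distinctions.\<close>

lemma odd_model_sect:
  "f \<in> sect odd_model U k \<longleftrightarrow>
    (\<forall>p x. f p x \<noteq> 0 \<longrightarrow> x \<in> U \<and> (p = 0 \<and> k = 0 \<or> p = odd_index \<and> k = 1))"
proof -
  define C where "C p \<longleftrightarrow> p = 0 \<and> k = 0 \<or> p = odd_index \<and> k = 1" for p
  have C: "multi_index [1] p \<and> mdegree [1] p = k \<longleftrightarrow> C p" for p
    by (auto simp: multi_index_odd mdegree_odd C_def)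
  have fp: "f p = 0 \<longleftrightarrow> (\<forall>x. f p x = 0)" for p
    by (simp add: fun_eq_iff)
  have "f \<in> sect odd_model U k \<longleftrightarrow> (\<forall>p x. f p x \<noteq> 0 \<longrightarrow> x \<in> U \<and> C p)"
    unfolding local_model_sect C fp by (auto simp: smooth_on_pt)
  then show ?thesis by (simp only: C_def)
qed

lemma odd_model_outside: "f \<in> sect odd_model U k \<Longrightarrow> x \<notin> U \<Longrightarrow> f p x = 0"
  unfolding odd_model_sect by blast

text \<open>This is (a + b \<xi>)(c + d \<xi>) = a c + (a d + b c) \<xi>. With a single variable the
  exponent in the Koszul sign is an empty sum, so the sign is +1.\<close>

lemma odd_model_gmult:
  "gmult odd_model U f g r x =
    (if r = 0 then f 0 x * g 0 x
     else if r = odd_index then f 0 x * g odd_index x + f odd_index x * g 0 x else 0)"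
proof -
  have sign: "koszul_sign [1] p q = 1" for p q by (simp add: koszul_sign_def)
  have "{(p, q). p + q = odd_index} = {(0, odd_index), (odd_index, 0)}"
  proof (intro equalityI subsetI)
    fix z assume "z \<in> {(p, q). p + q = odd_index}"
    then obtain p q where z: "z = (p, q)" and pq: "p i + q i = odd_index i" for i
      by (auto simp: fun_eq_iff)
    have "p i = 0" "q i = 0" if "i \<noteq> 0" for i using pq[of i] that by (simp_all add: odd_index_def)
    moreover have "p 0 = 0 \<and> q 0 = 1 \<or> p 0 = 1 \<and> q 0 = 0" using pq[of 0] by (auto simp: odd_index_def)
    ultimately have "p = 0 \<and> q = odd_index \<or> p = odd_index \<and> q = 0"
      using zero_or_odd_index[of p] zero_or_odd_index[of q] by blast
    then show "z \<in> {(0, odd_index), (odd_index, 0)}" using z by blast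
  qed auto
  then have "gmult odd_model U f g odd_index x = f 0 x * g odd_index x + f odd_index x * g 0 x"
    by (simp add: local_model_gmult multi_index_odd sign odd_index_neq_zero)
  moreover have "gmult odd_model U f g r x = 0" if "r \<noteq> 0" "r \<noteq> odd_index"
    using that by (simp add: local_model_gmult multi_index_odd)
  ultimately show ?thesis by (auto simp: local_model_gmult_body)
qed

section \<open>The point as a graded manifold\<close>

lemma odd_model_vector_sheaf: "sheaf_of_graded_vector_spaces pt odd_model"
proof -
  let ?A = odd_model
  have glue: "\<exists>!s. s \<in> sect ?A (\<Union>\<U>) k \<and> (\<forall>U\<in>\<U>. restr ?A (\<Union>\<U>) U s = \<sigma> U)"
    if o: "\<forall>U\<in>\<U>. openin pt U \<and> \<sigma> U \<in> sect ?A U k"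
      and c: "\<forall>U\<in>\<U>. \<forall>V\<in>\<U>. restr ?A U (U \<inter> V) (\<sigma> U) = restr ?A V (U \<inter> V) (\<sigma> V)" for \<U> k \<sigma>
  proof -
    have id: "restr ?A U U s = s" if "s \<in> sect ?A U k" for U s
      using that by (intro ext) (auto simp: odd_model_sect local_model_restr)
    \<comment> \<open>As \<open>{}\<close> and \<open>{0}\<close> are the only open sets, a family
      that does not contain its union is empty. In the first case the section given over the union
      is the glued one; in the second only 0 lives over \<open>{}\<close>.\<close>
    show ?thesis
    proof (cases "\<Union>\<U> \<in> \<U>")
      case True
      have "restr ?A (\<Union>\<U>) U (\<sigma> (\<Union>\<U>)) = \<sigma> U" if U: "U \<in> \<U>" for U
      proof -
        have "\<Union>\<U> \<inter> U = U" using U by blast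
        then show ?thesis using bspec[OF bspec[OF c True] U] id[of "\<sigma> U" U] o U by simp
      qed
      then show ?thesis using True o id by (intro ex1I[of _ "\<sigma> (\<Union>\<U>)"]) auto
    next
      case False
      have "U = {} \<or> U = {0}" if "U \<in> \<U>" for U using o that by (simp add: openin_pt)
      then have "\<U> \<subseteq> {{}, {0}}" by blast
      moreover have "{0} \<notin> \<U>"
      proof
        assume "{0} \<in> \<U>"
        moreover from this have "\<Union>\<U> = {0}" using \<open>\<U> \<subseteq> {{}, {0}}\<close> by blast
        ultimately show "False" using False by simp
      qed
      ultimately have sub: "\<U> \<subseteq> {{}}" by blast
      then have "\<Union>\<U> = {}" by blast
      then have "\<U> = {}" using sub False by (metis subset_singletonD singletonI)
      then show ?thesis by (intro ex1I[of _ 0]) (auto simp: odd_model_sect intro!: ext)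
    qed
  qed
  show ?thesis
    unfolding sheaf_of_graded_vector_spaces_def
  proof (intro conjI allI impI, goal_cases)
    case (1 U)
    have "subspace (sect ?A U k)" for k
    proof (rule subspaceI)
      fix f g assume "f \<in> sect ?A U k" "g \<in> sect ?A U k"
      then show "f + g \<in> sect ?A U k"
        unfolding odd_model_sect by (metis add.right_neutral plus_fun_apply)
    qed (auto simp: odd_model_sect scaleR_fun_def)
    moreover have "sect ?A U i \<inter> sect ?A U j = {0}" if "i \<noteq> j" for i j
    proof -
      have "f = 0" if "f \<in> sect ?A U i" "f \<in> sect ?A U j" for f
      proof (intro ext)
        fix p x
        show "f p x = 0 p x" using that \<open>i \<noteq> j\<close> unfolding odd_model_sect
          by (metis odd_index_neq_zero(1) zero_fun_apply)
      qed
      then show ?thesis by (auto simp: odd_model_sect)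
    qed
    ultimately show ?case by (simp add: graded_vector_space_def)
  next
    case (2 U V k)
    then show ?case by (auto simp: odd_model_sect local_model_restr)
  next
    case (3 U V k)
    then show ?case by (auto simp: linear_map_on_def local_model_restr scaleR_fun_def intro!: ext)
  next
    case (4 U k)
    then show ?case using odd_model_outside[of _ U k]
      by (intro ballI ext) (simp add: local_model_restr)
  next
    case (5 U V W k)
    then show ?case by (auto simp: local_model_restr intro!: ext)
  next
    case (6 \<U> k \<sigma>)
    then show ?case by (elim conjE) (rule glue)
  qed
qed

lemma odd_model_algebra: "sheaf_of_graded_algebras pt odd_model"
proof -
  let ?A = odd_model
  have zero: "f p x = 0" if "f \<in> sect ?A U k" "\<not> (p = 0 \<and> k = 0 \<or> p = odd_index \<and> k = 1)" for f U k p x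
    using that unfolding odd_model_sect by blast
  have one: "gone ?A U p x = (if p = 0 \<and> x \<in> U then 1 else 0)" for U p x
    by (simp add: local_model_gone)
  have 1: "gmult ?A U (gone ?A U) f = f" "gmult ?A U f (gone ?A U) = f" if f: "f \<in> sect ?A U k" for U f k
    using zero[OF f] odd_model_outside[OF f] by (auto simp: odd_model_gmult one odd_index_neq_zero intro!: ext)
  have 2: "gmult ?A U (gmult ?A U f g) h = gmult ?A U f (gmult ?A U g h)" for U f g h
    by (intro ext) (simp add: odd_model_gmult odd_index_neq_zero algebra_simps)
  have 3: "gmult ?A U f g = (if odd (i * j) then - gmult ?A U g f else gmult ?A U g f)"
    if "f \<in> sect ?A U i" "g \<in> sect ?A U j" for U f g i j
  proof -
    have sym: "gmult ?A U f g = gmult ?A U g f"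
      by (intro ext) (simp add: odd_model_gmult)
    \<comment> \<open>The coefficient formula is symmetric, with no sign. If both degrees are odd,
      both bodies vanish, so the product is 0 and equals its negative.\<close>
    have "gmult ?A U g f = 0" if "odd (i * j)"
    proof -
      have "i \<noteq> 0" "j \<noteq> 0" using that by auto
      then have "f 0 x = 0" "g 0 x = 0" for x
        using zero \<open>f \<in> sect ?A U i\<close> \<open>g \<in> sect ?A U j\<close> odd_index_neq_zero by metis+
      then show ?thesis by (intro ext) (simp add: odd_model_gmult)
    qed
    then show ?thesis using sym by simp
  qed
  have 4: "gone ?A U \<in> sect ?A U 0" for U
    by (auto simp: odd_model_sect one)
  have 5: "graded_bilinear (sect ?A U) (sect ?A U) (sect ?A U) (gmult ?A U)" for U
    unfolding graded_bilinear_def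
  proof (intro allI conjI ballI)
    fix i j f g assume f: "f \<in> sect ?A U i" and g: "g \<in> sect ?A U j"
    show "gmult ?A U f g \<in> sect ?A U (i + j)"
      unfolding odd_model_sect
    proof (intro allI impI)
      fix r x assume "gmult ?A U f g r x \<noteq> 0"
      then have "r = 0 \<and> f 0 x \<noteq> 0 \<and> g 0 x \<noteq> 0 \<or>
          r = odd_index \<and> (f 0 x \<noteq> 0 \<and> g odd_index x \<noteq> 0 \<or> f odd_index x \<noteq> 0 \<and> g 0 x \<noteq> 0)"
        by (auto simp: odd_model_gmult split: if_splits)
      then show "x \<in> U \<and> (r = 0 \<and> i + j = 0 \<or> r = odd_index \<and> i + j = 1)"
        using f g odd_index_neq_zero unfolding odd_model_sect by (metis add.left_neutral add.right_neutral)
    qed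
  qed (auto simp: linear_map_on_def odd_model_gmult scaleR_fun_def algebra_simps intro!: ext)
  have 6: "restr ?A U V (gone ?A U) = gone ?A V" if "V \<subseteq> U" for U V
    using that by (intro ext) (auto simp: local_model_restr one)
  have 7: "restr ?A U V (gmult ?A U f g) = gmult ?A V (restr ?A U V f) (restr ?A U V g)" for U V f g
    by (intro ext) (simp add: local_model_restr odd_model_gmult)
  show ?thesis
    unfolding sheaf_of_graded_algebras_def
    by (intro conjI allI impI ballI odd_model_vector_sheaf; (elim conjE)?; rule 1 2 3 4 5 6 7; assumption)
qed

text \<open>The structure sheaf is the local model itself, so the identity is a global
  chart.\<close>

lemma odd_model_manifold: "graded_manifold pt odd_model"
proof -
  define dm :: "int \<Rightarrow> nat" where "dm j = (if j = 1 then 1 else 0)" for j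
  have dm0: "dm 0 = 0" by (simp add: dm_def)
  have "graded_chart pt odd_model dm [1] {0} id (\<lambda>U f. f)"
    unfolding graded_chart_def Let_def dm0 image_id id_apply
    by (intro conjI allI impI ballI)
      (simp_all add: graded_variables_def dm_def openin_pt linear_map_on_def bij_betw_def
        homeomorphic_map_id[unfolded id_def])
  then have "\<forall>m\<in>topspace pt. \<exists>ds V \<phi> \<psi>. m \<in> V \<and> graded_chart pt odd_model dm ds V \<phi> \<psi>"
    unfolding topspace_pt by blast
  moreover have "finite {j. dm j \<noteq> 0}" by (simp add: dm_def)
  moreover have "Hausdorff_space pt" by (simp add: Hausdorff_space_def topspace_pt)
  moreover have "second_countable pt"
    unfolding second_countable_def
    by (rule exI[of _ "{{0}}"]) (auto simp: openin_pt)
  moreover have "connected_space pt"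
    unfolding connected_space_def by (auto simp: openin_pt)
  ultimately show ?thesis
    unfolding graded_manifold_def graded_manifold_of_dim_def using odd_model_algebra by blast
qed

interpretation pt: odd_function pt odd_model odd_coordinate
proof
  show "graded_manifold pt odd_model" by (rule odd_model_manifold)
  show "odd_coordinate \<in> sect odd_model (topspace pt) 1"
    by (simp add: odd_model_sect odd_coordinate_def topspace_pt)
qed

text \<open>This excludes that the subbundle property fails merely because of gluing. A family of
  open sets covering the point has a member equal to its union; over the empty set 0 is the only
  section.\<close>

lemma pt_image_submodule:
  "submodule_sheaf pt odd_model (free_module odd_model 0) (image_sheaf (free_module odd_model 1) pt.times_\<xi>)"
proof (rule pt.\<xi>.image_submoduleI)
  let ?L = "image_sheaf (free_module odd_model 1) pt.times_\<xi>" and ?P = "free_module odd_model 0"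
  fix \<U> k s
  assume o: "\<And>U. U \<in> \<U> \<Longrightarrow> openin pt U" and s: "s \<in> sect ?P (\<Union>\<U>) k"
    and loc: "\<And>U. U \<in> \<U> \<Longrightarrow> restr ?P (\<Union>\<U>) U s \<in> ?L U k"
  have oU: "openin pt (\<Union>\<U>)" using o by blast
  show "s \<in> ?L (\<Union>\<U>) k"
  proof (cases "0 \<in> \<Union>\<U>")
    case True
    then obtain U where U: "U \<in> \<U>" "0 \<in> U" by blast
    then have "U = \<Union>\<U>" using o[OF U(1)] oU True unfolding openin_pt by blast
    then show ?thesis using loc[OF U(1)] pt.\<xi>.P.S.restr_id[OF oU s] by simp
  next
    case False
    then have empty: "\<Union>\<U> = {}" using oU unfolding openin_pt by blast
    obtain f where f: "s = (\<lambda>_. f)" "f \<in> sect odd_model (\<Union>\<U>) k"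
      using s by (auto simp: free_module_simps)
    have "f p x = 0" for p x
      using odd_model_outside[OF f(2)] empty by simp
    then have "s = 0" unfolding f(1) by (intro ext) simp
    then show ?thesis using subspace_0[OF pt.\<xi>.image_subspace[OF oU]] by simp
  qed
qed

lemma pt_image_not_subbundle:
  "\<not> subbundle pt odd_model (free_module odd_model 0) (image_sheaf (free_module odd_model 1) pt.times_\<xi>)"
proof (rule pt.image_\<xi>_not_subbundle)
  show "topspace pt \<noteq> {}" by (simp add: topspace_pt)
  show "pt.\<xi>_on U \<noteq> 0" if "openin pt U" "U \<noteq> {}" for U
  proof -
    have "pt.\<xi>_on U odd_index 0 = 1"
      using that by (simp add: openin_pt pt.\<xi>_on_def local_model_restr odd_coordinate_def)
    then show ?thesis by auto
  qed
qed

theorem proposition3p14: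
  shows
    "(\<forall>(X :: 'm topology) (A :: ('m, 'a::real_vector) galgebra)
       (S :: ('m, 'a, 's::real_vector) gmodule) (P :: ('m, 'a, 'p::real_vector) gmodule) F.
       graded_manifold X A \<and> graded_vector_bundle X A S \<and> graded_vector_bundle X A P \<and>
       bundle_morphism X A S P F \<longrightarrow>
         ((\<forall>m\<in>topspace X. fiber_injective X A S P F m) \<longrightarrow> subbundle X A P (image_sheaf S F)) \<and>
         (surjective_morphism X S P F \<longrightarrow> subbundle X A S (kernel_sheaf S F)))
     \<and>
     (\<exists>(X :: (nat \<Rightarrow> real) topology) (A :: (nat \<Rightarrow> real, power_series) galgebra)
       (S :: (nat \<Rightarrow> real, power_series, nat \<Rightarrow> power_series) gmodule)
       (P :: (nat \<Rightarrow> real, power_series, nat \<Rightarrow> power_series) gmodule) F.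
       graded_manifold X A \<and> graded_vector_bundle X A S \<and> graded_vector_bundle X A P \<and>
       bundle_morphism X A S P F \<and>
       (\<exists>\<delta>. \<forall>m\<in>topspace X. \<forall>k. has_dimension (fiber_image X A S P F m k) (\<delta> k)) \<and>
       submodule_sheaf X A P (image_sheaf S F) \<and>
       \<not> subbundle X A P (image_sheaf S F))"
proof (intro conjI allI impI, goal_cases)
  case (1 X A S P F)
  then interpret bundle_map X A S P F
    by unfold_locales (auto simp: graded_vector_bundle_def)
  show ?case using 1 by (intro image_subbundle) blast
next
  case (2 X A S P F)
  then interpret bundle_map X A S P F
    by unfold_locales (auto simp: graded_vector_bundle_def)
  show ?case using 2 by (intro kernel_subbundle)
next
  case 3
  let ?S = "free_module odd_model 1" and ?P = "free_module odd_model 0"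
  have "\<exists>\<delta>. \<forall>m\<in>topspace pt. \<forall>k. has_dimension (fiber_image pt odd_model ?S ?P pt.times_\<xi> m k) (\<delta> k)"
    using pt.fiber_image_zero by (intro exI[of _ "\<lambda>_. 0"]) blast
  then show ?case
    using odd_model_manifold pt.free_module_bundle pt.times_\<xi>_morphism
      pt_image_submodule pt_image_not_subbundle
    by (intro exI[of _ pt] exI[of _ odd_model] exI[of _ ?S] exI[of _ ?P] exI[of _ pt.times_\<xi>] conjI)
qed

end
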